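(* For every set $T$, the category $\mathsf{FRg}(T)$ is the free regular category on $T$; i.e. there is an adjunction in which $\mathsf{FRg}(-)\colon\mathrm{Set}\to\mathsf{RgCat}$ is left adjoint to the functor $\mathrm{Ob}\colon\mathsf{RgCat}\to\mathrm{Set}$ sending a regular category to its set of objects.
   Context: A regular category is a category with finite limits, coequalizers of kernel pairs, and pullback-stable regular epimorphisms. A regular functor preserves finite limits and regular epimorphisms. $\mathsf{RgCat}$ is the category of (small) regular categories and regular functors. For a set $T$, let $\mathcal{P}_f(T)$ be the poset of finite subsets of $T$ and $\mathrm{inc}\colon\mathcal{P}_f(T)\to\mathrm{FinSet}$ the inclusion. $\mathsf{FRg}(T)$ is the comma category $(\mathcal{P}_f(T)^{\mathrm{op}}\downarrow\mathrm{FinSet}^{\mathrm{op}})$ of $\mathrm{inc}^{\mathrm{op}}\colon\mathcal{P}_f(T)^{\mathrm{op}}\to\mathrm{FinSet}^{\mathrm{op}}$ and $\mathrm{id}\colon\mathrm{FinSet}^{\mathrm{op}}\to\mathrm{FinSet}^{\mathrm{op}}$. Concretely (up to equivalence, working in the skeleton), its objects are triples $\Gamma=(n,S,\tau)$ with $n\in\mathbb{N}$, $S\subseteq T$ finite and $\tau\colon\underline{n}\to S$ a function, where $\underline{n}=\{1,\dots,n\}$; a morphism $(n,S,\tau)\to(n',S',\tau')$ exists only when $S'\subseteq S$ and is a function $f\colon\underline{n}'\to\underline{n}$ such that $\tau(f(i))=\tau'(i)$ for all $i\in\underline{n}'$. $\mathsf{FRg}(T)$ is a regular category. A function $f\colon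 T\to T'$ induces the functor $(n,S,\tau)\mapsto(n,f(S),f\circ\tau)$. The unit of the adjunction sends $t\in T$ to the unary context $\langle t\rangle=(1,\{t\},!)$, and the counit $\mathsf{FRg}(\mathrm{Ob}\,\mathcal{R})\to\mathcal{R}$ sends $(n,S,\tau)$ to $\prod_{i\in\underline{n}}\tau(i)\times\prod_{s\in S}\mathrm{Supp}(s)$, where $\mathrm{Supp}(s)$, the support of $s$, is the image of the unique map from $s$ to the terminal object.
   Formalization: The adjunction is proved up to isomorphism: each map T→Ob R extends to a regular functor, unique up to unique natural isomorphism; counit naturality and triangle identities hold up to isomorphism. A strict adjunction fails: for T=∅, regular functors to R are its terminal objects. *)

theory Defs
  imports "HOL-Library.FuncSet"
begin

section \<open>Categories and functors\<close>

record ('o, 'a) precategory =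
  Obj :: "'o set"
  Arr :: "'a set"
  Dom :: "'a \<Rightarrow> 'o"
  Cod :: "'a \<Rightarrow> 'o"
  Ident :: "'o \<Rightarrow> 'a"
  Comp :: "'a \<Rightarrow> 'a \<Rightarrow> 'a"  (infixl "\<cdot>\<index>" 70)

text \<open>Composition is written in applicative order: \<open>g \<cdot>\<^bsub>C\<^esub> f\<close> is "first f, then g".\<close>

definition hom :: "('o, 'a, 'm) precategory_scheme \<Rightarrow> 'o \<Rightarrow> 'o \<Rightarrow> 'a set" where
  "hom C x y = {f \<in> Arr C. Dom C f = x \<and> Cod C f = y}"

definition category :: "('o, 'a, 'm) precategory_scheme \<Rightarrow> bool" where
  "category C \<longleftrightarrow>
     (\<forall>f\<in>Arr C. Dom C f \<in> Obj C \<and> Cod C f \<in> Obj C) \<and>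
     (\<forall>x\<in>Obj C. Ident C x \<in> hom C x x) \<and>
     (\<forall>f\<in>Arr C. \<forall>g\<in>Arr C. Cod C f = Dom C g \<longrightarrow> g \<cdot>\<^bsub>C\<^esub> f \<in> hom C (Dom C f) (Cod C g)) \<and>
     (\<forall>f\<in>Arr C. f \<cdot>\<^bsub>C\<^esub> Ident C (Dom C f) = f \<and> Ident C (Cod C f) \<cdot>\<^bsub>C\<^esub> f = f) \<and>
     (\<forall>f\<in>Arr C. \<forall>g\<in>Arr C. \<forall>h\<in>Arr C. Cod C f = Dom C g \<and> Cod C g = Dom C h \<longrightarrow>
        h \<cdot>\<^bsub>C\<^esub> (g \<cdot>\<^bsub>C\<^esub> f) = (h \<cdot>\<^bsub>C\<^esub> g) \<cdot>\<^bsub>C\<^esub> f)"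

record ('o, 'a, 'p, 'b) funct =
  ObjMap :: "'o \<Rightarrow> 'p"
  ArrMap :: "'a \<Rightarrow> 'b"

definition is_functor ::
    "('o, 'a) precategory \<Rightarrow> ('p, 'b) precategory \<Rightarrow> ('o, 'a, 'p, 'b) funct \<Rightarrow> bool" where
  "is_functor C D F \<longleftrightarrow> category C \<and> category D \<and>
     (\<forall>x\<in>Obj C. ObjMap F x \<in> Obj D) \<and>
     (\<forall>f\<in>Arr C. ArrMap F f \<in> hom D (ObjMap F (Dom C f)) (ObjMap F (Cod C f))) \<and>
     (\<forall>x\<in>Obj C. ArrMap F (Ident C x) = Ident D (ObjMap F x)) \<and>
     (\<forall>f\<in>Arr C. \<forall>g\<in>Arr C. Cod C f = Dom C g \<longrightarrow>
        ArrMap F (g \<cdot>\<^bsub>C\<^esub> f) = ArrMap F g \<cdot>\<^bsub>D\<^esub> ArrMap F f)"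

definition id_funct :: "('o, 'a, 'o, 'a) funct" where
  "id_funct = \<lparr>ObjMap = (\<lambda>x. x), ArrMap = (\<lambda>f. f)\<rparr>"

definition comp_funct ::
    "('p, 'b, 'q, 'c) funct \<Rightarrow> ('o, 'a, 'p, 'b) funct \<Rightarrow> ('o, 'a, 'q, 'c) funct" where
  "comp_funct G F = \<lparr>ObjMap = ObjMap G \<circ> ObjMap F, ArrMap = ArrMap G \<circ> ArrMap F\<rparr>"

text \<open>Equality of functors with domain \<open>C\<close>: values outside \<open>C\<close> are junk and are ignored.\<close>

definition funct_eq ::
    "('o, 'a) precategory \<Rightarrow> ('o, 'a, 'p, 'b) funct \<Rightarrow> ('o, 'a, 'p, 'b) funct \<Rightarrow> bool" where
  "funct_eq C F G \<longleftrightarrow>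
     (\<forall>x\<in>Obj C. ObjMap F x = ObjMap G x) \<and> (\<forall>f\<in>Arr C. ArrMap F f = ArrMap G f)"

definition isos :: "('o, 'a) precategory \<Rightarrow> 'o \<Rightarrow> 'o \<Rightarrow> 'a set" where
  "isos C x y = {f \<in> hom C x y. \<exists>g\<in>hom C y x. g \<cdot>\<^bsub>C\<^esub> f = Ident C x \<and> f \<cdot>\<^bsub>C\<^esub> g = Ident C y}"

text \<open>Natural isomorphisms \<open>F \<Rightarrow> G\<close>. Families are required to be extensional, so that equality of
  natural isomorphisms is equality of functions.\<close>

definition nat_isos ::
    "('o, 'a) precategory \<Rightarrow> ('p, 'b) precategory \<Rightarrow>
     ('o, 'a, 'p, 'b) funct \<Rightarrow> ('o, 'a, 'p, 'b) funct \<Rightarrow> ('o \<Rightarrow> 'b) set" where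
  "nat_isos C D F G =
     {\<beta> \<in> extensional (Obj C).
        (\<forall>x\<in>Obj C. \<beta> x \<in> isos D (ObjMap F x) (ObjMap G x)) \<and>
        (\<forall>f\<in>Arr C. \<beta> (Cod C f) \<cdot>\<^bsub>D\<^esub> ArrMap F f = ArrMap G f \<cdot>\<^bsub>D\<^esub> \<beta> (Dom C f))}"


section \<open>Limits, regular categories and regular functors\<close>

definition is_cone ::
    "('j, 'k) precategory \<Rightarrow> ('o, 'a) precategory \<Rightarrow> ('j, 'k, 'o, 'a) funct \<Rightarrow> 'o \<Rightarrow> ('j \<Rightarrow> 'a) \<Rightarrow> bool" where
  "is_cone J C D c l \<longleftrightarrow> c \<in> Obj C \<and>
     (\<forall>j\<in>Obj J. l j \<in> hom C c (ObjMap D j)) \<and>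
     (\<forall>u\<in>Arr J. ArrMap D u \<cdot>\<^bsub>C\<^esub> l (Dom J u) = l (Cod J u))"

definition is_limit ::
    "('j, 'k) precategory \<Rightarrow> ('o, 'a) precategory \<Rightarrow> ('j, 'k, 'o, 'a) funct \<Rightarrow> 'o \<Rightarrow> ('j \<Rightarrow> 'a) \<Rightarrow> bool" where
  "is_limit J C D c l \<longleftrightarrow> is_cone J C D c l \<and>
     (\<forall>c' l'. is_cone J C D c' l' \<longrightarrow>
        (\<exists>!h. h \<in> hom C c' c \<and> (\<forall>j\<in>Obj J. l j \<cdot>\<^bsub>C\<^esub> h = l' j)))"

text \<open>Every finite category is isomorphic to one whose objects and arrows are natural numbers, so
  finite limits may be indexed by such shapes.\<close>

definition finite_category :: "(nat, nat) precategory \<Rightarrow> bool" where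
  "finite_category J \<longleftrightarrow> category J \<and> finite (Obj J) \<and> finite (Arr J)"

definition has_finite_limits :: "('o, 'a) precategory \<Rightarrow> bool" where
  "has_finite_limits C \<longleftrightarrow>
     (\<forall>J D. finite_category J \<and> is_functor J C D \<longrightarrow> (\<exists>c l. is_limit J C D c l))"

definition is_terminal :: "('o, 'a) precategory \<Rightarrow> 'o \<Rightarrow> bool" where
  "is_terminal C t \<longleftrightarrow> t \<in> Obj C \<and> (\<forall>x\<in>Obj C. \<exists>!f. f \<in> hom C x t)"

text \<open>\<open>P\<close> with projections \<open>p i\<close> is a product of the family \<open>A i\<close>, \<open>i \<in> I\<close>.\<close>

definition is_product ::
    "('o, 'a) precategory \<Rightarrow> 'i set \<Rightarrow> ('i \<Rightarrow> 'o) \<Rightarrow> 'o \<Rightarrow> ('i \<Rightarrow> 'a) \<Rightarrow> bool" where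
  "is_product C I A P p \<longleftrightarrow> P \<in> Obj C \<and> (\<forall>i\<in>I. p i \<in> hom C P (A i)) \<and>
     (\<forall>X\<in>Obj C. \<forall>q. (\<forall>i\<in>I. q i \<in> hom C X (A i)) \<longrightarrow>
        (\<exists>!h. h \<in> hom C X P \<and> (\<forall>i\<in>I. p i \<cdot>\<^bsub>C\<^esub> h = q i)))"

text \<open>The square with \<open>f \<cdot> p = g \<cdot> q\<close> is a pullback of \<open>f\<close> and \<open>g\<close>.\<close>

definition is_pullback ::
    "('o, 'a) precategory \<Rightarrow> 'a \<Rightarrow> 'a \<Rightarrow> 'a \<Rightarrow> 'a \<Rightarrow> bool" where
  "is_pullback C f g p q \<longleftrightarrow>
     f \<in> Arr C \<and> g \<in> Arr C \<and> p \<in> Arr C \<and> q \<in> Arr C \<and>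
     Cod C f = Cod C g \<and> Dom C p = Dom C q \<and> Cod C p = Dom C f \<and> Cod C q = Dom C g \<and>
     f \<cdot>\<^bsub>C\<^esub> p = g \<cdot>\<^bsub>C\<^esub> q \<and>
     (\<forall>w. \<forall>p'\<in>hom C w (Dom C f). \<forall>q'\<in>hom C w (Dom C g). f \<cdot>\<^bsub>C\<^esub> p' = g \<cdot>\<^bsub>C\<^esub> q' \<longrightarrow>
        (\<exists>!h. h \<in> hom C w (Dom C p) \<and> p \<cdot>\<^bsub>C\<^esub> h = p' \<and> q \<cdot>\<^bsub>C\<^esub> h = q'))"

definition is_coequalizer :: "('o, 'a) precategory \<Rightarrow> 'a \<Rightarrow> 'a \<Rightarrow> 'a \<Rightarrow> bool" where
  "is_coequalizer C g h e \<longleftrightarrow>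
     g \<in> Arr C \<and> h \<in> Arr C \<and> e \<in> Arr C \<and>
     Dom C g = Dom C h \<and> Cod C g = Cod C h \<and> Dom C e = Cod C g \<and>
     e \<cdot>\<^bsub>C\<^esub> g = e \<cdot>\<^bsub>C\<^esub> h \<and>
     (\<forall>z. \<forall>k\<in>hom C (Cod C g) z. k \<cdot>\<^bsub>C\<^esub> g = k \<cdot>\<^bsub>C\<^esub> h \<longrightarrow>
        (\<exists>!l. l \<in> hom C (Cod C e) z \<and> l \<cdot>\<^bsub>C\<^esub> e = k))"

definition is_regular_epi :: "('o, 'a) precategory \<Rightarrow> 'a \<Rightarrow> bool" where
  "is_regular_epi C e \<longleftrightarrow> (\<exists>g h. is_coequalizer C g h e)"

definition is_mono :: "('o, 'a) precategory \<Rightarrow> 'a \<Rightarrow> bool" where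
  "is_mono C m \<longleftrightarrow> m \<in> Arr C \<and>
     (\<forall>w. \<forall>f\<in>hom C w (Dom C m). \<forall>g\<in>hom C w (Dom C m). m \<cdot>\<^bsub>C\<^esub> f = m \<cdot>\<^bsub>C\<^esub> g \<longrightarrow> f = g)"

text \<open>A kernel pair of \<open>f\<close> is a pullback of \<open>f\<close> along itself.\<close>

definition regular_category :: "('o, 'a) precategory \<Rightarrow> bool" where
  "regular_category C \<longleftrightarrow> category C \<and> has_finite_limits C \<and>
     (\<forall>f p q. is_pullback C f f p q \<longrightarrow> (\<exists>e. is_coequalizer C p q e)) \<and>
     (\<forall>e g p q. is_regular_epi C e \<and> is_pullback C e g p q \<longrightarrow> is_regular_epi C q)"

definition preserves_finite_limits ::
    "('o, 'a) precategory \<Rightarrow> ('p, 'b) precategory \<Rightarrow> ('o, 'a, 'p, 'b) funct \<Rightarrow> bool" where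
  "preserves_finite_limits C C' F \<longleftrightarrow>
     (\<forall>J D c l. finite_category J \<and> is_functor J C D \<and> is_limit J C D c l \<longrightarrow>
        is_limit J C' (comp_funct F D) (ObjMap F c) (ArrMap F \<circ> l))"

text \<open>Morphisms of \<open>RgCat\<close>.\<close>

definition regular_functor ::
    "('o, 'a) precategory \<Rightarrow> ('p, 'b) precategory \<Rightarrow> ('o, 'a, 'p, 'b) funct \<Rightarrow> bool" where
  "regular_functor C D F \<longleftrightarrow>
     regular_category C \<and> regular_category D \<and> is_functor C D F \<and>
     preserves_finite_limits C D F \<and>
     (\<forall>e. is_regular_epi C e \<longrightarrow> is_regular_epi D (ArrMap F e))"

text \<open>The functor \<open>Ob\<close> sends \<open>R\<close> to the set \<open>Obj R\<close> and \<open>H\<close> to its map on objects. Morphisms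
  \<open>A \<rightarrow> B\<close> of the category of sets are the elements of \<open>A \<rightarrow>\<^sub>E B\<close>, composed by \<^const>\<open>compose\<close>.\<close>

definition Ob_map :: "('o, 'a) precategory \<Rightarrow> ('o, 'a, 'p, 'b) funct \<Rightarrow> 'o \<Rightarrow> 'p" where
  "Ob_map R H = restrict (ObjMap H) (Obj R)"

text \<open>\<open>u\<close> is a support of \<open>s\<close>: an image (regular epi followed by mono) of the unique map from \<open>s\<close> to a
  terminal object.\<close>

definition is_image :: "('o, 'a) precategory \<Rightarrow> 'a \<Rightarrow> 'o \<Rightarrow> bool" where
  "is_image C f u \<longleftrightarrow>
     (\<exists>e\<in>hom C (Dom C f) u. \<exists>m\<in>hom C u (Cod C f).
        is_regular_epi C e \<and> is_mono C m \<and> f = m \<cdot>\<^bsub>C\<^esub> e)"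

definition is_support :: "('o, 'a) precategory \<Rightarrow> 'o \<Rightarrow> 'o \<Rightarrow> bool" where
  "is_support C s u \<longleftrightarrow> (\<exists>t. is_terminal C t \<and> (\<exists>f\<in>hom C s t. is_image C f u))"


section \<open>The category \<open>FRg T\<close>\<close>

text \<open>Objects are triples \<open>(n, S, \<tau>)\<close>; an arrow from \<open>\<Gamma> = (n, S, \<tau>)\<close> to \<open>\<Gamma>' = (n', S', \<tau>')\<close> is
  \<open>(\<Gamma>, f, \<Gamma>')\<close> with \<open>f\<close> a function \<^emph>\<open>from\<close> \<open>{1..n'}\<close> \<^emph>\<open>to\<close> \<open>{1..n}\<close>.\<close>

type_synonym 't ctx = "nat \<times> 't set \<times> (nat \<Rightarrow> 't)"
type_synonym 't ctx_arr = "'t ctx \<times> (nat \<Rightarrow> nat) \<times> 't ctx"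

definition FRg_obj :: "'t set \<Rightarrow> 't ctx set" where
  "FRg_obj T = {(n, S, \<tau>). S \<subseteq> T \<and> finite S \<and> \<tau> \<in> {1..n} \<rightarrow>\<^sub>E S}"

definition FRg_arr :: "'t set \<Rightarrow> 't ctx_arr set" where
  "FRg_arr T = {((n, S, \<tau>), f, (n', S', \<tau>')).
     (n, S, \<tau>) \<in> FRg_obj T \<and> (n', S', \<tau>') \<in> FRg_obj T \<and> S' \<subseteq> S \<and>
     f \<in> {1..n'} \<rightarrow>\<^sub>E {1..n} \<and> (\<forall>i\<in>{1..n'}. \<tau> (f i) = \<tau>' i)}"

definition FRg :: "'t set \<Rightarrow> ('t ctx, 't ctx_arr) precategory" where
  "FRg T = \<lparr>Obj = FRg_obj T,
     Arr = FRg_arr T,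
     Dom = (\<lambda>(\<Gamma>, f, \<Gamma>'). \<Gamma>),
     Cod = (\<lambda>(\<Gamma>, f, \<Gamma>'). \<Gamma>'),
     Ident = (\<lambda>(n, S, \<tau>). ((n, S, \<tau>), \<lambda>i\<in>{1..n}. i, (n, S, \<tau>))),
     Comp = (\<lambda>(\<Gamma>\<^sub>2, g, (n, S, \<tau>)) (\<Gamma>\<^sub>1, f, \<Gamma>\<^sub>2'). (\<Gamma>\<^sub>1, compose {1..n} f g, (n, S, \<tau>)))\<rparr>"

fun FRg_map_obj :: "('t \<Rightarrow> 's) \<Rightarrow> 't ctx \<Rightarrow> 's ctx" where
  "FRg_map_obj f (n, S, \<tau>) = (n, f ` S, compose {1..n} f \<tau>)"

definition FRg_map :: "('t \<Rightarrow> 's) \<Rightarrow> ('t ctx, 't ctx_arr, 's ctx, 's ctx_arr) funct" where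
  "FRg_map f = \<lparr>ObjMap = FRg_map_obj f,
     ArrMap = (\<lambda>(\<Gamma>, u, \<Gamma>'). (FRg_map_obj f \<Gamma>, u, FRg_map_obj f \<Gamma>'))\<rparr>"

definition FRg_unit :: "'t set \<Rightarrow> 't \<Rightarrow> 't ctx" where
  "FRg_unit T = (\<lambda>t\<in>T. (1, {t}, \<lambda>i\<in>{1..1}. t))"

text \<open>\<open>E\<close> is a version of the counit \<open>FRg (Obj R) \<rightarrow> R\<close>, for a choice of supports \<open>Supp\<close> and of product
  cones \<open>p \<Gamma>\<close>: it sends \<open>(n, S, \<tau>)\<close> to the product of the \<open>\<tau> i\<close> (index \<open>Inl i\<close>) and of the
  \<open>Supp s\<close> (index \<open>Inr s\<close>), and an arrow to the induced map of products.\<close>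

definition is_counit ::
    "('o, 'a) precategory \<Rightarrow> ('o \<Rightarrow> 'o) \<Rightarrow> ('o ctx \<Rightarrow> nat + 'o \<Rightarrow> 'a) \<Rightarrow>
     ('o ctx, 'o ctx_arr, 'o, 'a) funct \<Rightarrow> bool" where
  "is_counit R Supp p E \<longleftrightarrow>
     (\<forall>s\<in>Obj R. is_support R s (Supp s)) \<and>
     (\<forall>(n, S, \<tau>)\<in>Obj (FRg (Obj R)).
        is_product R ({1..n} <+> S) (case_sum \<tau> Supp) (ObjMap E (n, S, \<tau>)) (p (n, S, \<tau>))) \<and>
     (\<forall>((n, S, \<tau>), f, (n', S', \<tau>'))\<in>Arr (FRg (Obj R)).
        let \<Gamma> = (n, S, \<tau>); \<Gamma>' = (n', S', \<tau>'); h = ArrMap E (\<Gamma>, f, \<Gamma>') in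
          h \<in> hom R (ObjMap E \<Gamma>) (ObjMap E \<Gamma>') \<and>
          (\<forall>i\<in>{1..n'}. p \<Gamma>' (Inl i) \<cdot>\<^bsub>R\<^esub> h = p \<Gamma> (Inl (f i))) \<and>
          (\<forall>s\<in>S'. p \<Gamma>' (Inr s) \<cdot>\<^bsub>R\<^esub> h = p \<Gamma> (Inr s)))"

end

theory Submission
  imports Defs
begin

text \<open>A limit of contexts is a colimit of the underlying finite sets together with the union of the sets of
  sorts, and a map of contexts is a regular epimorphism iff its function is injective and both sets of
  sorts agree. Every context \<open>(n, S, \<tau>)\<close> is the product of the unary contexts \<open>\<langle>\<tau> i\<rangle>\<close> and of the
  supports \<open>(0, {s}, !)\<close>. A regular functor preserves these products and supports, hence is determined up
  to unique isomorphism by its values on unary contexts. Conversely, the counit preserves finite limits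
  because a cone over its values is a compatible family of arrows, to which the universal property of the
  colimit of finite sets applies. It preserves regular epimorphisms because these
  only omit factors \<open>s\<close> whose support remains, and \<open>A \<times> s \<rightarrow> A\<close> is then a pullback of \<open>s \<rightarrow> Supp s\<close>.
  All other extensions, and all naturality statements, are obtained from the counit by composition.\<close>

section \<open>Categories and regular epimorphisms\<close>

text \<open>Products and supports are determined only up to isomorphism, hence so are the values of
  a regular functor on contexts; this is why extensions are unique, and the counit natural, only up
  to isomorphism. Existence can still be strict, because the counit can be chosen to send
  \<open>unit_ctx r\<close> to \<open>r\<close> itself. The set of sorts is kept beside \<tau>
  because a sort may survive without a variable: omitting the last variable of sort \<open>s\<close>
  leaves the support of \<open>s\<close> behind. Limits are handled through
  \<open>compatible\<close> families, that is, cocones under the underlying finite sets with values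
  in an arbitrary type. The factorisation of such a family through a limit is proved once for all
  value types and then used for numbers (legs of cones of contexts), for sorts (the labels \<tau>)
  and for arrows of a regular category (cones over values of the counit). Any two arrows into a
  support agree. Hence an arrow into a value of the counit, or of any regular functor on contexts,
  is determined by its components at the variables, and most equations below are checked
  there.\<close>

lemma comp_hom:
  fixes C (structure)
  assumes "category C" "f \<in> hom C x y" "g \<in> hom C y z"
  shows "g \<cdot> f \<in> hom C x z"
  using assms unfolding category_def hom_def by auto

lemma comp_assoc:
  fixes C (structure)
  assumes "category C" "f \<in> hom C x y" "g \<in> hom C y z" "h \<in> hom C z w"
  shows "h \<cdot> (g \<cdot> f) = h \<cdot> g \<cdot> f"
  using assms unfolding category_def hom_def by auto

lemma ident_hom: "category C \<Longrightarrow> x \<in> Obj C \<Longrightarrow> Ident C x \<in> hom C x x"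
  unfolding category_def by auto

lemma comp_ident:
  fixes C (structure)
  assumes "category C" "f \<in> hom C x y"
  shows "f \<cdot> Ident C x = f" "Ident C y \<cdot> f = f"
  using assms unfolding category_def hom_def by auto

lemma hom_obj:
  assumes "category C" "f \<in> hom C x y"
  shows "x \<in> Obj C" "y \<in> Obj C"
  using assms unfolding category_def hom_def by auto

lemma arr_hom: "f \<in> Arr C \<Longrightarrow> f \<in> hom C (Dom C f) (Cod C f)"
  by (simp add: hom_def)

lemma homD:
  assumes "f \<in> hom C x y"
  shows "f \<in> Arr C" "Dom C f = x" "Cod C f = y"
  using assms by (auto simp: hom_def)

lemma coequalizer_factor:
  fixes C (structure)
  assumes "is_coequalizer C g h e" "k \<in> hom C (Cod C g) z" "k \<cdot> g = k \<cdot> h"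
  obtains l where "l \<in> hom C (Cod C e) z" "l \<cdot> e = k"
  using assms unfolding is_coequalizer_def by blast

text \<open>Both arrows are factorisations of the same map \<open>a \<cdot> e\<close>, which
  identifies the pair coequalized by \<open>e\<close>, so uniqueness in the coequalizer
  applies.\<close>

lemma regular_epi_cancel:
  fixes C (structure)
  assumes C: "category C" and e: "is_regular_epi C e" "e \<in> hom C x y"
    and ab: "a \<in> hom C y z" "b \<in> hom C y z" "a \<cdot> e = b \<cdot> e"
  shows "a = b"
proof -
  obtain g h where q: "is_coequalizer C g h e"
    using e(1) unfolding is_regular_epi_def by blast
  have g: "g \<in> hom C (Dom C g) x" "h \<in> hom C (Dom C g) x" "e \<cdot> g = e \<cdot> h" "Cod C g = x"
    using q e(2) unfolding is_coequalizer_def hom_def by auto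
  have "a \<cdot> e \<cdot> g = a \<cdot> e \<cdot> h"
    using comp_assoc[OF C g(1) e(2) ab(1)] comp_assoc[OF C g(2) e(2) ab(1)] g(3) by simp
  moreover have "a \<cdot> e \<in> hom C (Cod C g) z"
    using comp_hom[OF C e(2) ab(1)] g(4) by simp
  moreover have "Cod C e = y" using e(2) by (simp add: hom_def)
  ultimately show ?thesis
    using q ab unfolding is_coequalizer_def by metis
qed

text \<open>Phrased without a terminal object, so that it fits both the chosen supports
  \<open>Supp s\<close> and the values \<open>ObjMap F (supp_ctx s)\<close> of an arbitrary regular
  functor.\<close>

definition subterminal :: "('o, 'a) precategory \<Rightarrow> 'o \<Rightarrow> bool" where
  "subterminal C u \<longleftrightarrow> u \<in> Obj C \<and> (\<forall>w. \<forall>a\<in>hom C w u. \<forall>b\<in>hom C w u. a = b)"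

lemma subterminalD: "subterminal C u \<Longrightarrow> a \<in> hom C w u \<Longrightarrow> b \<in> hom C w u \<Longrightarrow> a = b"
  unfolding subterminal_def by blast

text \<open>An arrow into a subterminal object identifies every parallel pair, in particular the one
  coequalized by \<open>e\<close>. This is how arrows between supports are obtained from arrows
  between the objects that cover them.\<close>

lemma regular_epi_lift_subterminal:
  fixes C (structure)
  assumes C: "category C" and e: "is_regular_epi C e" "e \<in> hom C x y"
    and u: "subterminal C u" and k: "k \<in> hom C x u"
  obtains l where "l \<in> hom C y u"
proof -
  obtain g h where q: "is_coequalizer C g h e"
    using e(1) unfolding is_regular_epi_def by blast
  have g: "g \<in> hom C (Dom C g) x" "h \<in> hom C (Dom C g) x" "Cod C g = x" "Cod C e = y"
    using q e(2) unfolding is_coequalizer_def hom_def by auto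
  have "k \<cdot> g = k \<cdot> h"
    using subterminalD[OF u] comp_hom[OF C g(1) k] comp_hom[OF C g(2) k] by blast
  then show thesis
    using coequalizer_factor[OF q] k g that by metis
qed

section \<open>Isomorphisms, monomorphisms and their interplay with regular epimorphisms\<close>

lemma isosE:
  fixes C (structure)
  assumes "f \<in> isos C x y"
  obtains g where "f \<in> hom C x y" "g \<in> hom C y x" "g \<cdot> f = Ident C x" "f \<cdot> g = Ident C y"
  using assms unfolding isos_def by auto

lemma isosI:
  fixes C (structure)
  assumes "f \<in> hom C x y" "g \<in> hom C y x" "g \<cdot> f = Ident C x" "f \<cdot> g = Ident C y"
  shows "f \<in> isos C x y"
  using assms unfolding isos_def by auto

lemma isos_inverse:
  assumes "f \<in> isos C x y"
  obtains g where "g \<in> isos C y x"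
  using assms unfolding isos_def by auto

lemma isos_comp:
  fixes C (structure)
  assumes C: "category C" and f: "f \<in> isos C x y" and g: "g \<in> isos C y z"
  shows "g \<cdot> f \<in> isos C x z"
proof -
  obtain f' where f': "f \<in> hom C x y" "f' \<in> hom C y x" "f' \<cdot> f = Ident C x" "f \<cdot> f' = Ident C y"
    using f by (rule isosE)
  obtain g' where g': "g \<in> hom C y z" "g' \<in> hom C z y" "g' \<cdot> g = Ident C y" "g \<cdot> g' = Ident C z"
    using g by (rule isosE)
  have cancel: "v' \<cdot> u' \<cdot> (u \<cdot> v) = v' \<cdot> v"
    if "v \<in> hom C a b" "u \<in> hom C b c" "u' \<in> hom C c b" "v' \<in> hom C b a" "u' \<cdot> u = Ident C b"
    for u v u' v' a b c
  proof -
    have "v' \<cdot> u' \<cdot> (u \<cdot> v) = v' \<cdot> (u' \<cdot> (u \<cdot> v))"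
      using comp_assoc[OF C comp_hom[OF C that(1,2)] that(3,4)] by simp
    then show ?thesis
      using comp_assoc[OF C that(1-3)] comp_ident[OF C that(1)] that(5) by simp
  qed
  show ?thesis
  proof (rule isosI)
    show "g \<cdot> f \<in> hom C x z" "f' \<cdot> g' \<in> hom C z x"
      using comp_hom[OF C] f' g' by blast+
    show "f' \<cdot> g' \<cdot> (g \<cdot> f) = Ident C x" "g \<cdot> f \<cdot> (f' \<cdot> g') = Ident C z"
      using cancel[of f x y g z g' f'] cancel[of g' z y f' x f g] f' g' by auto
  qed
qed

lemma mono_cancel:
  fixes C (structure)
  assumes "is_mono C m" "m \<in> hom C x y" "f \<in> hom C w x" "g \<in> hom C w x" "m \<cdot> f = m \<cdot> g"
  shows "f = g"
  using assms unfolding is_mono_def hom_def by blast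

text \<open>The composite is a coequalizer of the same pair \<open>g\<close>, \<open>h\<close>; a
  factorisation through \<open>e\<close> is transported along the inverse of
  \<open>m\<close>.\<close>

lemma regular_epi_comp_iso:
  fixes C (structure)
  assumes C: "category C" and e: "is_regular_epi C e" "e \<in> hom C x y" and m: "m \<in> isos C y z"
  shows "is_regular_epi C (m \<cdot> e)"
proof -
  obtain m' where m': "m \<in> hom C y z" "m' \<in> hom C z y" "m' \<cdot> m = Ident C y" "m \<cdot> m' = Ident C z"
    using m by (rule isosE)
  obtain g h where q: "is_coequalizer C g h e"
    using e(1) unfolding is_regular_epi_def by blast
  have g: "g \<in> hom C (Dom C g) x" "h \<in> hom C (Dom C g) x" "Cod C g = x" "Cod C e = y"
    "e \<cdot> g = e \<cdot> h" "Dom C h = Dom C g" "Cod C h = x"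
    using q e(2) unfolding is_coequalizer_def hom_def by auto
  have me: "m \<cdot> e \<in> hom C x z" using comp_hom[OF C e(2) m'(1)] .
  have "is_coequalizer C g h (m \<cdot> e)"
    unfolding is_coequalizer_def
  proof (intro conjI allI ballI impI)
    show "m \<cdot> e \<cdot> g = m \<cdot> e \<cdot> h"
      using comp_assoc[OF C g(1) e(2) m'(1)] comp_assoc[OF C g(2) e(2) m'(1)] g(5) by simp
    fix w k assume k: "k \<in> hom C (Cod C g) w" "k \<cdot> g = k \<cdot> h"
    obtain l where l: "l \<in> hom C y w" "l \<cdot> e = k"
      using coequalizer_factor[OF q k] g(4) by auto
    have "l \<cdot> m' \<cdot> (m \<cdot> e) = k"
      using comp_assoc[OF C me m'(2) l(1)] comp_assoc[OF C e(2) m'(1,2)] comp_ident[OF C e(2)] m'(3) l(2)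
      by simp
    moreover have "a = b" if a: "a \<in> hom C z w" "b \<in> hom C z w" "a \<cdot> (m \<cdot> e) = b \<cdot> (m \<cdot> e)" for a b
    proof -
      have "a \<cdot> m \<cdot> e = b \<cdot> m \<cdot> e"
        using comp_assoc[OF C e(2) m'(1) a(1)] comp_assoc[OF C e(2) m'(1) a(2)] a(3) by simp
      then have "a \<cdot> m = b \<cdot> m"
        using regular_epi_cancel[OF C e comp_hom[OF C m'(1) a(1)] comp_hom[OF C m'(1) a(2)]] by simp
      then show ?thesis
        using comp_assoc[OF C m'(2,1) a(1)] comp_assoc[OF C m'(2,1) a(2)] m'(4)
          comp_ident[OF C a(1)] comp_ident[OF C a(2)] by simp
    qed
    ultimately show "\<exists>!l. l \<in> hom C (Cod C (m \<cdot> e)) w \<and> l \<cdot> (m \<cdot> e) = k"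
      using comp_hom[OF C m'(2) l(1)] homD(3)[OF me] by metis
  qed (use me g e(2) in \<open>auto simp: hom_def\<close>)
  then show ?thesis unfolding is_regular_epi_def by blast
qed

text \<open>An identity is the coequalizer of itself with itself, and an isomorphism is an identity
  followed by an isomorphism.\<close>

lemma iso_regular_epi:
  fixes C (structure)
  assumes C: "category C" and m: "m \<in> isos C x y"
  shows "is_regular_epi C m"
proof -
  have mh: "m \<in> hom C x y" using m unfolding isos_def by simp
  have x: "x \<in> Obj C" using hom_obj[OF C mh] by simp
  have i: "Ident C x \<in> hom C x x" using ident_hom[OF C x] .
  have "is_coequalizer C (Ident C x) (Ident C x) (Ident C x)"
    unfolding is_coequalizer_def
  proof (intro conjI allI ballI impI)
    fix z k assume "k \<in> hom C (Cod C (Ident C x)) z"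
    then have k: "k \<in> hom C x z" using i by (simp add: hom_def)
    show "\<exists>!l. l \<in> hom C (Cod C (Ident C x)) z \<and> l \<cdot> Ident C x = k"
      using k comp_ident(1)[OF C] homD(3)[OF i] by metis
  qed (use i in \<open>auto simp: hom_def\<close>)
  then have "is_regular_epi C (Ident C x)" unfolding is_regular_epi_def by blast
  from regular_epi_comp_iso[OF C this i m] show ?thesis
    using comp_ident(1)[OF C mh] by simp
qed

text \<open>As \<open>m\<close> is monic, \<open>k\<close> already identifies the pair coequalized
  by \<open>m \<cdot> k\<close>. So \<open>k\<close> factors through \<open>m \<cdot> k\<close>, and
  the factor is a two-sided inverse of \<open>m\<close>: cancel the epimorphism on one side and the
  monomorphism on the other.\<close>

lemma regular_epi_factor_mono:
  fixes C (structure)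
  assumes C: "category C" and e: "is_regular_epi C (m \<cdot> k)"
    and m: "is_mono C m" "m \<in> hom C y z" and k: "k \<in> hom C x y"
  shows "m \<in> isos C y z"
proof -
  have mk: "m \<cdot> k \<in> hom C x z" using comp_hom[OF C k m(2)] .
  obtain g h where q: "is_coequalizer C g h (m \<cdot> k)"
    using e unfolding is_regular_epi_def by blast
  have g: "g \<in> hom C (Dom C g) x" "h \<in> hom C (Dom C g) x" "Cod C g = x" "Cod C (m \<cdot> k) = z"
    "m \<cdot> k \<cdot> g = m \<cdot> k \<cdot> h"
    using q mk unfolding is_coequalizer_def hom_def by auto
  have "m \<cdot> (k \<cdot> g) = m \<cdot> (k \<cdot> h)"
    using comp_assoc[OF C g(1) k m(2)] comp_assoc[OF C g(2) k m(2)] g(5) by simp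
  then have "k \<cdot> g = k \<cdot> h"
    using mono_cancel[OF m comp_hom[OF C g(1) k] comp_hom[OF C g(2) k]] by simp
  then obtain l where l: "l \<in> hom C z y" "l \<cdot> (m \<cdot> k) = k"
    using coequalizer_factor[OF q, of k] k g by metis
  have ml: "m \<cdot> l \<in> hom C z z" using comp_hom[OF C l(1) m(2)] .
  have z: "z \<in> Obj C" "y \<in> Obj C" using hom_obj[OF C m(2)] by auto
  have "m \<cdot> l \<cdot> (m \<cdot> k) = Ident C z \<cdot> (m \<cdot> k)"
    using comp_assoc[OF C mk l(1) m(2)] l(2) comp_ident[OF C mk] by simp
  then have 1: "m \<cdot> l = Ident C z"
    using regular_epi_cancel[OF C e mk ml ident_hom[OF C z(1)]] by simp
  have "m \<cdot> (l \<cdot> m) = m \<cdot> Ident C y"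
    using comp_assoc[OF C m(2) l(1) m(2)] 1 comp_ident[OF C m(2)] by simp
  then have "l \<cdot> m = Ident C y"
    using mono_cancel[OF m comp_hom[OF C m(2) l(1)] ident_hom[OF C z(2)]] by simp
  with 1 show ?thesis using isosI[OF m(2) l(1)] by simp
qed

section \<open>Products and pullbacks as finite limits\<close>

text \<open>Finite limits are indexed by categories on natural numbers, whereas
  \<open>is_product\<close> allows any index type. Discrete shapes and the reindexing below
  translate between the two.\<close>

definition discrete_cat :: "nat set \<Rightarrow> (nat, nat) precategory" where
  "discrete_cat I = \<lparr>Obj = I, Arr = I, Dom = (\<lambda>i. i), Cod = (\<lambda>i. i), Ident = (\<lambda>i. i), Comp = (\<lambda>i j. j)\<rparr>"

definition discrete_diagram ::
    "('o, 'a) precategory \<Rightarrow> (nat \<Rightarrow> 'o) \<Rightarrow> (nat, nat, 'o, 'a) funct" where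
  "discrete_diagram C A = \<lparr>ObjMap = A, ArrMap = (\<lambda>i. Ident C (A i))\<rparr>"

lemma finite_discrete_cat: "finite I \<Longrightarrow> finite_category (discrete_cat I)"
  by (auto simp: discrete_cat_def finite_category_def category_def hom_def)

lemma is_functor_discrete_diagram:
  assumes "category C" "\<And>i. i \<in> I \<Longrightarrow> A i \<in> Obj C"
  shows "is_functor (discrete_cat I) C (discrete_diagram C A)"
  using assms ident_hom[OF assms(1)] comp_ident[OF assms(1) ident_hom[OF assms(1)]]
  by (auto simp: discrete_cat_def discrete_diagram_def is_functor_def category_def hom_def)

lemma is_cone_discrete_iff:
  assumes "category C"
  shows "is_cone (discrete_cat I) C (discrete_diagram C A) P p \<longleftrightarrow>
    P \<in> Obj C \<and> (\<forall>i\<in>I. p i \<in> hom C P (A i))"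
  using comp_ident[OF assms]
  by (auto simp: is_cone_def discrete_cat_def discrete_diagram_def)

lemma is_product_iff_limit:
  assumes "category C"
  shows "is_product C I A P p \<longleftrightarrow> is_limit (discrete_cat I) C (discrete_diagram C A) P p"
  unfolding is_product_def is_limit_def is_cone_discrete_iff[OF assms]
  by (simp add: discrete_cat_def Ball_def imp_conjL)

text \<open>The products defining the counit are indexed by a sum of numbers and objects; an
  enumeration of that finite index set turns them into limits of the official shapes and
  back.\<close>

lemma is_product_reindex:
  assumes "bij_betw \<phi> K I"
  shows "is_product C I A P p \<longleftrightarrow> is_product C K (A \<circ> \<phi>) P (p \<circ> \<phi>)"
proof -
  have I: "I = \<phi> ` K" using assms by (simp add: bij_betw_def)
  have inv: "inv_into K \<phi> (\<phi> k) = k" if "k \<in> K" for k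
    using assms that by (simp add: bij_betw_def)
  show ?thesis
  proof
    assume P: "is_product C I A P p"
    show "is_product C K (A \<circ> \<phi>) P (p \<circ> \<phi>)"
      unfolding is_product_def
    proof (intro conjI ballI allI impI)
      fix X q assume q: "X \<in> Obj C" "\<forall>k\<in>K. q k \<in> hom C X ((A \<circ> \<phi>) k)"
      then have "\<forall>i\<in>I. (q \<circ> inv_into K \<phi>) i \<in> hom C X (A i)"
        using I inv by auto
      then have "\<exists>!h. h \<in> hom C X P \<and> (\<forall>i\<in>I. Comp C (p i) h = (q \<circ> inv_into K \<phi>) i)"
        using P q(1) unfolding is_product_def by blast
      then show "\<exists>!h. h \<in> hom C X P \<and> (\<forall>k\<in>K. Comp C ((p \<circ> \<phi>) k) h = q k)"
        using I inv by simp
    qed (use P I in \<open>auto simp: is_product_def\<close>)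
  next
    assume P: "is_product C K (A \<circ> \<phi>) P (p \<circ> \<phi>)"
    show "is_product C I A P p"
      unfolding is_product_def
    proof (intro conjI ballI allI impI)
      fix X q assume q: "X \<in> Obj C" "\<forall>i\<in>I. q i \<in> hom C X (A i)"
      then have "\<forall>k\<in>K. (q \<circ> \<phi>) k \<in> hom C X ((A \<circ> \<phi>) k)"
        using I by auto
      then have "\<exists>!h. h \<in> hom C X P \<and> (\<forall>k\<in>K. Comp C ((p \<circ> \<phi>) k) h = (q \<circ> \<phi>) k)"
        using P q(1) unfolding is_product_def by blast
      then show "\<exists>!h. h \<in> hom C X P \<and> (\<forall>i\<in>I. Comp C (p i) h = q i)"
        using I by simp
    qed (use P I in \<open>auto simp: is_product_def\<close>)
  qed
qed

lemma finite_product_exists: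
  assumes C: "category C" "has_finite_limits C" and I: "finite I" "\<And>i. i \<in> I \<Longrightarrow> A i \<in> Obj C"
  obtains P p where "is_product C I A P p"
proof -
  obtain \<phi> :: "nat \<Rightarrow> _" and K where \<phi>: "bij_betw \<phi> K I" "finite K"
    using ex_bij_betw_nat_finite[OF I(1)] by blast
  have "is_functor (discrete_cat K) C (discrete_diagram C (A \<circ> \<phi>))"
    using is_functor_discrete_diagram[OF C(1)] I(2) \<phi>(1) by (fastforce simp: bij_betw_def)
  then obtain P q where "is_limit (discrete_cat K) C (discrete_diagram C (A \<circ> \<phi>)) P q"
    using C(2) finite_discrete_cat[OF \<phi>(2)] unfolding has_finite_limits_def by blast
  then have "is_product C K (A \<circ> \<phi>) P q" using is_product_iff_limit[OF C(1)] by blast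
  then have "is_product C I ((A \<circ> \<phi>) \<circ> inv_into K \<phi>) P (q \<circ> inv_into K \<phi>)"
    by (rule iffD1[OF is_product_reindex[OF bij_betw_inv_into[OF \<phi>(1)]]])
  then have "is_product C I A P (q \<circ> inv_into K \<phi>)"
    using \<phi>(1) bij_betw_inv_into_right[OF \<phi>(1)] by (simp add: is_product_def)
  then show thesis using that by blast
qed

lemma product_induced:
  fixes C (structure)
  assumes "category C" "is_product C I A P p" "X \<in> Obj C" "\<And>i. i \<in> I \<Longrightarrow> q i \<in> hom C X (A i)"
  obtains h where "h \<in> hom C X P" "\<And>i. i \<in> I \<Longrightarrow> p i \<cdot> h = q i"
  using assms unfolding is_product_def by blast

lemma product_joint_mono:
  fixes C (structure)
  assumes C: "category C" and P: "is_product C I A P p"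
    and h: "h \<in> hom C X P" "h' \<in> hom C X P" "\<And>i. i \<in> I \<Longrightarrow> p i \<cdot> h = p i \<cdot> h'"
  shows "h = h'"
proof -
  have "X \<in> Obj C" using hom_obj[OF C h(1)] by simp
  moreover have "\<forall>i\<in>I. p i \<cdot> h' \<in> hom C X (A i)"
    using P comp_hom[OF C h(2)] unfolding is_product_def by blast
  moreover have "\<forall>X\<in>Obj C. \<forall>q. (\<forall>i\<in>I. q i \<in> hom C X (A i)) \<longrightarrow>
      (\<exists>!k. k \<in> hom C X P \<and> (\<forall>i\<in>I. p i \<cdot> k = q i))"
    using P unfolding is_product_def by blast
  ultimately have "\<exists>!k. k \<in> hom C X P \<and> (\<forall>i\<in>I. p i \<cdot> k = p i \<cdot> h')"
    by simp
  then show ?thesis using h by blast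
qed

text \<open>The two diagrams are different records, but they have the same cones: \<open>F\<close>
  sends the identity of \<open>A i\<close> to the identity of its image for every index in
  \<open>I\<close>.\<close>

lemma comp_discrete_diagram:
  assumes F: "is_functor C D F" and A: "\<And>i. i \<in> I \<Longrightarrow> A i \<in> Obj C"
  shows "is_limit (discrete_cat I) D (comp_funct F (discrete_diagram C A)) c l \<longleftrightarrow>
    is_limit (discrete_cat I) D (discrete_diagram D (ObjMap F \<circ> A)) c l"
proof -
  have "is_cone (discrete_cat I) D (comp_funct F (discrete_diagram C A)) c l \<longleftrightarrow>
    is_cone (discrete_cat I) D (discrete_diagram D (ObjMap F \<circ> A)) c l" for c l
    using F A by (auto simp: is_cone_def discrete_cat_def discrete_diagram_def comp_funct_def is_functor_def)
  then show ?thesis unfolding is_limit_def by simp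
qed

lemma preserves_finite_products:
  assumes F: "is_functor C D F" "preserves_finite_limits C D F"
    and I: "finite I" "\<And>i. i \<in> I \<Longrightarrow> A i \<in> Obj C" and P: "is_product C I A P p"
  shows "is_product D I (ObjMap F \<circ> A) (ObjMap F P) (ArrMap F \<circ> p)"
proof -
  have C: "category C" and D: "category D" using F(1) unfolding is_functor_def by auto
  obtain \<phi> :: "nat \<Rightarrow> _" and K where \<phi>: "bij_betw \<phi> K I" "finite K"
    using ex_bij_betw_nat_finite[OF I(1)] by blast
  have A: "(A \<circ> \<phi>) k \<in> Obj C" if "k \<in> K" for k
    using I(2) \<phi>(1) that by (auto simp: bij_betw_def)
  have "is_product C K (A \<circ> \<phi>) P (p \<circ> \<phi>)"
    by (rule iffD1[OF is_product_reindex[OF \<phi>(1)] P])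
  then have "is_limit (discrete_cat K) C (discrete_diagram C (A \<circ> \<phi>)) P (p \<circ> \<phi>)"
    by (rule iffD1[OF is_product_iff_limit[OF C]])
  then have "is_limit (discrete_cat K) D (comp_funct F (discrete_diagram C (A \<circ> \<phi>))) (ObjMap F P)
      (ArrMap F \<circ> (p \<circ> \<phi>))"
    using F(2) finite_discrete_cat[OF \<phi>(2)] is_functor_discrete_diagram[OF C, of K "A \<circ> \<phi>"] A
    unfolding preserves_finite_limits_def by blast
  then have "is_product D K (ObjMap F \<circ> (A \<circ> \<phi>)) (ObjMap F P) (ArrMap F \<circ> (p \<circ> \<phi>))"
    using comp_discrete_diagram[OF F(1), of K "A \<circ> \<phi>"] A unfolding is_product_iff_limit[OF D] by simp
  then show ?thesis
    using is_product_reindex[OF \<phi>(1), of D "ObjMap F \<circ> A" "ObjMap F P" "ArrMap F \<circ> p"]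
    by (simp add: o_assoc)
qed

text \<open>The shape \<open>0 \<rightarrow> 2 \<leftarrow> 1\<close>: arrows \<open>0\<close>, \<open>1\<close>, \<open>2\<close> are the identities, \<open>3\<close> and \<open>4\<close> the two legs.\<close>

definition cospan_cat :: "(nat, nat) precategory" where
  "cospan_cat = \<lparr>Obj = {0, 1, 2}, Arr = {0, 1, 2, 3, 4},
     Dom = (\<lambda>a. if a = 3 then 0 else if a = 4 then 1 else a), Cod = (\<lambda>a. if a < 3 then a else 2),
     Ident = (\<lambda>i. i), Comp = (\<lambda>b a. if a < 3 then b else a)\<rparr>"

definition cospan_diagram ::
    "('o, 'a) precategory \<Rightarrow> 'a \<Rightarrow> 'a \<Rightarrow> (nat, nat, 'o, 'a) funct" where
  "cospan_diagram C f g = \<lparr>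
     ObjMap = (\<lambda>i. if i = 0 then Dom C f else if i = 1 then Dom C g else Cod C f),
     ArrMap = (\<lambda>a. if a = 3 then f else if a = 4 then g else
       Ident C (if a = 0 then Dom C f else if a = 1 then Dom C g else Cod C f))\<rparr>"

lemma finite_cospan_cat: "finite_category cospan_cat"
  by (auto simp: cospan_cat_def finite_category_def category_def hom_def)

lemma is_functor_cospan_diagram:
  assumes C: "category C" and fg: "f \<in> Arr C" "g \<in> Arr C" "Cod C f = Cod C g"
  shows "is_functor cospan_cat C (cospan_diagram C f g)"
proof -
  have J: "category cospan_cat" using finite_cospan_cat unfolding finite_category_def by simp
  have o: "Dom C f \<in> Obj C" "Dom C g \<in> Obj C" "Cod C g \<in> Obj C"
    using C fg unfolding category_def by auto
  note i = ident_hom[OF C o(1)] ident_hom[OF C o(2)] ident_hom[OF C o(3)]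
  note fh = arr_hom[OF fg(1)] arr_hom[OF fg(2)]
  show ?thesis
    unfolding is_functor_def
    using J C o i fg comp_ident[OF C i(1)] comp_ident[OF C i(2)] comp_ident[OF C i(3)]
      comp_ident[OF C fh(1)] comp_ident[OF C fh(2)]
    by (simp add: cospan_cat_def cospan_diagram_def hom_def)
qed

lemma pullback_exists:
  assumes C: "category C" "has_finite_limits C" and fg: "f \<in> Arr C" "g \<in> Arr C" "Cod C f = Cod C g"
  obtains p q where "is_pullback C f g p q"
proof -
  let ?D = "cospan_diagram C f g"
  have D: "is_functor cospan_cat C ?D"
    using is_functor_cospan_diagram[OF C(1) fg] .
  obtain c l where lim: "is_limit cospan_cat C ?D c l"
    using C(2) D finite_cospan_cat unfolding has_finite_limits_def by blast
  have cone: "is_cone cospan_cat C ?D c l" using lim unfolding is_limit_def by simp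
  have l: "l 0 \<in> hom C c (Dom C f)" "l 1 \<in> hom C c (Dom C g)" "l 2 \<in> hom C c (Cod C f)"
    "Comp C f (l 0) = l 2" "Comp C g (l 1) = l 2"
    using cone by (auto simp: is_cone_def cospan_cat_def cospan_diagram_def)
  note fh = arr_hom[OF fg(1)] arr_hom[OF fg(2)]
  have "is_pullback C f g (l 0) (l 1)"
    unfolding is_pullback_def
  proof (intro conjI allI ballI impI)
    fix w p' q' assume a: "p' \<in> hom C w (Dom C f)" "q' \<in> hom C w (Dom C g)"
      "Comp C f p' = Comp C g q'"
    let ?l = "\<lambda>i. if i = 0 then p' else if i = 1 then q' else Comp C f p'"
    have fp: "Comp C f p' \<in> hom C w (Cod C f)" using comp_hom[OF C(1) a(1) fh(1)] .
    have "is_cone cospan_cat C ?D w ?l"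
      using a fp hom_obj[OF C(1) a(1)] comp_ident(2)[OF C(1) a(1)] comp_ident(2)[OF C(1) a(2)]
        comp_ident(2)[OF C(1) fp]
      by (auto simp: is_cone_def cospan_cat_def cospan_diagram_def)
    then have ex: "\<exists>!h. h \<in> hom C w c \<and> (\<forall>j\<in>Obj cospan_cat. Comp C (l j) h = ?l j)"
      using lim unfolding is_limit_def by blast
    \<comment> \<open>The component at the tip \<open>2\<close> is forced by the one at
      \<open>0\<close>, so the limit condition reduces to the two legs of the pullback.\<close>
    have eq: "(\<forall>j\<in>Obj cospan_cat. Comp C (l j) h = ?l j) \<longleftrightarrow> Comp C (l 0) h = p' \<and> Comp C (l 1) h = q'"
      if "h \<in> hom C w c" for h
      using comp_assoc[OF C(1) that l(1) fh(1)] l(4) by (auto simp: cospan_cat_def)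
    show "\<exists>!h. h \<in> hom C w (Dom C (l 0)) \<and> Comp C (l 0) h = p' \<and> Comp C (l 1) h = q'"
      using ex eq homD(2)[OF l(1)] by (metis (no_types, lifting))
  qed (use l fg in \<open>auto simp: hom_def\<close>)
  then show thesis using that by blast
qed

section \<open>Images in regular categories\<close>

lemma pullback_factor:
  fixes C (structure)
  assumes "is_pullback C f g p q" "p' \<in> hom C w (Dom C f)" "q' \<in> hom C w (Dom C g)" "f \<cdot> p' = g \<cdot> q'"
  obtains h where "h \<in> hom C w (Dom C p)" "p \<cdot> h = p'" "q \<cdot> h = q'"
  using assms unfolding is_pullback_def by blast

text \<open>Stability under pullback in the language of generalized elements: an element
  \<open>a\<close> of \<open>y\<close> comes from an element of \<open>x\<close> after passing to a
  cover \<open>c\<close> of its stage. It allows element-style arguments with regular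
  epimorphisms.\<close>

lemma regular_epi_lift:
  fixes C (structure)
  assumes R: "regular_category C" and e: "is_regular_epi C e" "e \<in> hom C x y" and a: "a \<in> hom C w y"
  obtains v c b where "is_regular_epi C c" "c \<in> hom C v w" "b \<in> hom C v x" "e \<cdot> b = a \<cdot> c"
proof -
  have C: "category C" "has_finite_limits C" using R unfolding regular_category_def by auto
  obtain b c where pb: "is_pullback C e a b c"
    using pullback_exists[OF C, of e a] e(2) a by (auto simp: hom_def)
  then have "is_regular_epi C c" using R e(1) unfolding regular_category_def by blast
  moreover have "c \<in> hom C (Dom C c) w" "b \<in> hom C (Dom C c) x" "e \<cdot> b = a \<cdot> c"
    using pb e(2) a by (auto simp: is_pullback_def hom_def)
  ultimately show thesis using that by blast
qed

text \<open>\<open>e\<close> is the coequalizer of the kernel pair of \<open>f\<close>. To see that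
  \<open>m\<close> is monic, two elements \<open>a\<close>, \<open>b\<close> of \<open>u\<close>
  with the same image are lifted to elements of \<open>x\<close> over a common cover. The lifts
  agree under \<open>f\<close>, hence factor through the kernel pair and are identified by
  \<open>e\<close>; the covers then cancel.\<close>

lemma image_factorization:
  fixes C (structure)
  assumes R: "regular_category C" and f: "f \<in> hom C x y"
  obtains e m u where "e \<in> hom C x u" "m \<in> hom C u y" "is_regular_epi C e" "is_mono C m" "f = m \<cdot> e"
proof -
  have C: "category C" "has_finite_limits C" using R unfolding regular_category_def by auto
  obtain p q where pb: "is_pullback C f f p q"
    using pullback_exists[OF C, of f f] f by (auto simp: hom_def)
  then obtain e where q: "is_coequalizer C p q e"
    using R unfolding regular_category_def by blast
  then have ereg: "is_regular_epi C e" unfolding is_regular_epi_def by blast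
  have pq: "p \<in> hom C (Dom C p) x" "q \<in> hom C (Dom C p) x" "f \<cdot> p = f \<cdot> q" "Cod C p = x"
    using pb f by (auto simp: is_pullback_def hom_def)
  define u where "u = Cod C e"
  have e: "e \<in> hom C x u" "e \<cdot> p = e \<cdot> q"
    using q pq by (auto simp: is_coequalizer_def hom_def u_def)
  obtain m where m: "m \<in> hom C u y" "m \<cdot> e = f"
    using coequalizer_factor[OF q, of f y] f pq unfolding u_def by auto
  have "is_mono C m"
    unfolding is_mono_def
  proof (intro conjI allI ballI impI)
    show "m \<in> Arr C" using m by (simp add: hom_def)
    fix w a b assume "a \<in> hom C w (Dom C m)" "b \<in> hom C w (Dom C m)" and eq: "m \<cdot> a = m \<cdot> b"
    then have a: "a \<in> hom C w u" and b: "b \<in> hom C w u" using m by (auto simp: hom_def)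
    obtain v c s where c: "is_regular_epi C c" "c \<in> hom C v w" "s \<in> hom C v x" "e \<cdot> s = a \<cdot> c"
      using regular_epi_lift[OF R ereg e(1) a] .
    have bc: "b \<cdot> c \<in> hom C v u" using comp_hom[OF C(1) c(2) b] .
    have ac: "a \<cdot> c \<in> hom C v u" using comp_hom[OF C(1) c(2) a] .
    \<comment> \<open>Lifting \<open>b \<cdot> c\<close> instead of \<open>b\<close> makes the
      second cover refine the first, so that both lifts live over the same stage
      \<open>v'\<close>.\<close>
    obtain v' c' t where c': "is_regular_epi C c'" "c' \<in> hom C v' v" "t \<in> hom C v' x" "e \<cdot> t = b \<cdot> c \<cdot> c'"
      using regular_epi_lift[OF R ereg e(1) bc] .
    have sc: "s \<cdot> c' \<in> hom C v' x" using comp_hom[OF C(1) c'(2) c(3)] .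
    have 1: "e \<cdot> (s \<cdot> c') = a \<cdot> c \<cdot> c'" using comp_assoc[OF C(1) c'(2) c(3) e(1)] c(4) by simp
    have "f \<cdot> (s \<cdot> c') = m \<cdot> (a \<cdot> c \<cdot> c')"
      using comp_assoc[OF C(1) sc e(1) m(1)] 1 m(2) by simp
    also have "\<dots> = m \<cdot> (b \<cdot> c \<cdot> c')"
      using comp_assoc[OF C(1) c'(2) ac m(1)] comp_assoc[OF C(1) c'(2) bc m(1)]
        comp_assoc[OF C(1) c(2) a m(1)] comp_assoc[OF C(1) c(2) b m(1)] eq by simp
    also have "\<dots> = f \<cdot> t"
      using comp_assoc[OF C(1) c'(3) e(1) m(1)] c'(4) m(2) by simp
    finally obtain h where h: "h \<in> hom C v' (Dom C p)" "p \<cdot> h = s \<cdot> c'" "q \<cdot> h = t"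
      using pullback_factor[OF pb, of "s \<cdot> c'" v' t] sc c'(3) f by (auto simp: hom_def)
    have "e \<cdot> (s \<cdot> c') = e \<cdot> t"
      using h comp_assoc[OF C(1) h(1) pq(1) e(1)] comp_assoc[OF C(1) h(1) pq(2) e(1)] e(2) by simp
    then have "a \<cdot> c \<cdot> c' = b \<cdot> c \<cdot> c'" using 1 c'(4) by simp
    then have "a \<cdot> c = b \<cdot> c" using regular_epi_cancel[OF C(1) c'(1,2) ac bc] by simp
    then show "a = b" using regular_epi_cancel[OF C(1) c(1,2) a b] by simp
  qed
  then show thesis using that e(1) m ereg by blast
qed

text \<open>Let \<open>m\<close> be the monic part of the image of \<open>g \<cdot> f\<close>. The
  pair coequalized by \<open>f\<close> is identified by \<open>e\<close> too, so \<open>e\<close>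
  factors through \<open>f\<close> and thereby \<open>g\<close> through \<open>m\<close>. A
  monomorphism through which a regular epimorphism factors is invertible.\<close>

lemma regular_epi_comp:
  fixes C (structure)
  assumes R: "regular_category C"
    and f: "is_regular_epi C f" "f \<in> hom C x y" and g: "is_regular_epi C g" "g \<in> hom C y z"
  shows "is_regular_epi C (g \<cdot> f)"
proof -
  have C: "category C" using R unfolding regular_category_def by auto
  have gf: "g \<cdot> f \<in> hom C x z" using comp_hom[OF C f(2) g(2)] .
  obtain e m u where e: "e \<in> hom C x u" "m \<in> hom C u z" "is_regular_epi C e" "is_mono C m" "g \<cdot> f = m \<cdot> e"
    using image_factorization[OF R gf] .
  obtain a b where q: "is_coequalizer C a b f"
    using f(1) unfolding is_regular_epi_def by blast
  have ab: "a \<in> hom C (Dom C a) x" "b \<in> hom C (Dom C a) x" "Cod C a = x" "Cod C f = y" "f \<cdot> a = f \<cdot> b"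
    using q f(2) unfolding is_coequalizer_def hom_def by auto
  have "m \<cdot> (e \<cdot> a) = m \<cdot> (e \<cdot> b)"
    using comp_assoc[OF C ab(1) e(1,2)] comp_assoc[OF C ab(2) e(1,2)] e(5)
      comp_assoc[OF C ab(1) f(2) g(2)] comp_assoc[OF C ab(2) f(2) g(2)] ab(5) by simp
  then have "e \<cdot> a = e \<cdot> b"
    using mono_cancel[OF e(4,2) comp_hom[OF C ab(1) e(1)] comp_hom[OF C ab(2) e(1)]] by simp
  then obtain k where k: "k \<in> hom C y u" "k \<cdot> f = e"
    using coequalizer_factor[OF q, of e u] e(1) ab by auto
  have "m \<cdot> k \<cdot> f = g \<cdot> f" using comp_assoc[OF C f(2) k(1) e(2)] k(2) e(5) by simp
  then have "m \<cdot> k = g"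
    using regular_epi_cancel[OF C f comp_hom[OF C k(1) e(2)] g(2)] by simp
  then have "m \<in> isos C u z"
    using regular_epi_factor_mono[OF C _ e(4,2) k(1)] g(1) by simp
  then show ?thesis using regular_epi_comp_iso[OF C e(3,1)] e(5) by simp
qed

lemma terminal_exists:
  assumes "category C" "has_finite_limits C"
  obtains t where "is_terminal C t"
proof -
  obtain P p where P: "is_product C ({} :: nat set) (\<lambda>_. undefined) P p"
    using finite_product_exists[OF assms, of "{} :: nat set"] by auto
  have "is_terminal C P" using P unfolding is_product_def is_terminal_def by auto
  then show thesis using that by blast
qed

lemma support_exists:
  assumes R: "regular_category C" and s: "s \<in> Obj C"
  obtains u where "is_support C s u"
proof -
  have C: "category C" "has_finite_limits C" using R unfolding regular_category_def by auto
  obtain t where t: "is_terminal C t" using terminal_exists[OF C] .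
  obtain f where f: "f \<in> hom C s t" using t s unfolding is_terminal_def by blast
  obtain e m u where "e \<in> hom C s u" "m \<in> hom C u t" "is_regular_epi C e" "is_mono C m" "f = Comp C m e"
    using image_factorization[OF R f] .
  then have "is_image C f u" using f unfolding is_image_def by (auto simp: hom_def)
  then show thesis using that t f unfolding is_support_def by blast
qed

text \<open>A subobject of a terminal object is subterminal. From here on supports are used only
  through this and through their cover \<open>e\<close>.\<close>

lemma supportD:
  assumes C: "category C" and u: "is_support C s u"
  obtains e where "subterminal C u" "is_regular_epi C e" "e \<in> hom C s u"
proof -
  obtain t f where t: "is_terminal C t" "f \<in> hom C s t" "is_image C f u"
    using u unfolding is_support_def by blast
  then obtain e m where e: "e \<in> hom C s u" "m \<in> hom C u t" "is_regular_epi C e" "is_mono C m"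
    unfolding is_image_def by (auto simp: hom_def)
  have "a = b" if "a \<in> hom C w u" "b \<in> hom C w u" for a b w
  proof -
    have "Comp C m a \<in> hom C w t" "Comp C m b \<in> hom C w t" "w \<in> Obj C"
      using comp_hom[OF C _ e(2)] hom_obj[OF C] that by auto
    then have "Comp C m a = Comp C m b" using t(1) unfolding is_terminal_def by blast
    then show ?thesis using mono_cancel[OF e(4,2) that] by simp
  qed
  then have "subterminal C u" using hom_obj[OF C e(2)] unfolding subterminal_def by blast
  then show thesis using that e by blast
qed

section \<open>Regular functors\<close>

lemma functor_hom: "is_functor C D F \<Longrightarrow> f \<in> hom C x y \<Longrightarrow> ArrMap F f \<in> hom D (ObjMap F x) (ObjMap F y)"
  unfolding is_functor_def hom_def by auto

lemma functor_comp:
  assumes "is_functor C D F" "f \<in> hom C x y" "g \<in> hom C y z"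
  shows "ArrMap F (Comp C g f) = Comp D (ArrMap F g) (ArrMap F f)"
  using assms unfolding is_functor_def hom_def by auto

lemma functor_ident: "is_functor C D F \<Longrightarrow> x \<in> Obj C \<Longrightarrow> ArrMap F (Ident C x) = Ident D (ObjMap F x)"
  unfolding is_functor_def by auto

lemma functor_isos:
  assumes F: "is_functor C D F" and f: "f \<in> isos C x y"
  shows "ArrMap F f \<in> isos D (ObjMap F x) (ObjMap F y)"
proof -
  have C: "category C" using F unfolding is_functor_def by simp
  obtain g where g: "f \<in> hom C x y" "g \<in> hom C y x" "Comp C g f = Ident C x" "Comp C f g = Ident C y"
    using f by (rule isosE)
  show ?thesis
    using isosI[OF functor_hom[OF F g(1)] functor_hom[OF F g(2)]]
      functor_comp[OF F g(1,2)] functor_comp[OF F g(2,1)] g(3,4)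
      functor_ident[OF F hom_obj(1)[OF C g(1)]] functor_ident[OF F hom_obj(2)[OF C g(1)]] by simp
qed

lemma is_functor_comp_funct:
  assumes F: "is_functor C D F" and G: "is_functor D E G"
  shows "is_functor C E (comp_funct G F)"
  using F G unfolding is_functor_def comp_funct_def hom_def by auto

lemma functor_cone:
  assumes F: "is_functor C D F" and X: "is_functor J C X" and c: "is_cone J C X c l"
  shows "is_cone J D (comp_funct F X) (ObjMap F c) (ArrMap F \<circ> l)"
  unfolding is_cone_def
proof (intro conjI ballI)
  show "ObjMap F c \<in> Obj D" using F c unfolding is_functor_def is_cone_def by auto
  show "(ArrMap F \<circ> l) j \<in> hom D (ObjMap F c) (ObjMap (comp_funct F X) j)" if "j \<in> Obj J" for j
    using functor_hom[OF F] c that unfolding is_cone_def comp_funct_def by auto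
  fix u assume u: "u \<in> Arr J"
  have "Dom J u \<in> Obj J" using u X unfolding is_functor_def category_def by auto
  then have "l (Dom J u) \<in> hom C c (ObjMap X (Dom J u))" using c unfolding is_cone_def by auto
  from functor_comp[OF F this functor_hom[OF X arr_hom[OF u]]]
  show "Comp D (ArrMap (comp_funct F X) u) ((ArrMap F \<circ> l) (Dom J u)) = (ArrMap F \<circ> l) (Cod J u)"
    using c u unfolding is_cone_def comp_funct_def by auto
qed

lemma regular_functor_comp:
  assumes F: "regular_functor C D F" and G: "regular_functor D E G"
  shows "regular_functor C E (comp_funct G F)"
  unfolding regular_functor_def preserves_finite_limits_def
proof (intro conjI allI impI)
  fix J X c l assume a: "finite_category J \<and> is_functor J C X \<and> is_limit J C X c l"
  have f: "is_functor C D F" using F unfolding regular_functor_def by simp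
  have "is_limit J D (comp_funct F X) (ObjMap F c) (ArrMap F \<circ> l)"
    using F a unfolding regular_functor_def preserves_finite_limits_def by blast
  moreover have "is_functor J D (comp_funct F X)" using a f is_functor_comp_funct by blast
  ultimately have "is_limit J E (comp_funct G (comp_funct F X)) (ObjMap G (ObjMap F c)) (ArrMap G \<circ> (ArrMap F \<circ> l))"
    using G a unfolding regular_functor_def preserves_finite_limits_def by blast
  then show "is_limit J E (comp_funct (comp_funct G F) X) (ObjMap (comp_funct G F) c) (ArrMap (comp_funct G F) \<circ> l)"
    by (simp add: comp_funct_def o_assoc)
next
  show "is_functor C E (comp_funct G F)"
    using F G is_functor_comp_funct unfolding regular_functor_def by blast
qed (use F G in \<open>auto simp: regular_functor_def comp_funct_def\<close>)

lemma regular_functor_id: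
  assumes "regular_category C"
  shows "regular_functor C C id_funct"
proof -
  have "comp_funct id_funct X = X" for X :: "(nat, nat, 'a, 'b) funct"
    by (simp add: comp_funct_def id_funct_def comp_def)
  moreover have "is_functor C C id_funct"
    using assms by (auto simp: is_functor_def id_funct_def regular_category_def hom_def category_def)
  ultimately show ?thesis
    using assms by (auto simp: regular_functor_def preserves_finite_limits_def id_funct_def comp_def)
qed

section \<open>The category of contexts\<close>

abbreviation len :: "'t ctx \<Rightarrow> nat" where "len \<Gamma> \<equiv> fst \<Gamma>"
abbreviation sorts :: "'t ctx \<Rightarrow> 't set" where "sorts \<Gamma> \<equiv> fst (snd \<Gamma>)"
abbreviation tau :: "'t ctx \<Rightarrow> nat \<Rightarrow> 't" where "tau \<Gamma> \<equiv> snd (snd \<Gamma>)"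
abbreviation fn :: "'t ctx_arr \<Rightarrow> nat \<Rightarrow> nat" where "fn u \<equiv> fst (snd u)"

lemma FRg_simps:
  "Obj (FRg T) = FRg_obj T" "Arr (FRg T) = FRg_arr T" "Dom (FRg T) u = fst u" "Cod (FRg T) u = snd (snd u)"
  "Ident (FRg T) \<Gamma> = (\<Gamma>, \<lambda>i\<in>{1..len \<Gamma>}. i, \<Gamma>)"
  "Comp (FRg T) v u = (fst u, compose {1..len (snd (snd v))} (fn u) (fn v), snd (snd v))"
  by (auto simp: FRg_def split: prod.splits)

lemma FRg_obj_iff:
  "\<Gamma> \<in> FRg_obj T \<longleftrightarrow> sorts \<Gamma> \<subseteq> T \<and> finite (sorts \<Gamma>) \<and> tau \<Gamma> \<in> {1..len \<Gamma>} \<rightarrow>\<^sub>E sorts \<Gamma>"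
  by (cases \<Gamma>) (auto simp: FRg_obj_def)

lemma FRg_hom_iff:
  "u \<in> hom (FRg T) \<Gamma> \<Gamma>' \<longleftrightarrow> \<Gamma> \<in> FRg_obj T \<and> \<Gamma>' \<in> FRg_obj T \<and> fst u = \<Gamma> \<and> snd (snd u) = \<Gamma>' \<and>
    sorts \<Gamma>' \<subseteq> sorts \<Gamma> \<and> fn u \<in> {1..len \<Gamma>'} \<rightarrow>\<^sub>E {1..len \<Gamma>} \<and>
    (\<forall>i\<in>{1..len \<Gamma>'}. tau \<Gamma> (fn u i) = tau \<Gamma>' i)"
  by (cases u; cases \<Gamma>; cases \<Gamma>') (auto simp: hom_def FRg_simps FRg_arr_def)

lemma FRg_homI:
  assumes "\<Gamma> \<in> FRg_obj T" "\<Gamma>' \<in> FRg_obj T" "sorts \<Gamma>' \<subseteq> sorts \<Gamma>"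
    "\<And>i. i \<in> {1..len \<Gamma>'} \<Longrightarrow> f i \<in> {1..len \<Gamma>} \<and> tau \<Gamma> (f i) = tau \<Gamma>' i"
  shows "(\<Gamma>, \<lambda>i\<in>{1..len \<Gamma>'}. f i, \<Gamma>') \<in> hom (FRg T) \<Gamma> \<Gamma>'"
  unfolding FRg_hom_iff using assms by auto

lemma FRg_homD:
  assumes "u \<in> hom (FRg T) \<Gamma> \<Gamma>'"
  shows "\<Gamma> \<in> FRg_obj T" "\<Gamma>' \<in> FRg_obj T" "sorts \<Gamma>' \<subseteq> sorts \<Gamma>"
    "\<And>i. i \<in> {1..len \<Gamma>'} \<Longrightarrow> fn u i \<in> {1..len \<Gamma>}"
    "\<And>i. i \<in> {1..len \<Gamma>'} \<Longrightarrow> tau \<Gamma> (fn u i) = tau \<Gamma>' i"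
    "fst u = \<Gamma>" "snd (snd u) = \<Gamma>'" "u = (\<Gamma>, fn u, \<Gamma>')"
  using assms unfolding FRg_hom_iff by (auto dest: PiE_mem)

lemma FRg_hom_eqI:
  assumes "u \<in> hom (FRg T) \<Gamma> \<Gamma>'" "v \<in> hom (FRg T) \<Gamma> \<Gamma>'" "\<And>i. i \<in> {1..len \<Gamma>'} \<Longrightarrow> fn u i = fn v i"
  shows "u = v"
proof -
  have "fn u = fn v"
    using assms unfolding FRg_hom_iff by (meson PiE_ext)
  then show ?thesis using assms(1,2) FRg_homD(8) by metis
qed

text \<open>The underlying functions run against the arrows, so they compose in the opposite order.
  Colimits of finite sets thus appear as limits of contexts.\<close>

lemma FRg_comp_fn:
  assumes "v \<in> hom (FRg T) \<Gamma>' \<Gamma>''" "i \<in> {1..len \<Gamma>''}"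
  shows "fn (Comp (FRg T) v u) i = fn u (fn v i)"
  using assms FRg_homD(7)[OF assms(1)] by (simp add: FRg_simps compose_def)

lemma FRg_ident_fn: "i \<in> {1..len \<Gamma>} \<Longrightarrow> fn (Ident (FRg T) \<Gamma>) i = i"
  by (simp add: FRg_simps)

lemma FRg_ident_hom: "\<Gamma> \<in> FRg_obj T \<Longrightarrow> Ident (FRg T) \<Gamma> \<in> hom (FRg T) \<Gamma> \<Gamma>"
  unfolding FRg_simps by (rule FRg_homI) auto

lemma FRg_comp_hom:
  assumes "u \<in> hom (FRg T) \<Gamma> \<Gamma>'" "v \<in> hom (FRg T) \<Gamma>' \<Gamma>''"
  shows "Comp (FRg T) v u \<in> hom (FRg T) \<Gamma> \<Gamma>''"
proof -
  note u = FRg_homD[OF assms(1)] and v = FRg_homD[OF assms(2)]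
  have "Comp (FRg T) v u = (\<Gamma>, \<lambda>i\<in>{1..len \<Gamma>''}. fn u (fn v i), \<Gamma>'')"
    using u(6) v(7) by (simp add: FRg_simps compose_def)
  moreover have "(\<Gamma>, \<lambda>i\<in>{1..len \<Gamma>''}. fn u (fn v i), \<Gamma>'') \<in> hom (FRg T) \<Gamma> \<Gamma>''"
    using u(3) v(3) u(4)[OF v(4)] u(5)[OF v(4)] v(5) by (intro FRg_homI u(1) v(2)) auto
  ultimately show ?thesis by simp
qed

lemma category_FRg: "category (FRg T)"
  unfolding category_def
proof (intro conjI ballI impI)
  fix f assume f: "f \<in> Arr (FRg T)"
  note fh = arr_hom[OF f]
  have o: "Dom (FRg T) f \<in> FRg_obj T" "Cod (FRg T) f \<in> FRg_obj T" using FRg_homD(1,2)[OF fh] .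
  then show "Dom (FRg T) f \<in> Obj (FRg T)" "Cod (FRg T) f \<in> Obj (FRg T)" by (auto simp: FRg_simps)
  note i = FRg_ident_hom[OF o(1)] FRg_ident_hom[OF o(2)]
  show "Comp (FRg T) f (Ident (FRg T) (Dom (FRg T) f)) = f"
  proof (rule FRg_hom_eqI[OF FRg_comp_hom[OF i(1) fh] fh])
    fix x assume x: "x \<in> {1..len (Cod (FRg T) f)}"
    show "fn (Comp (FRg T) f (Ident (FRg T) (Dom (FRg T) f))) x = fn f x"
      using FRg_comp_fn[OF fh x] FRg_ident_fn[OF FRg_homD(4)[OF fh x]] by metis
  qed
  show "Comp (FRg T) (Ident (FRg T) (Cod (FRg T) f)) f = f"
  proof (rule FRg_hom_eqI[OF FRg_comp_hom[OF fh i(2)] fh])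
    fix x assume x: "x \<in> {1..len (Cod (FRg T) f)}"
    show "fn (Comp (FRg T) (Ident (FRg T) (Cod (FRg T) f)) f) x = fn f x"
      using FRg_comp_fn[OF i(2) x] FRg_ident_fn[OF x] by metis
  qed
  fix g assume g: "g \<in> Arr (FRg T)"
  { assume c: "Cod (FRg T) f = Dom (FRg T) g"
    have gh: "g \<in> hom (FRg T) (Cod (FRg T) f) (Cod (FRg T) g)" using arr_hom[OF g] c by simp
    then show "Comp (FRg T) g f \<in> hom (FRg T) (Dom (FRg T) f) (Cod (FRg T) g)"
      using FRg_comp_hom[OF fh] by blast }
  fix h assume h: "h \<in> Arr (FRg T)"
  assume c: "Cod (FRg T) f = Dom (FRg T) g \<and> Cod (FRg T) g = Dom (FRg T) h"
  have gh: "g \<in> hom (FRg T) (Cod (FRg T) f) (Cod (FRg T) g)"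
    and hh: "h \<in> hom (FRg T) (Cod (FRg T) g) (Cod (FRg T) h)" using arr_hom[OF g] arr_hom[OF h] c by auto
  show "Comp (FRg T) h (Comp (FRg T) g f) = Comp (FRg T) (Comp (FRg T) h g) f"
  proof (rule FRg_hom_eqI)
    show "Comp (FRg T) h (Comp (FRg T) g f) \<in> hom (FRg T) (Dom (FRg T) f) (Cod (FRg T) h)"
      "Comp (FRg T) (Comp (FRg T) h g) f \<in> hom (FRg T) (Dom (FRg T) f) (Cod (FRg T) h)"
      using FRg_comp_hom fh gh hh by blast+
    fix x assume x: "x \<in> {1..len (Cod (FRg T) h)}"
    show "fn (Comp (FRg T) h (Comp (FRg T) g f)) x = fn (Comp (FRg T) (Comp (FRg T) h g) f) x"
      using FRg_comp_fn[OF hh x] FRg_comp_fn[OF gh FRg_homD(4)[OF hh x]]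
        FRg_comp_fn[OF FRg_comp_hom[OF gh hh] x] by metis
  qed
next
  show "Ident (FRg T) x \<in> hom (FRg T) x x" if "x \<in> Obj (FRg T)" for x
    using FRg_ident_hom that by (simp add: FRg_simps)
qed

section \<open>Limits of contexts\<close>

text \<open>A cocone under the finite sets \<open>{1..len (ObjMap D j)}\<close> and the functions
  underlying \<open>D\<close>. The vertex is a bare type \<open>'v\<close>, and values outside these
  sets are ignored.\<close>

definition compatible ::
    "('j, 'k) precategory \<Rightarrow> ('j, 'k, 't ctx, 't ctx_arr) funct \<Rightarrow> ('j \<Rightarrow> nat \<Rightarrow> 'v) \<Rightarrow> bool" where
  "compatible J D a \<longleftrightarrow> (\<forall>u\<in>Arr J. \<forall>x\<in>{1..len (ObjMap D (Cod J u))}.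
     a (Cod J u) x = a (Dom J u) (fn (ArrMap D u) x))"

lemma FRg_cone_iff:
  assumes D: "is_functor J (FRg T) D"
  shows "is_cone J (FRg T) D c l \<longleftrightarrow>
    c \<in> FRg_obj T \<and> (\<forall>j\<in>Obj J. l j \<in> hom (FRg T) c (ObjMap D j)) \<and> compatible J D (\<lambda>j. fn (l j))"
proof -
  have "Comp (FRg T) (ArrMap D u) (l (Dom J u)) = l (Cod J u) \<longleftrightarrow>
      (\<forall>x\<in>{1..len (ObjMap D (Cod J u))}. fn (l (Cod J u)) x = fn (l (Dom J u)) (fn (ArrMap D u) x))"
    if l: "\<forall>j\<in>Obj J. l j \<in> hom (FRg T) c (ObjMap D j)" and u: "u \<in> Arr J" for u
  proof -
    have o: "Dom J u \<in> Obj J" "Cod J u \<in> Obj J" using D u unfolding is_functor_def category_def by auto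
    have Du: "ArrMap D u \<in> hom (FRg T) (ObjMap D (Dom J u)) (ObjMap D (Cod J u))"
      using functor_hom[OF D arr_hom[OF u]] .
    have ld: "l (Dom J u) \<in> hom (FRg T) c (ObjMap D (Dom J u))"
      and lc: "l (Cod J u) \<in> hom (FRg T) c (ObjMap D (Cod J u))" using l o by auto
    show ?thesis
    proof
      assume "Comp (FRg T) (ArrMap D u) (l (Dom J u)) = l (Cod J u)"
      then show "\<forall>x\<in>{1..len (ObjMap D (Cod J u))}. fn (l (Cod J u)) x = fn (l (Dom J u)) (fn (ArrMap D u) x)"
        using FRg_comp_fn[OF Du] by metis
    next
      assume "\<forall>x\<in>{1..len (ObjMap D (Cod J u))}. fn (l (Cod J u)) x = fn (l (Dom J u)) (fn (ArrMap D u) x)"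
      then show "Comp (FRg T) (ArrMap D u) (l (Dom J u)) = l (Cod J u)"
        using FRg_comp_fn[OF Du] by (intro FRg_hom_eqI[OF FRg_comp_hom[OF ld Du] lc]) metis
    qed
  qed
  then show ?thesis unfolding is_cone_def compatible_def by (auto simp: FRg_simps(1))
qed

text \<open>Arrows of contexts respect sorts. The family also serves as a readily available input
  when only the statement about sorts of \<open>FRg_limit_factor\<close> is wanted.\<close>

lemma compatible_tau:
  assumes D: "is_functor J (FRg T) D"
  shows "compatible J D (\<lambda>j. tau (ObjMap D j))"
  unfolding compatible_def
  using FRg_homD(5)[OF functor_hom[OF D arr_hom]] by metis

text \<open>Joint surjectivity of the legs gives uniqueness of the comparison map and forces its
  labels to match; factorisation of families gives its existence. Families of numbers suffice,
  because the legs of a competing cone are functions into some \<open>{1..n}\<close>.\<close>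

lemma FRg_limitI:
  fixes D :: "('j, 'k, 't ctx, 't ctx_arr) funct"
  assumes D: "is_functor J (FRg T) D" and cone: "is_cone J (FRg T) D c l"
    and sorts: "sorts c \<subseteq> (\<Union>j\<in>Obj J. sorts (ObjMap D j))"
    and surj: "\<And>i. i \<in> {1..len c} \<Longrightarrow> \<exists>j\<in>Obj J. \<exists>x\<in>{1..len (ObjMap D j)}. fn (l j) x = i"
    and fac: "\<And>a :: 'j \<Rightarrow> nat \<Rightarrow> nat. compatible J D a \<Longrightarrow>
      \<exists>b. \<forall>j\<in>Obj J. \<forall>x\<in>{1..len (ObjMap D j)}. b (fn (l j) x) = a j x"
  shows "is_limit J (FRg T) D c l"
  unfolding is_limit_def
proof (intro conjI cone allI impI)
  fix c' l' assume cone': "is_cone J (FRg T) D c' l'"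
  have c: "c \<in> FRg_obj T" and l: "\<And>j. j \<in> Obj J \<Longrightarrow> l j \<in> hom (FRg T) c (ObjMap D j)"
    using cone unfolding FRg_cone_iff[OF D] by auto
  have c': "c' \<in> FRg_obj T" and l': "\<And>j. j \<in> Obj J \<Longrightarrow> l' j \<in> hom (FRg T) c' (ObjMap D j)"
    and "compatible J D (\<lambda>j. fn (l' j))"
    using cone' unfolding FRg_cone_iff[OF D] by auto
  then obtain b where b: "\<And>j x. j \<in> Obj J \<Longrightarrow> x \<in> {1..len (ObjMap D j)} \<Longrightarrow> b (fn (l j) x) = fn (l' j) x"
    using fac by blast
  let ?h = "(c', \<lambda>i\<in>{1..len c}. b i, c)"
  have h: "?h \<in> hom (FRg T) c' c"
  proof (rule FRg_homI[OF c' c])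
    show "sorts c \<subseteq> sorts c'" using sorts FRg_homD(3)[OF l'] by blast
    fix i assume "i \<in> {1..len c}"
    then obtain j x where j: "j \<in> Obj J" "x \<in> {1..len (ObjMap D j)}" "fn (l j) x = i" using surj by blast
    then show "b i \<in> {1..len c'} \<and> tau c' (b i) = tau c i"
      using b[OF j(1,2)] FRg_homD(4,5)[OF l'[OF j(1)] j(2)] FRg_homD(5)[OF l[OF j(1)] j(2)] by auto
  qed
  have eq: "Comp (FRg T) (l j) k = l' j \<longleftrightarrow> (\<forall>x\<in>{1..len (ObjMap D j)}. fn k (fn (l j) x) = fn (l' j) x)"
    if j: "j \<in> Obj J" and k: "k \<in> hom (FRg T) c' c" for j k
  proof
    assume "Comp (FRg T) (l j) k = l' j"
    then show "\<forall>x\<in>{1..len (ObjMap D j)}. fn k (fn (l j) x) = fn (l' j) x"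
      using FRg_comp_fn[OF l[OF j]] by metis
  next
    assume "\<forall>x\<in>{1..len (ObjMap D j)}. fn k (fn (l j) x) = fn (l' j) x"
    then show "Comp (FRg T) (l j) k = l' j"
      using FRg_comp_fn[OF l[OF j]] by (intro FRg_hom_eqI[OF FRg_comp_hom[OF k l[OF j]] l'[OF j]]) metis
  qed
  show "\<exists>!h. h \<in> hom (FRg T) c' c \<and> (\<forall>j\<in>Obj J. Comp (FRg T) (l j) h = l' j)"
  proof (rule ex1I[of _ ?h])
    show "?h \<in> hom (FRg T) c' c \<and> (\<forall>j\<in>Obj J. Comp (FRg T) (l j) ?h = l' j)"
      using h eq[OF _ h] b FRg_homD(4)[OF l] by auto
    fix k assume k: "k \<in> hom (FRg T) c' c \<and> (\<forall>j\<in>Obj J. Comp (FRg T) (l j) k = l' j)"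
    show "k = ?h"
    proof (rule FRg_hom_eqI[OF _ h])
      fix i assume i: "i \<in> {1..len c}"
      then obtain j x where j: "j \<in> Obj J" "x \<in> {1..len (ObjMap D j)}" "fn (l j) x = i" using surj by blast
      then show "fn k i = fn ?h i" using k eq[of j k] b i by auto
    qed (use k in blast)
  qed
qed

text \<open>A variable \<open>i\<close> of the limit that no leg reaches could be duplicated. The
  two arrows that use the original and the copy would then induce the same cone, against
  uniqueness.\<close>

lemma FRg_limit_surj:
  assumes D: "is_functor J (FRg T) D" and lim: "is_limit J (FRg T) D c l" and i: "i \<in> {1..len c}"
  shows "\<exists>j\<in>Obj J. \<exists>x\<in>{1..len (ObjMap D j)}. fn (l j) x = i"
proof (rule ccontr)
  assume no: "\<not> ?thesis"
  have cone: "is_cone J (FRg T) D c l" using lim unfolding is_limit_def by simp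
  have c: "c \<in> FRg_obj T" and l: "\<And>j. j \<in> Obj J \<Longrightarrow> l j \<in> hom (FRg T) c (ObjMap D j)"
    using cone unfolding FRg_cone_iff[OF D] by auto
  \<comment> \<open>The copy of \<open>i\<close> sits at position \<open>Suc (len c)\<close> and
    carries the same sort; the arrows \<open>k i\<close> and \<open>k (Suc (len c))\<close> differ
    at \<open>i\<close> only.\<close>
  define d where "d = (Suc (len c), sorts c, \<lambda>x\<in>{1..Suc (len c)}. if x = Suc (len c) then tau c i else tau c x)"
  have tau: "tau c x \<in> sorts c" if "x \<in> {1..len c}" for x using c that unfolding FRg_obj_iff by auto
  have d: "d \<in> FRg_obj T" using c i tau by (auto simp: FRg_obj_iff d_def le_Suc_eq)
  define k where "k = (\<lambda>v. (d, \<lambda>x\<in>{1..len c}. if x = i then v else x, c))"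
  have h: "k v \<in> hom (FRg T) d c" if "v \<in> {i, Suc (len c)}" for v
    unfolding k_def by (rule FRg_homI[OF d c]) (use that i in \<open>auto simp: d_def\<close>)
  have "Comp (FRg T) (l j) (k i) = Comp (FRg T) (l j) (k (Suc (len c)))"
    if j: "j \<in> Obj J" for j
  proof (rule FRg_hom_eqI[OF FRg_comp_hom[OF h l[OF j]] FRg_comp_hom[OF h l[OF j]]])
    fix x assume x: "x \<in> {1..len (ObjMap D j)}"
    show "fn (Comp (FRg T) (l j) (k i)) x =
      fn (Comp (FRg T) (l j) (k (Suc (len c)))) x"
      unfolding FRg_comp_fn[OF l[OF j] x] using no j x by (auto simp: k_def)
  qed auto
  moreover have "is_cone J (FRg T) D d (\<lambda>j. Comp (FRg T) (l j) (k i))"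
    unfolding is_cone_def
  proof (intro conjI ballI)
    fix u assume u: "u \<in> Arr J"
    have "Dom J u \<in> Obj J" using D u unfolding is_functor_def category_def by auto
    then show "Comp (FRg T) (ArrMap D u) (Comp (FRg T) (l (Dom J u)) (k i)) =
      Comp (FRg T) (l (Cod J u)) (k i)"
      using comp_assoc[OF category_FRg h l functor_hom[OF D arr_hom[OF u]], of i] cone u
      unfolding is_cone_def by simp
  qed (use d FRg_comp_hom[OF h l] in \<open>auto simp: FRg_simps(1)\<close>)
  ultimately have "k i = k (Suc (len c))"
    using lim h unfolding is_limit_def by (metis (no_types, lifting) insertI1 insertI2)
  then have "fn (k i) i = fn (k (Suc (len c))) i" by simp
  then show False using i by (simp add: k_def)
qed

text \<open>The values of a compatible family, paired with their sorts, form a context; it is the vertex of a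
  cone, and the comparison map to the limit yields the factorisation.\<close>

lemma FRg_limit_factor:
  fixes a :: "'j \<Rightarrow> nat \<Rightarrow> 'v"
  assumes D: "is_functor J (FRg T) D" and fin: "finite (Obj J)" and lim: "is_limit J (FRg T) D c l"
    and a: "compatible J D a"
  shows "sorts c = (\<Union>j\<in>Obj J. sorts (ObjMap D j))"
    and "\<exists>b. \<forall>j\<in>Obj J. \<forall>x\<in>{1..len (ObjMap D j)}. b (fn (l j) x) = a j x"
proof -
  have cone: "is_cone J (FRg T) D c l" using lim unfolding is_limit_def by simp
  have c: "c \<in> FRg_obj T" and l: "\<And>j. j \<in> Obj J \<Longrightarrow> l j \<in> hom (FRg T) c (ObjMap D j)"
    using cone unfolding FRg_cone_iff[OF D] by auto
  have Do: "ObjMap D j \<in> FRg_obj T" if "j \<in> Obj J" for j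
    using D that unfolding is_functor_def by (auto simp: FRg_simps)
  define g where "g = (\<lambda>(j, x). (a j x, tau (ObjMap D j) x))"
  define V where "V = g ` (SIGMA j:Obj J. {1..len (ObjMap D j)})"
  have "finite V" using fin unfolding V_def by auto
  then obtain \<phi> where \<phi>: "bij_betw \<phi> {1..card V} V" using ex_bij_betw_nat_finite_1 by blast
  define \<psi> where "\<psi> = inv_into {1..card V} \<phi>"
  have gV: "g (j, x) \<in> V" if "j \<in> Obj J" "x \<in> {1..len (ObjMap D j)}" for j x
    using that unfolding V_def by blast
  have \<psi>: "\<psi> v \<in> {1..card V}" "\<phi> (\<psi> v) = v" if "v \<in> V" for v
    using \<phi> that bij_betw_inv_into[OF \<phi>] bij_betw_inv_into_right[OF \<phi>] bij_betwE unfolding \<psi>_def by blast+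
  let ?S = "\<Union>j\<in>Obj J. sorts (ObjMap D j)"
  define d where "d = (card V, ?S, \<lambda>i\<in>{1..card V}. snd (\<phi> i))"
  have "snd v \<in> ?S" if "v \<in> V" for v
    using that Do unfolding V_def g_def FRg_obj_iff by fastforce
  then have d: "d \<in> FRg_obj T"
    using Do fin bij_betwE[OF \<phi>] unfolding FRg_obj_iff d_def by fastforce
  define m where "m = (\<lambda>j. (d, \<lambda>x\<in>{1..len (ObjMap D j)}. \<psi> (g (j, x)), ObjMap D j))"
  have m: "m j \<in> hom (FRg T) d (ObjMap D j)" if "j \<in> Obj J" for j
    unfolding m_def
  proof (rule FRg_homI[OF d Do[OF that]])
    fix x assume "x \<in> {1..len (ObjMap D j)}"
    then show "\<psi> (g (j, x)) \<in> {1..len d} \<and> tau d (\<psi> (g (j, x))) = tau (ObjMap D j) x"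
      using \<psi>[OF gV[OF that]] by (auto simp: d_def g_def)
  qed (use that in \<open>auto simp: d_def\<close>)
  have "compatible J D (\<lambda>j x. g (j, x))"
    using a compatible_tau[OF D] unfolding compatible_def g_def by auto
  then have "compatible J D (\<lambda>j. fn (m j))"
    using FRg_homD(4)[OF functor_hom[OF D arr_hom]] unfolding compatible_def m_def by auto
  then have "is_cone J (FRg T) D d m" unfolding FRg_cone_iff[OF D] using d m by blast
  then obtain h where h: "h \<in> hom (FRg T) d c" "\<And>j. j \<in> Obj J \<Longrightarrow> Comp (FRg T) (l j) h = m j"
    using lim unfolding is_limit_def by blast
  \<comment> \<open>The comparison map bounds the sorts of the limit from above, since
    \<open>d\<close> carries exactly the union; the legs bound them from below.\<close>
  show "sorts c = ?S"
    using FRg_homD(3)[OF h(1)] FRg_homD(3)[OF l] by (auto simp: d_def)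
  have "fst (\<phi> (fn h (fn (l j) x))) = a j x" if "j \<in> Obj J" "x \<in> {1..len (ObjMap D j)}" for j x
  proof -
    have "fn h (fn (l j) x) = fn (m j) x" using FRg_comp_fn[OF l] that h(2) by metis
    then show ?thesis using that \<psi>(2)[OF gV[OF that]] by (simp add: m_def g_def)
  qed
  then show "\<exists>b. \<forall>j\<in>Obj J. \<forall>x\<in>{1..len (ObjMap D j)}. b (fn (l j) x) = a j x"
    by (intro exI[of _ "\<lambda>i. fst (\<phi> (fn h i))"]) auto
qed

text \<open>The colimit of finite sets underlying a limit of contexts: two elements are identified when no
  compatible family of natural numbers separates them.\<close>

lemma FRg_has_finite_limits:
  fixes T :: "'t set"
  shows "has_finite_limits (FRg T)"
  unfolding has_finite_limits_def
proof (intro allI impI)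
  fix J :: "(nat, nat) precategory" and D :: "(nat, nat, 't ctx, 't ctx_arr) funct"
  assume "finite_category J \<and> is_functor J (FRg T) D"
  then have fin: "finite (Obj J)" and D: "is_functor J (FRg T) D"
    unfolding finite_category_def by auto
  have Do: "ObjMap D j \<in> FRg_obj T" if "j \<in> Obj J" for j
    using D that unfolding is_functor_def by (auto simp: FRg_simps)
  define P where "P = (SIGMA j:Obj J. {1..len (ObjMap D j)})"
  define cls where "cls = (\<lambda>(j, x). {(k, y)\<in>P. \<forall>a :: nat \<Rightarrow> nat \<Rightarrow> nat. compatible J D a \<longrightarrow> a j x = a k y})"
  have finP: "finite P" using fin unfolding P_def by auto
  have cls: "a j x = a k y" if "compatible J D a" "(j, x) \<in> P" "(k, y) \<in> P" "cls (j, x) = cls (k, y)"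
    for a :: "nat \<Rightarrow> nat \<Rightarrow> 'v" and j x k y
  proof -
    \<comment> \<open>Classes are defined by families of numbers. A family with values in another
      type takes finitely many values on \<open>P\<close>, and coding these injectively as numbers
      preserves compatibility.\<close>
    obtain e :: "'v \<Rightarrow> nat" where e: "inj_on e ((\<lambda>(j, x). a j x) ` P)"
      using finite_imp_inj_to_nat_seg[OF finite_imageI[OF finP, of "\<lambda>(j, x). a j x"]] by blast
    have "compatible J D (\<lambda>j x. e (a j x))" using that(1) unfolding compatible_def by auto
    moreover have "(k, y) \<in> cls (k, y)" using that(3) unfolding cls_def by auto
    then have "(k, y) \<in> cls (j, x)" using that(4) by simp
    ultimately have "e (a j x) = e (a k y)" unfolding cls_def by auto
    then show ?thesis using inj_onD[OF e] that(2,3) by force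
  qed
  define Q where "Q = cls ` P"
  have "finite Q" using finP unfolding Q_def by simp
  then obtain \<phi> where \<phi>: "bij_betw \<phi> {1..card Q} Q" using ex_bij_betw_nat_finite_1 by blast
  define \<psi> where "\<psi> = (\<lambda>p. inv_into {1..card Q} \<phi> (cls p))"
  have \<psi>: "\<psi> p \<in> {1..card Q}" "\<phi> (\<psi> p) = cls p" if "p \<in> P" for p
  proof -
    have "cls p \<in> Q" using that unfolding Q_def by simp
    then show "\<psi> p \<in> {1..card Q}" "\<phi> (\<psi> p) = cls p"
      using bij_betwE[OF bij_betw_inv_into[OF \<phi>]] bij_betw_inv_into_right[OF \<phi>] unfolding \<psi>_def by auto
  qed
  \<comment> \<open>One index pair is chosen for each numbered class; a compatible family, being
    constant on classes, factors through evaluation at the chosen pairs.\<close>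
  define rep where "rep = (\<lambda>i. SOME p. p \<in> P \<and> \<psi> p = i)"
  have rep: "rep i \<in> P \<and> \<psi> (rep i) = i" if "i \<in> {1..card Q}" for i
  proof -
    have "\<phi> i \<in> cls ` P" using \<phi> that bij_betwE unfolding Q_def by blast
    then obtain p where "p \<in> P" "\<phi> i = cls p" by blast
    then have "p \<in> P \<and> \<psi> p = i" using bij_betw_inv_into_left[OF \<phi> that] unfolding \<psi>_def by simp
    then show ?thesis unfolding rep_def by (rule someI)
  qed
  have fac: "(\<lambda>(j, x). a j x) (rep (\<psi> (j, x))) = a j x" if "compatible J D a" "(j, x) \<in> P"
    for a :: "nat \<Rightarrow> nat \<Rightarrow> 'v" and j x
  proof -
    obtain k y where k: "rep (\<psi> (j, x)) = (k, y)" by fastforce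
    have "(k, y) \<in> P" "\<psi> (k, y) = \<psi> (j, x)" using rep[OF \<psi>(1)[OF that(2)]] k by auto
    then have "cls (k, y) = cls (j, x)" using \<psi>(2) that(2) by metis
    then show ?thesis using cls[OF that(1) \<open>(k, y) \<in> P\<close> that(2)] k by simp
  qed
  let ?S = "\<Union>j\<in>Obj J. sorts (ObjMap D j)"
  define c where "c = (card Q, ?S, \<lambda>i\<in>{1..card Q}. (\<lambda>(j, x). tau (ObjMap D j) x) (rep i))"
  have tauS: "(\<lambda>(j, x). tau (ObjMap D j) x) p \<in> ?S" if p: "p \<in> P" for p
  proof -
    obtain j x where "p = (j, x)" "j \<in> Obj J" "x \<in> {1..len (ObjMap D j)}" using p unfolding P_def by blast
    then show ?thesis using Do[of j] unfolding FRg_obj_iff by auto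
  qed
  have "?S \<subseteq> T" "finite ?S" using Do fin unfolding FRg_obj_iff by auto
  then have c: "c \<in> FRg_obj T" using tauS rep unfolding FRg_obj_iff c_def by auto
  define l where "l = (\<lambda>j. (c, \<lambda>x\<in>{1..len (ObjMap D j)}. \<psi> (j, x), ObjMap D j))"
  have l: "l j \<in> hom (FRg T) c (ObjMap D j)" if "j \<in> Obj J" for j
    unfolding l_def
  proof (rule FRg_homI[OF c Do[OF that]])
    fix x assume "x \<in> {1..len (ObjMap D j)}"
    then have "(j, x) \<in> P" using that unfolding P_def by simp
    then show "\<psi> (j, x) \<in> {1..len c} \<and> tau c (\<psi> (j, x)) = tau (ObjMap D j) x"
      using \<psi>(1) fac[OF compatible_tau[OF D]] by (simp add: c_def)
  qed (use that in \<open>auto simp: c_def\<close>)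
  have "compatible J D (\<lambda>j. fn (l j))"
    unfolding compatible_def
  proof (intro ballI)
    fix u x assume u: "u \<in> Arr J" and x: "x \<in> {1..len (ObjMap D (Cod J u))}"
    have x': "fn (ArrMap D u) x \<in> {1..len (ObjMap D (Dom J u))}"
      using FRg_homD(4)[OF functor_hom[OF D arr_hom[OF u]] x] .
    \<comment> \<open>No compatible family can separate these two pairs, because compatibility is
      precisely this equation.\<close>
    have "cls (Cod J u, x) = cls (Dom J u, fn (ArrMap D u) x)"
      using u x unfolding cls_def compatible_def by simp
    then show "fn (l (Cod J u)) x = fn (l (Dom J u)) (fn (ArrMap D u) x)"
      using x x' by (simp add: l_def \<psi>_def)
  qed
  then have "is_cone J (FRg T) D c l" using FRg_cone_iff[OF D] c l by blast
  then have "is_limit J (FRg T) D c l"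
  proof (rule FRg_limitI[OF D])
    show "sorts c \<subseteq> ?S" by (simp add: c_def)
    show "\<exists>j\<in>Obj J. \<exists>x\<in>{1..len (ObjMap D j)}. fn (l j) x = i" if "i \<in> {1..len c}" for i
    proof -
      obtain j x where "rep i = (j, x)" by fastforce
      then have "(j, x) \<in> P" "\<psi> (j, x) = i" using rep[of i] that by (auto simp: c_def)
      then show ?thesis unfolding P_def by (intro bexI[of _ j] bexI[of _ x]) (auto simp: l_def)
    qed
    fix a :: "nat \<Rightarrow> nat \<Rightarrow> nat" assume a: "compatible J D a"
    have "(\<lambda>(j, x). a j x) (rep (fn (l j) x)) = a j x" if "j \<in> Obj J" "x \<in> {1..len (ObjMap D j)}" for j x
      using fac[OF a] that by (simp add: l_def P_def)
    then show "\<exists>b. \<forall>j\<in>Obj J. \<forall>x\<in>{1..len (ObjMap D j)}. b (fn (l j) x) = a j x"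
      by (intro exI[of _ "\<lambda>i. (\<lambda>(j, x). a j x) (rep i)"]) simp
  qed
  then show "\<exists>c l. is_limit J (FRg T) D c l" by blast
qed

section \<open>Regularity of the category of contexts\<close>

text \<open>Reversing arrows turns coequalizers into equalizers of finite sets: \<open>e\<close> is
  an injection onto the positions where \<open>g\<close> and \<open>h\<close> agree. An arrow that
  identifies \<open>g\<close> and \<open>h\<close> uses only such positions, so its function can be
  pulled back along \<open>fn e\<close>.\<close>

lemma FRg_coequalizerI:
  assumes gh: "g \<in> hom (FRg T) d c" "h \<in> hom (FRg T) d c" and e: "e \<in> hom (FRg T) c q"
    and sorts: "sorts q = sorts c" and inj: "inj_on (fn e) {1..len q}"
    and im: "fn e ` {1..len q} = {i \<in> {1..len c}. fn g i = fn h i}"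
  shows "is_coequalizer (FRg T) g h e"
  unfolding is_coequalizer_def
proof (intro conjI allI ballI impI)
  show "Comp (FRg T) e g = Comp (FRg T) e h"
    by (rule FRg_hom_eqI[OF FRg_comp_hom[OF gh(1) e] FRg_comp_hom[OF gh(2) e]])
      (use im in \<open>simp only: FRg_comp_fn[OF e]; blast\<close>)
  fix z k assume "k \<in> hom (FRg T) (Cod (FRg T) g) z" and eq: "Comp (FRg T) k g = Comp (FRg T) k h"
  then have k: "k \<in> hom (FRg T) c z" using homD[OF gh(1)] by simp
  have kim: "fn k i \<in> fn e ` {1..len q}" if "i \<in> {1..len z}" for i
    using FRg_comp_fn[OF k that] eq FRg_homD(4)[OF k that] unfolding im by (metis (mono_tags, lifting) mem_Collect_eq)
  define f where "f = (\<lambda>i. inv_into {1..len q} (fn e) (fn k i))"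
  have f: "f i \<in> {1..len q}" "fn e (f i) = fn k i" if "i \<in> {1..len z}" for i
    using inv_into_into[OF kim[OF that]] f_inv_into_f[OF kim[OF that]] unfolding f_def by auto
  let ?l = "(q, \<lambda>i\<in>{1..len z}. f i, z)"
  have l: "?l \<in> hom (FRg T) q z"
    using FRg_homD(5)[OF e f(1)] FRg_homD(5)[OF k] f
    by (intro FRg_homI FRg_homD(2)[OF e] FRg_homD(2)[OF k]) (use sorts FRg_homD(3)[OF k] in auto)
  have "Comp (FRg T) ?l e = k"
    by (rule FRg_hom_eqI[OF FRg_comp_hom[OF e l] k]) (use f in \<open>simp only: FRg_comp_fn[OF l]; simp\<close>)
  moreover have "l' = ?l" if l': "l' \<in> hom (FRg T) q z" "Comp (FRg T) l' e = k" for l'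
  proof (rule FRg_hom_eqI[OF l'(1) l])
    fix i assume i: "i \<in> {1..len z}"
    have "fn e (fn l' i) = fn e (f i)" using FRg_comp_fn[OF l'(1) i] l'(2) f(2)[OF i] by metis
    then show "fn l' i = fn ?l i" using inj_onD[OF inj] FRg_homD(4)[OF l'(1) i] f(1)[OF i] i by auto
  qed
  ultimately show "\<exists>!l. l \<in> hom (FRg T) (Cod (FRg T) e) z \<and> Comp (FRg T) l e = k"
    unfolding homD(3)[OF e] using l by (intro ex1I[of _ ?l] conjI) blast+
qed (use homD[OF gh(1)] homD[OF gh(2)] homD[OF e] in auto)

lemma FRg_coequalizer_exists:
  assumes gh: "g \<in> hom (FRg T) d c" "h \<in> hom (FRg T) d c"
  obtains e where "is_coequalizer (FRg T) g h e"
proof -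
  define E where "E = {i \<in> {1..len c}. fn g i = fn h i}"
  have "finite E" unfolding E_def by simp
  then obtain \<phi> where \<phi>: "bij_betw \<phi> {1..card E} E" using ex_bij_betw_nat_finite_1 by blast
  have \<phi>E: "\<phi> i \<in> {1..len c}" if "i \<in> {1..card E}" for i
    using bij_betwE[OF \<phi>] that unfolding E_def by blast
  have c: "c \<in> FRg_obj T" using FRg_homD(2)[OF gh(1)] .
  define q where "q = (card E, sorts c, \<lambda>i\<in>{1..card E}. tau c (\<phi> i))"
  have "tau c (\<phi> i) \<in> sorts c" if "i \<in> {1..card E}" for i
    using c \<phi>E[OF that] unfolding FRg_obj_iff by blast
  then have q: "q \<in> FRg_obj T" using c unfolding q_def FRg_obj_iff by auto
  let ?e = "(c, \<lambda>i\<in>{1..len q}. \<phi> i, q)"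
  have e: "?e \<in> hom (FRg T) c q" by (rule FRg_homI[OF c q]) (use \<phi>E in \<open>auto simp: q_def\<close>)
  have "is_coequalizer (FRg T) g h ?e"
  proof (rule FRg_coequalizerI[OF gh e])
    show "inj_on (fn ?e) {1..len q}" using \<phi> by (simp add: bij_betw_def q_def inj_on_restrict_eq)
    show "fn ?e ` {1..len q} = {i \<in> {1..len c}. fn g i = fn h i}"
      using \<phi> unfolding E_def[symmetric] by (auto simp: bij_betw_def q_def)
  qed (simp add: q_def)
  then show thesis using that by blast
qed

text \<open>Injectivity follows by cancelling \<open>e\<close> in front of arrows that select single
  variables, equality of sorts by factoring an arrow onto a context without variables. Conversely,
  an injection of finite sets is the equalizer of two maps into a doubled codomain.\<close>

lemma FRg_regular_epi_iff:
  assumes e: "e \<in> hom (FRg T) c q"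
  shows "is_regular_epi (FRg T) e \<longleftrightarrow> inj_on (fn e) {1..len q} \<and> sorts q = sorts c"
proof
  assume epi: "is_regular_epi (FRg T) e"
  have c: "c \<in> FRg_obj T" and q: "q \<in> FRg_obj T" using FRg_homD(1,2)[OF e] .
  have "inj_on (fn e) {1..len q}"
  proof (rule inj_onI)
    fix x y assume xy: "x \<in> {1..len q}" "y \<in> {1..len q}" "fn e x = fn e y"
    have t: "tau q y = tau q x" using FRg_homD(5)[OF e xy(1)] FRg_homD(5)[OF e xy(2)] xy(3) by simp
    \<comment> \<open>A unary context of the common sort of \<open>x\<close> and \<open>y\<close>:
      the arrows \<open>q \<rightarrow> z\<close> that select \<open>x\<close> and \<open>y\<close>
      agree after precomposition with \<open>e\<close>.\<close>
    define z where "z = (1 :: nat, {tau q x}, \<lambda>i\<in>{1..1 :: nat}. tau q x)"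
    have tq: "tau q x \<in> sorts q" using q xy unfolding FRg_obj_iff by auto
    then have z: "z \<in> FRg_obj T" using q unfolding z_def FRg_obj_iff by auto
    let ?l = "\<lambda>w. (q, \<lambda>i\<in>{1..len z}. w, z)"
    have l: "?l w \<in> hom (FRg T) q z" if "w \<in> {x, y}" for w
      by (rule FRg_homI[OF q z]) (use that xy t tq in \<open>auto simp: z_def\<close>)
    have "Comp (FRg T) (?l x) e = Comp (FRg T) (?l y) e"
    proof (rule FRg_hom_eqI[OF FRg_comp_hom[OF e l] FRg_comp_hom[OF e l]])
      fix i assume i: "i \<in> {1..len z}"
      show "fn (Comp (FRg T) (?l x) e) i = fn (Comp (FRg T) (?l y) e) i"
        using FRg_comp_fn[OF l i, of x e] FRg_comp_fn[OF l i, of y e] i xy(3) by simp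
    qed auto
    then have "?l x = ?l y" using regular_epi_cancel[OF category_FRg epi e l l] by simp
    then have "(\<lambda>i\<in>{1..len z}. x) 1 = (\<lambda>i\<in>{1..len z}. y) 1" by simp
    then show "x = y" by (simp add: z_def)
  qed
  moreover have "sorts q = sorts c"
  proof -
    obtain g h where coeq: "is_coequalizer (FRg T) g h e" using epi unfolding is_regular_epi_def by blast
    have gh: "g \<in> hom (FRg T) (Dom (FRg T) g) c" "h \<in> hom (FRg T) (Dom (FRg T) g) c"
      "Cod (FRg T) g = c" "Cod (FRg T) e = q"
      using coeq homD[OF e] unfolding is_coequalizer_def hom_def by auto
    \<comment> \<open>Without variables every pair into \<open>c\<close> is identified on the way to
      \<open>z\<close>, so the arrow descends to \<open>q\<close>; an arrow
      \<open>q \<rightarrow> z\<close> exists only if \<open>q\<close> has all sorts of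
      \<open>c\<close>.\<close>
    define z where "z = (0 :: nat, sorts c, \<lambda>i :: nat. undefined :: 'a)"
    have z: "z \<in> FRg_obj T" using c unfolding z_def FRg_obj_iff by auto
    let ?k = "(c, \<lambda>i\<in>{1..len z}. i, z)"
    have k: "?k \<in> hom (FRg T) c z" by (rule FRg_homI[OF c z]) (auto simp: z_def)
    have "Comp (FRg T) ?k g = Comp (FRg T) ?k h"
      by (rule FRg_hom_eqI[OF FRg_comp_hom[OF gh(1) k] FRg_comp_hom[OF gh(2) k]]) (simp add: z_def)
    then obtain l where "l \<in> hom (FRg T) q z" using coequalizer_factor[OF coeq] k gh(3,4) by metis
    then show ?thesis using FRg_homD(3) FRg_homD(3)[OF e] by (fastforce simp: z_def)
  qed
  ultimately show "inj_on (fn e) {1..len q} \<and> sorts q = sorts c" by simp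
next
  assume a: "inj_on (fn e) {1..len q} \<and> sorts q = sorts c"
  have c: "c \<in> FRg_obj T" and q: "q \<in> FRg_obj T" using FRg_homD(1,2)[OF e] .
  let ?n = "len c"
  \<comment> \<open>Two copies of the variables of \<open>c\<close>. One arrow uses the first copy
    throughout, the other moves to the second copy exactly off the image of \<open>e\<close>, so
    they agree on that image only.\<close>
  define d where "d = (?n + ?n, sorts c, \<lambda>i\<in>{1..?n + ?n}. if i \<le> ?n then tau c i else tau c (i - ?n))"
  have tau: "tau c x \<in> sorts c" if "x \<in> {1..?n}" for x using c that unfolding FRg_obj_iff by auto
  have "tau c (x - ?n) \<in> sorts c" if "x \<le> ?n + ?n" "\<not> x \<le> ?n" for x
    by (rule tau) (use that in auto)
  then have d: "d \<in> FRg_obj T" using c tau unfolding d_def FRg_obj_iff by auto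
  define f where "f = (\<lambda>i. if i \<in> fn e ` {1..len q} then i else i + ?n)"
  let ?g = "(d, \<lambda>i\<in>{1..?n}. i, c)" and ?h = "(d, \<lambda>i\<in>{1..?n}. f i, c)"
  have gh: "?g \<in> hom (FRg T) d c" "?h \<in> hom (FRg T) d c"
    by (rule FRg_homI[OF d c]; auto simp: d_def f_def)+
  have "fn e ` {1..len q} \<subseteq> {1..?n}" using FRg_homD(4)[OF e] by blast
  then have "fn e ` {1..len q} = {i \<in> {1..?n}. fn ?g i = fn ?h i}"
    by (auto simp: f_def)
  then show "is_regular_epi (FRg T) e"
    using FRg_coequalizerI[OF gh e] a unfolding is_regular_epi_def by blast
qed

text \<open>The pullback need not be computed. It is enough to have one commuting square whose leg
  into \<open>d\<close> is injective and keeps the sorts of \<open>d\<close>: this leg factors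
  through \<open>q\<close>, which forces both properties on \<open>q\<close>.\<close>

lemma FRg_regular_epi_pullback:
  assumes e: "is_regular_epi (FRg T) e" and pb: "is_pullback (FRg T) e g p q"
  shows "is_regular_epi (FRg T) q"
proof -
  define c y d v where "c = Dom (FRg T) e" and "y = Cod (FRg T) e" and "d = Dom (FRg T) g" and "v = Dom (FRg T) p"
  have eh: "e \<in> hom (FRg T) c y" and g: "g \<in> hom (FRg T) d y" and p: "p \<in> hom (FRg T) v c"
    and q: "q \<in> hom (FRg T) v d"
    using pb unfolding is_pullback_def hom_def c_def y_def d_def v_def by auto
  have inj: "inj_on (fn e) {1..len y}" and sy: "sorts y = sorts c" using e FRg_regular_epi_iff[OF eh] by auto
  have c: "c \<in> FRg_obj T" and d: "d \<in> FRg_obj T" and y: "y \<in> FRg_obj T"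
    using FRg_homD(1,2)[OF eh] FRg_homD(1)[OF g] by auto
  have sd: "sorts c \<subseteq> sorts d" using FRg_homD(3)[OF g] sy by simp
  define w where "w = (len d + len c, sorts d,
    \<lambda>i\<in>{1..len d + len c}. if i \<le> len d then tau d i else tau c (i - len d))"
  have "tau c (x - len d) \<in> sorts d" if "x \<le> len d + len c" "\<not> x \<le> len d" for x
  proof -
    have "x - len d \<in> {1..len c}" using that by auto
    then show ?thesis using c sd unfolding FRg_obj_iff by blast
  qed
  moreover have "tau d x \<in> sorts d" if "x \<in> {1..len d}" for x using d that unfolding FRg_obj_iff by auto
  ultimately have w: "w \<in> FRg_obj T" using d unfolding w_def FRg_obj_iff by auto
  \<comment> \<open>Positions of \<open>c\<close> that come from \<open>y\<close> are sent where
    \<open>g\<close> sends them, which makes the square commute; the others go to the second block.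
    Injectivity of \<open>fn e\<close> makes the first case well defined.\<close>
  define f where "f = (\<lambda>i. if i \<in> fn e ` {1..len y} then fn g (inv_into {1..len y} (fn e) i) else len d + i)"
  let ?q = "(w, \<lambda>i\<in>{1..len d}. i, d)" and ?p = "(w, \<lambda>i\<in>{1..len c}. f i, c)"
  have q': "?q \<in> hom (FRg T) w d" by (rule FRg_homI[OF w d]) (auto simp: w_def)
  have fe: "f (fn e j) = fn g j" if "j \<in> {1..len y}" for j
    using inj that by (simp add: f_def)
  have p': "?p \<in> hom (FRg T) w c"
  proof (rule FRg_homI[OF w c])
    fix i assume i: "i \<in> {1..len c}"
    show "f i \<in> {1..len w} \<and> tau w (f i) = tau c i"
    proof (cases "i \<in> fn e ` {1..len y}")
      case True
      then obtain j where j: "j \<in> {1..len y}" "i = fn e j" by blast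
      have "fn g j \<in> {1..len d}" "tau d (fn g j) = tau c i"
        using FRg_homD(4,5)[OF g j(1)] FRg_homD(5)[OF eh j(1)] j(2) by auto
      then show ?thesis using fe[OF j(1)] j(2) by (auto simp: w_def)
    next
      case False
      then show ?thesis using i by (auto simp: w_def f_def)
    qed
  qed (use sd in \<open>auto simp: w_def\<close>)
  have "Comp (FRg T) e ?p = Comp (FRg T) g ?q"
  proof (rule FRg_hom_eqI[OF FRg_comp_hom[OF p' eh] FRg_comp_hom[OF q' g]])
    fix i assume i: "i \<in> {1..len y}"
    show "fn (Comp (FRg T) e ?p) i = fn (Comp (FRg T) g ?q) i"
      unfolding FRg_comp_fn[OF eh i] FRg_comp_fn[OF g i]
      using fe[OF i] FRg_homD(4)[OF eh i] FRg_homD(4)[OF g i] by simp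
  qed
  then obtain h where h: "h \<in> hom (FRg T) w v" "Comp (FRg T) q h = ?q"
    using pullback_factor[OF pb, of ?p w ?q] p' q' unfolding c_def d_def v_def by metis
  have "inj_on (fn q) {1..len d}"
  proof (rule inj_onI)
    fix i j assume ij: "i \<in> {1..len d}" "j \<in> {1..len d}" "fn q i = fn q j"
    then have "fn ?q i = fn ?q j" using FRg_comp_fn[OF q, of _ h] h(2) by metis
    then show "i = j" using ij by simp
  qed
  moreover have "sorts d = sorts v" using FRg_homD(3)[OF h(1)] FRg_homD(3)[OF q] by (auto simp: w_def)
  ultimately show ?thesis using FRg_regular_epi_iff[OF q] by simp
qed

lemma regular_category_FRg: "regular_category (FRg T)"
  unfolding regular_category_def
proof (intro conjI allI impI)
  fix f p q assume "is_pullback (FRg T) f f p q"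
  then have "p \<in> hom (FRg T) (Dom (FRg T) p) (Dom (FRg T) f)" "q \<in> hom (FRg T) (Dom (FRg T) p) (Dom (FRg T) f)"
    unfolding is_pullback_def hom_def by auto
  then show "\<exists>e. is_coequalizer (FRg T) p q e" using FRg_coequalizer_exists by blast
qed (use category_FRg FRg_has_finite_limits FRg_regular_epi_pullback in blast)+

text \<open>Only the labels change, while lengths and underlying functions stay. The criteria for
  limits and regular epimorphisms speak of these functions and of sets of sorts, and direct images
  commute with unions.\<close>

lemma regular_functor_FRg_map:
  assumes f: "f \<in> T \<rightarrow> T'"
  shows "regular_functor (FRg T) (FRg T') (FRg_map f)"
proof -
  let ?F = "FRg_map f"
  have proj: "len (ObjMap ?F \<Gamma>) = len \<Gamma>" "sorts (ObjMap ?F \<Gamma>) = f ` sorts \<Gamma>"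
    "tau (ObjMap ?F \<Gamma>) = compose {1..len \<Gamma>} f (tau \<Gamma>)" for \<Gamma>
    by (cases \<Gamma>; simp add: FRg_map_def)+
  have arr: "ArrMap ?F u = (ObjMap ?F (fst u), fn u, ObjMap ?F (snd (snd u)))" for u
    by (cases u) (auto simp: FRg_map_def)
  have obj: "ObjMap ?F \<Gamma> \<in> FRg_obj T'" if "\<Gamma> \<in> FRg_obj T" for \<Gamma>
    using that f unfolding FRg_obj_iff proj by (fastforce simp: compose_def)
  have hom: "ArrMap ?F u \<in> hom (FRg T') (ObjMap ?F \<Gamma>) (ObjMap ?F \<Gamma>')" if u: "u \<in> hom (FRg T) \<Gamma> \<Gamma>'" for u \<Gamma> \<Gamma>'
  proof -
    note u' = FRg_homD[OF u]
    have "compose {1..len \<Gamma>} f (tau \<Gamma>) (fn u i) = compose {1..len \<Gamma>'} f (tau \<Gamma>') i"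
      if "i \<in> {1..len \<Gamma>'}" for i
      using u'(4,5)[OF that] that by (simp add: compose_def)
    then show ?thesis
      using u obj[OF u'(1)] obj[OF u'(2)] unfolding FRg_hom_iff arr proj by auto
  qed
  have fctr: "is_functor (FRg T) (FRg T') ?F"
    unfolding is_functor_def
  proof (intro conjI category_FRg ballI impI)
    show "ObjMap ?F x \<in> Obj (FRg T')" if "x \<in> Obj (FRg T)" for x
      using obj that by (simp add: FRg_simps)
    show "ArrMap ?F u \<in> hom (FRg T') (ObjMap ?F (Dom (FRg T) u)) (ObjMap ?F (Cod (FRg T) u))"
      if "u \<in> Arr (FRg T)" for u
      using hom[OF arr_hom[OF that]] .
    show "ArrMap ?F (Ident (FRg T) x) = Ident (FRg T') (ObjMap ?F x)" for x
      unfolding FRg_simps arr proj by simp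
    show "ArrMap ?F (Comp (FRg T) v u) = Comp (FRg T') (ArrMap ?F v) (ArrMap ?F u)" for u v
      unfolding FRg_simps arr proj by (simp add: proj)
  qed
  moreover have "is_regular_epi (FRg T') (ArrMap ?F e)" if e: "is_regular_epi (FRg T) e" for e
  proof -
    have eh: "e \<in> hom (FRg T) (Dom (FRg T) e) (Cod (FRg T) e)"
      using e unfolding is_regular_epi_def is_coequalizer_def hom_def by auto
    show ?thesis
      using e unfolding FRg_regular_epi_iff[OF eh] FRg_regular_epi_iff[OF hom[OF eh]] by (simp add: proj arr)
  qed
  moreover have "preserves_finite_limits (FRg T) (FRg T') ?F"
    unfolding preserves_finite_limits_def
  proof (intro allI impI)
    fix J D c l assume a: "finite_category J \<and> is_functor J (FRg T) D \<and> is_limit J (FRg T) D c l"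
    then have fin: "finite (Obj J)" and D: "is_functor J (FRg T) D" and lim: "is_limit J (FRg T) D c l"
      unfolding finite_category_def by auto
    have cone: "is_cone J (FRg T) D c l" using lim unfolding is_limit_def by simp
    have D': "is_functor J (FRg T') (comp_funct ?F D)" using is_functor_comp_funct[OF D fctr] .
    have len: "len (ObjMap (comp_funct ?F D) j) = len (ObjMap D j)" for j by (simp add: comp_funct_def proj)
    show "is_limit J (FRg T') (comp_funct ?F D) (ObjMap ?F c) (ArrMap ?F \<circ> l)"
    proof (rule FRg_limitI[OF D' functor_cone[OF fctr D cone]])
      show "sorts (ObjMap ?F c) \<subseteq> (\<Union>j\<in>Obj J. sorts (ObjMap (comp_funct ?F D) j))"
        unfolding proj FRg_limit_factor(1)[OF D fin lim compatible_tau[OF D]]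
        by (auto simp: comp_funct_def proj)
      show "\<exists>j\<in>Obj J. \<exists>x\<in>{1..len (ObjMap (comp_funct ?F D) j)}. fn ((ArrMap ?F \<circ> l) j) x = i"
        if "i \<in> {1..len (ObjMap ?F c)}" for i
        using FRg_limit_surj[OF D lim] that by (simp add: len proj arr)
      fix a :: "nat \<Rightarrow> nat \<Rightarrow> nat" assume "compatible J (comp_funct ?F D) a"
      then have "compatible J D a" unfolding compatible_def len by (simp add: comp_funct_def arr)
      from FRg_limit_factor(2)[OF D fin lim this]
      show "\<exists>b. \<forall>j\<in>Obj J. \<forall>x\<in>{1..len (ObjMap (comp_funct ?F D) j)}. b (fn ((ArrMap ?F \<circ> l) j) x) = a j x"
        by (simp add: len arr)
    qed
  qed
  ultimately show ?thesis using regular_category_FRg[of T] regular_category_FRg[of T'] unfolding regular_functor_def by blast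
qed

section \<open>The counit\<close>

text \<open>The value of \<open>FRg_unit\<close> without the restriction to \<open>T\<close>, so
  that it can be rewritten without a membership condition and shared between different sets of
  sorts.\<close>

definition unit_ctx :: "'t \<Rightarrow> 't ctx" where
  "unit_ctx t = (1, {t}, \<lambda>i\<in>{1..1}. t)"

lemma FRg_unit_eq: "t \<in> T \<Longrightarrow> FRg_unit T t = unit_ctx t"
  by (simp add: FRg_unit_def unit_ctx_def)

lemma unit_ctx_obj: "t \<in> T \<Longrightarrow> unit_ctx t \<in> FRg_obj T"
  by (auto simp: FRg_obj_iff unit_ctx_def)

lemma unit_ctx_simps:
  "len (unit_ctx t) = 1" "sorts (unit_ctx t) = {t}" "tau (unit_ctx t) (Suc 0) = t"
  by (auto simp: unit_ctx_def)

text \<open>An arbitrary choice of supports and product cones is fixed, since the claims about the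
  counit range over all such choices.\<close>

locale counit =
  fixes R :: "('o, 'a) precategory" (structure) and Supp p E
  assumes R: "regular_category R" and is_counit: "is_counit R Supp p E"
begin

lemma C: "category R"
  using R unfolding regular_category_def by auto

lemma cover:
  assumes "s \<in> Obj R"
  obtains e where "subterminal R (Supp s)" "is_regular_epi R e" "e \<in> hom R s (Supp s)"
  using supportD[OF C] is_counit assms unfolding is_counit_def by metis

lemma Supp_eq: "s \<in> Obj R \<Longrightarrow> a \<in> hom R w (Supp s) \<Longrightarrow> b \<in> hom R w (Supp s) \<Longrightarrow> a = b"
  using cover subterminalD by metis

lemma prod:
  assumes "\<Gamma> \<in> FRg_obj (Obj R)"
  shows "is_product R ({1..len \<Gamma>} <+> sorts \<Gamma>) (case_sum (tau \<Gamma>) Supp) (ObjMap E \<Gamma>) (p \<Gamma>)"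
  using is_counit assms unfolding is_counit_def by (cases \<Gamma>) (auto simp: FRg_simps)

lemma obj: "\<Gamma> \<in> FRg_obj (Obj R) \<Longrightarrow> ObjMap E \<Gamma> \<in> Obj R"
  using prod unfolding is_product_def by blast

lemma tau_obj: "\<Gamma> \<in> FRg_obj (Obj R) \<Longrightarrow> i \<in> {1..len \<Gamma>} \<Longrightarrow> tau \<Gamma> i \<in> sorts \<Gamma>"
  and sorts_obj: "\<Gamma> \<in> FRg_obj (Obj R) \<Longrightarrow> s \<in> sorts \<Gamma> \<Longrightarrow> s \<in> Obj R"
  unfolding FRg_obj_iff by auto

lemma proj:
  assumes "\<Gamma> \<in> FRg_obj (Obj R)"
  shows "i \<in> {1..len \<Gamma>} \<Longrightarrow> p \<Gamma> (Inl i) \<in> hom R (ObjMap E \<Gamma>) (tau \<Gamma> i)"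
    and "s \<in> sorts \<Gamma> \<Longrightarrow> p \<Gamma> (Inr s) \<in> hom R (ObjMap E \<Gamma>) (Supp s)"
proof -
  have pr: "\<forall>i\<in>{1..len \<Gamma>} <+> sorts \<Gamma>. p \<Gamma> i \<in> hom R (ObjMap E \<Gamma>) (case_sum (tau \<Gamma>) Supp i)"
    using prod[OF assms] unfolding is_product_def by blast
  show "i \<in> {1..len \<Gamma>} \<Longrightarrow> p \<Gamma> (Inl i) \<in> hom R (ObjMap E \<Gamma>) (tau \<Gamma> i)"
    "s \<in> sorts \<Gamma> \<Longrightarrow> p \<Gamma> (Inr s) \<in> hom R (ObjMap E \<Gamma>) (Supp s)"
    using bspec[OF pr InlI] bspec[OF pr InrI] by auto
qed

lemma hom:
  assumes "u \<in> hom (FRg (Obj R)) \<Gamma> \<Gamma>'"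
  shows "ArrMap E u \<in> hom R (ObjMap E \<Gamma>) (ObjMap E \<Gamma>')"
    and "i \<in> {1..len \<Gamma>'} \<Longrightarrow> p \<Gamma>' (Inl i) \<cdot> ArrMap E u = p \<Gamma> (Inl (fn u i))"
proof -
  obtain n S t f n' S' t' where u: "u = ((n, S, t), f, (n', S', t'))" by (metis prod_cases3)
  have "((n, S, t), f, (n', S', t')) \<in> Arr (FRg (Obj R))" "\<Gamma> = (n, S, t)" "\<Gamma>' = (n', S', t')"
    using assms homD(1) FRg_homD(6,7)[OF assms] u by auto
  then show "ArrMap E u \<in> hom R (ObjMap E \<Gamma>) (ObjMap E \<Gamma>')"
    "i \<in> {1..len \<Gamma>'} \<Longrightarrow> p \<Gamma>' (Inl i) \<cdot> ArrMap E u = p \<Gamma> (Inl (fn u i))"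
    using is_counit u unfolding is_counit_def by (fastforce simp: Let_def)+
qed

text \<open>The components at supports agree automatically, these being subterminal; only those at
  variables have to be compared.\<close>

lemma ext:
  assumes \<Gamma>: "\<Gamma> \<in> FRg_obj (Obj R)" and h: "h \<in> hom R X (ObjMap E \<Gamma>)" "h' \<in> hom R X (ObjMap E \<Gamma>)"
    and eq: "\<And>i. i \<in> {1..len \<Gamma>} \<Longrightarrow> p \<Gamma> (Inl i) \<cdot> h = p \<Gamma> (Inl i) \<cdot> h'"
  shows "h = h'"
proof (rule product_joint_mono[OF C prod[OF \<Gamma>] h])
  fix i assume "i \<in> {1..len \<Gamma>} <+> sorts \<Gamma>"
  then show "p \<Gamma> i \<cdot> h = p \<Gamma> i \<cdot> h'"
  proof
    fix s assume s: "i = Inr s" "s \<in> sorts \<Gamma>"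
    have "p \<Gamma> (Inr s) \<in> hom R (ObjMap E \<Gamma>) (Supp s)" using proj(2)[OF \<Gamma> s(2)] .
    then show ?thesis
      using Supp_eq[OF sorts_obj[OF \<Gamma> s(2)]] comp_hom[OF C h(1)] comp_hom[OF C h(2)] s(1) by blast
  qed (use eq in auto)
qed

text \<open>For the same reason the maps into supports need only exist; which ones are taken does
  not affect the result.\<close>

lemma induced:
  assumes \<Gamma>: "\<Gamma> \<in> FRg_obj (Obj R)" and X: "X \<in> Obj R"
    and a: "\<And>i. i \<in> {1..len \<Gamma>} \<Longrightarrow> a i \<in> hom R X (tau \<Gamma> i)"
    and b: "\<And>s. s \<in> sorts \<Gamma> \<Longrightarrow> \<exists>b. b \<in> hom R X (Supp s)"
  obtains h where "h \<in> hom R X (ObjMap E \<Gamma>)" "\<And>i. i \<in> {1..len \<Gamma>} \<Longrightarrow> p \<Gamma> (Inl i) \<cdot> h = a i"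
proof -
  obtain b' where b': "\<And>s. s \<in> sorts \<Gamma> \<Longrightarrow> b' s \<in> hom R X (Supp s)" using b by metis
  have "case_sum a b' i \<in> hom R X (case_sum (tau \<Gamma>) Supp i)" if "i \<in> {1..len \<Gamma>} <+> sorts \<Gamma>" for i
    using that a b' by auto
  then obtain h where "h \<in> hom R X (ObjMap E \<Gamma>)"
    "\<And>i. i \<in> {1..len \<Gamma>} <+> sorts \<Gamma> \<Longrightarrow> p \<Gamma> i \<cdot> h = case_sum a b' i"
    using product_induced[OF C prod[OF \<Gamma>] X, of "case_sum a b'"] by blast
  then show thesis using that by fastforce
qed

lemma is_functor: "is_functor (FRg (Obj R)) R E"
  unfolding is_functor_def
proof (intro conjI category_FRg C ballI impI)
  fix u assume u: "u \<in> Arr (FRg (Obj R))"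
  show "ArrMap E u \<in> hom R (ObjMap E (Dom (FRg (Obj R)) u)) (ObjMap E (Cod (FRg (Obj R)) u))"
    using hom(1)[OF arr_hom[OF u]] .
  fix v assume v: "v \<in> Arr (FRg (Obj R))" and uv: "Cod (FRg (Obj R)) u = Dom (FRg (Obj R)) v"
  define \<Gamma>1 \<Gamma>2 \<Gamma>3 where "\<Gamma>1 = Dom (FRg (Obj R)) u" and "\<Gamma>2 = Dom (FRg (Obj R)) v" and "\<Gamma>3 = Cod (FRg (Obj R)) v"
  have uh: "u \<in> hom (FRg (Obj R)) \<Gamma>1 \<Gamma>2" and vh: "v \<in> hom (FRg (Obj R)) \<Gamma>2 \<Gamma>3"
    using u v uv unfolding hom_def \<Gamma>1_def \<Gamma>2_def \<Gamma>3_def by auto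
  note vu = FRg_comp_hom[OF uh vh]
  show "ArrMap E (Comp (FRg (Obj R)) v u) = ArrMap E v \<cdot> ArrMap E u"
  proof (rule ext[OF FRg_homD(2)[OF vh] hom(1)[OF vu] comp_hom[OF C hom(1)[OF uh] hom(1)[OF vh]]])
    fix i assume i: "i \<in> {1..len \<Gamma>3}"
    show "p \<Gamma>3 (Inl i) \<cdot> ArrMap E (Comp (FRg (Obj R)) v u) = p \<Gamma>3 (Inl i) \<cdot> (ArrMap E v \<cdot> ArrMap E u)"
      using comp_assoc[OF C hom(1)[OF uh] hom(1)[OF vh] proj(1)[OF FRg_homD(2)[OF vh] i]]
        hom(2)[OF vu i] hom(2)[OF vh i] hom(2)[OF uh FRg_homD(4)[OF vh i]] FRg_comp_fn[OF vh i]
      by simp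
  qed
next
  fix \<Gamma> assume "\<Gamma> \<in> Obj (FRg (Obj R))"
  then have \<Gamma>: "\<Gamma> \<in> FRg_obj (Obj R)" by (simp add: FRg_simps)
  then show "ObjMap E \<Gamma> \<in> Obj R" using obj by blast
  note i = FRg_ident_hom[OF \<Gamma>]
  show "ArrMap E (Ident (FRg (Obj R)) \<Gamma>) = Ident R (ObjMap E \<Gamma>)"
  proof (rule ext[OF \<Gamma> hom(1)[OF i] ident_hom[OF C obj[OF \<Gamma>]]])
    fix x assume x: "x \<in> {1..len \<Gamma>}"
    show "p \<Gamma> (Inl x) \<cdot> ArrMap E (Ident (FRg (Obj R)) \<Gamma>) = p \<Gamma> (Inl x) \<cdot> Ident R (ObjMap E \<Gamma>)"
      using hom(2)[OF i x] FRg_ident_fn[OF x] comp_ident(1)[OF C proj(1)[OF \<Gamma> x]] by metis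
  qed
qed

text \<open>A cone over \<open>E \<circ> D\<close> is a compatible family of arrows of \<open>R\<close>, which factors through the limit of
  \<open>D\<close> because that limit is a colimit of finite sets.\<close>

lemma preserves_limits: "preserves_finite_limits (FRg (Obj R)) R E"
  unfolding preserves_finite_limits_def
proof (intro allI impI)
  fix J :: "(nat, nat) precategory" and D c l
  assume a: "finite_category J \<and> is_functor J (FRg (Obj R)) D \<and> is_limit J (FRg (Obj R)) D c l"
  then have fin: "finite (Obj J)" and D: "is_functor J (FRg (Obj R)) D"
    and lim: "is_limit J (FRg (Obj R)) D c l"
    unfolding finite_category_def by auto
  have cone: "is_cone J (FRg (Obj R)) D c l" using lim unfolding is_limit_def by simp
  have c: "c \<in> FRg_obj (Obj R)" and l: "\<And>j. j \<in> Obj J \<Longrightarrow> l j \<in> hom (FRg (Obj R)) c (ObjMap D j)"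
    using cone unfolding FRg_cone_iff[OF D] by auto
  have Do: "ObjMap D j \<in> FRg_obj (Obj R)" if "j \<in> Obj J" for j
    using D that unfolding is_functor_def by (auto simp: FRg_simps)
  show "is_limit J R (comp_funct E D) (ObjMap E c) (ArrMap E \<circ> l)"
    unfolding is_limit_def
  proof (intro conjI allI impI functor_cone[OF is_functor D cone])
    fix X m assume "is_cone J R (comp_funct E D) X m"
    then have X: "X \<in> Obj R" and m: "\<And>j. j \<in> Obj J \<Longrightarrow> m j \<in> hom R X (ObjMap E (ObjMap D j))"
      and mc: "\<And>u. u \<in> Arr J \<Longrightarrow> ArrMap E (ArrMap D u) \<cdot> m (Dom J u) = m (Cod J u)"
      unfolding is_cone_def by (auto simp: comp_funct_def)
    \<comment> \<open>The components of the cone at all variables, as one family with values in the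
      arrows of \<open>R\<close>. Their codomains vary with the sort; that they fit the limit is
      checked after the factorisation.\<close>
    define a where "a = (\<lambda>j x. p (ObjMap D j) (Inl x) \<cdot> m j)"
    have "compatible J D a"
      unfolding compatible_def
    proof (intro ballI)
      fix u x assume u: "u \<in> Arr J" and x: "x \<in> {1..len (ObjMap D (Cod J u))}"
      have j: "Dom J u \<in> Obj J" "Cod J u \<in> Obj J" using u D unfolding is_functor_def category_def by auto
      note Du = functor_hom[OF D arr_hom[OF u]]
      show "a (Cod J u) x = a (Dom J u) (fn (ArrMap D u) x)"
        using comp_assoc[OF C m[OF j(1)] hom(1)[OF Du] proj(1)[OF Do[OF j(2)] x]] hom(2)[OF Du x] mc[OF u]
        by (simp add: a_def)
    qed
    from FRg_limit_factor[OF D fin lim this]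
    obtain b where b: "\<And>j x. j \<in> Obj J \<Longrightarrow> x \<in> {1..len (ObjMap D j)} \<Longrightarrow> b (fn (l j) x) = a j x"
      and sorts: "sorts c = (\<Union>j\<in>Obj J. sorts (ObjMap D j))" by blast
    have "b i \<in> hom R X (tau c i)" if i: "i \<in> {1..len c}" for i
    proof -
      obtain j x where j: "j \<in> Obj J" "x \<in> {1..len (ObjMap D j)}" "fn (l j) x = i"
        using FRg_limit_surj[OF D lim i] by blast
      then show ?thesis
        using b[OF j(1,2)] comp_hom[OF C m[OF j(1)] proj(1)[OF Do[OF j(1)] j(2)]]
          FRg_homD(5)[OF l[OF j(1)] j(2)] by (simp add: a_def)
    qed
    \<comment> \<open>Each sort of the limit occurs in some context of the diagram, and the cone leg
      there, followed by a projection, reaches its support.\<close>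
    moreover have "\<exists>b. b \<in> hom R X (Supp s)" if s: "s \<in> sorts c" for s
    proof -
      obtain j where "j \<in> Obj J" "s \<in> sorts (ObjMap D j)" using s sorts by auto
      then show ?thesis using comp_hom[OF C m proj(2)[OF Do]] by blast
    qed
    ultimately obtain h where h: "h \<in> hom R X (ObjMap E c)" "\<And>i. i \<in> {1..len c} \<Longrightarrow> p c (Inl i) \<cdot> h = b i"
      using induced[OF c X] by blast
    have eq: "p (ObjMap D j) (Inl x) \<cdot> (ArrMap E (l j) \<cdot> k) = p c (Inl (fn (l j) x)) \<cdot> k"
      if j: "j \<in> Obj J" and x: "x \<in> {1..len (ObjMap D j)}" and k: "k \<in> hom R X (ObjMap E c)" for j x k
      using comp_assoc[OF C k hom(1)[OF l[OF j]] proj(1)[OF Do[OF j] x]] hom(2)[OF l[OF j] x] by simp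
    have "ArrMap E (l j) \<cdot> h = m j" if j: "j \<in> Obj J" for j
    proof (rule ext[OF Do[OF j] comp_hom[OF C h(1) hom(1)[OF l[OF j]]] m[OF j]])
      fix x assume x: "x \<in> {1..len (ObjMap D j)}"
      show "p (ObjMap D j) (Inl x) \<cdot> (ArrMap E (l j) \<cdot> h) = p (ObjMap D j) (Inl x) \<cdot> m j"
        using eq[OF j x h(1)] h(2)[OF FRg_homD(4)[OF l[OF j] x]] b[OF j x] by (simp add: a_def)
    qed
    moreover have "k = h"
      if k: "k \<in> hom R X (ObjMap E c)" "\<forall>j\<in>Obj J. ArrMap E (l j) \<cdot> k = m j" for k
    proof (rule ext[OF c k(1) h(1)])
      fix i assume i: "i \<in> {1..len c}"
      obtain j x where j: "j \<in> Obj J" "x \<in> {1..len (ObjMap D j)}" "fn (l j) x = i"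
        using FRg_limit_surj[OF D lim i] by blast
      then show "p c (Inl i) \<cdot> k = p c (Inl i) \<cdot> h"
        using eq[OF j(1,2) k(1)] k(2) h(2)[OF i] b[OF j(1,2)] by (simp add: a_def)
    qed
    ultimately show "\<exists>!h. h \<in> hom R X (ObjMap E c) \<and> (\<forall>j\<in>Obj J. (ArrMap E \<circ> l) j \<cdot> h = m j)"
      unfolding o_apply using h(1) by (intro ex1I[of _ h]) blast+
  qed
qed

text \<open>Omitting a factor \<open>t\<close> whose support remains is a pullback of the cover of \<open>Supp t\<close> by \<open>t\<close>.\<close>

lemma regular_epi_step:
  assumes \<Gamma>: "\<Gamma> \<in> FRg_obj (Obj R)" and u: "u \<in> hom (FRg (Obj R)) \<Delta> \<Gamma>"
    and len: "len \<Delta> = Suc (len \<Gamma>)" and sorts: "sorts \<Delta> = sorts \<Gamma>"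
    and fnu: "\<And>i. i \<in> {1..len \<Gamma>} \<Longrightarrow> fn u i = i"
  shows "is_regular_epi R (ArrMap E u)"
proof -
  define n where "n = Suc (len \<Gamma>)"
  define t where "t = tau \<Delta> n"
  have \<Delta>: "\<Delta> \<in> FRg_obj (Obj R)" using FRg_homD(1)[OF u] .
  have n: "n \<in> {1..len \<Delta>}" unfolding n_def len by simp
  \<comment> \<open>The equality of sorts is used here: the sort of the omitted variable remains in
    \<Gamma>, so \<open>Supp t\<close> is a factor of \<open>ObjMap E \<Gamma>\<close>.\<close>
  have t: "t \<in> sorts \<Gamma>" using tau_obj[OF \<Delta> n] sorts unfolding t_def by simp
  have to: "t \<in> Obj R" using sorts_obj[OF \<Gamma> t] .
  obtain e where e: "is_regular_epi R e" "e \<in> hom R t (Supp t)" using cover[OF to] .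
  have q: "p \<Delta> (Inl n) \<in> hom R (ObjMap E \<Delta>) t" using proj(1)[OF \<Delta> n] unfolding t_def .
  note Eu = hom(1)[OF u]
  note pt = proj(2)[OF \<Gamma> t]
  have "is_pullback R e (p \<Gamma> (Inr t)) (p \<Delta> (Inl n)) (ArrMap E u)"
    unfolding is_pullback_def
  proof (intro conjI allI ballI impI)
    show "e \<cdot> p \<Delta> (Inl n) = p \<Gamma> (Inr t) \<cdot> ArrMap E u"
      using Supp_eq[OF to comp_hom[OF C q e(2)] comp_hom[OF C Eu pt]] .
    fix w p' q' assume "p' \<in> hom R w (Dom R e)" "q' \<in> hom R w (Dom R (p \<Gamma> (Inr t)))"
    then have p': "p' \<in> hom R w t" and q': "q' \<in> hom R w (ObjMap E \<Gamma>)"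
      using homD(2)[OF e(2)] homD(2)[OF pt] by auto
    define a where "a = (\<lambda>i. if i = n then p' else p \<Gamma> (Inl i) \<cdot> q')"
    have a: "a i \<in> hom R w (tau \<Delta> i)" if i: "i \<in> {1..len \<Delta>}" for i
    proof (cases "i = n")
      case True then show ?thesis using p' by (simp add: a_def t_def)
    next
      case False
      then have i': "i \<in> {1..len \<Gamma>}" using i len unfolding n_def by auto
      then have "tau \<Delta> i = tau \<Gamma> i" using FRg_homD(5)[OF u i'] fnu[OF i'] by simp
      then show ?thesis using comp_hom[OF C q' proj(1)[OF \<Gamma> i']] False by (simp add: a_def)
    qed
    have "\<exists>b. b \<in> hom R w (Supp s)" if "s \<in> sorts \<Delta>" for s
      using comp_hom[OF C q' proj(2)[OF \<Gamma>]] that sorts by blast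
    then obtain h where h: "h \<in> hom R w (ObjMap E \<Delta>)" "\<And>i. i \<in> {1..len \<Delta>} \<Longrightarrow> p \<Delta> (Inl i) \<cdot> h = a i"
      using induced[OF \<Delta> hom_obj(1)[OF C p'] a] by blast
    have eq: "p \<Gamma> (Inl i) \<cdot> (ArrMap E u \<cdot> k) = p \<Delta> (Inl i) \<cdot> k"
      if i: "i \<in> {1..len \<Gamma>}" and k: "k \<in> hom R w (ObjMap E \<Delta>)" for i k
      using comp_assoc[OF C k Eu proj(1)[OF \<Gamma> i]] hom(2)[OF u i] fnu[OF i] by simp
    have ne: "i \<in> {1..len \<Delta>}" "i \<noteq> n" if "i \<in> {1..len \<Gamma>}" for i using that len unfolding n_def by auto
    have "ArrMap E u \<cdot> h = q'"
    proof (rule ext[OF \<Gamma> comp_hom[OF C h(1) Eu] q'])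
      fix i assume i: "i \<in> {1..len \<Gamma>}"
      show "p \<Gamma> (Inl i) \<cdot> (ArrMap E u \<cdot> h) = p \<Gamma> (Inl i) \<cdot> q'"
        using eq[OF i h(1)] h(2)[OF ne(1)[OF i]] ne(2)[OF i] by (simp add: a_def)
    qed
    moreover have "p \<Delta> (Inl n) \<cdot> h = p'" using h(2)[OF n] by (simp add: a_def)
    moreover have "k = h"
      if k: "k \<in> hom R w (ObjMap E \<Delta>)" "p \<Delta> (Inl n) \<cdot> k = p'" "ArrMap E u \<cdot> k = q'" for k
    proof (rule ext[OF \<Delta> k(1) h(1)])
      fix i assume i: "i \<in> {1..len \<Delta>}"
      show "p \<Delta> (Inl i) \<cdot> k = p \<Delta> (Inl i) \<cdot> h"
      proof (cases "i = n")
        case True then show ?thesis using h(2)[OF i] k(2) by (simp add: a_def)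
      next
        case False
        then have i': "i \<in> {1..len \<Gamma>}" using i len unfolding n_def by auto
        then show ?thesis using eq[OF i' k(1)] k(3) h(2)[OF i] False by (simp add: a_def)
      qed
    qed
    ultimately show "\<exists>!h. h \<in> hom R w (Dom R (p \<Delta> (Inl n))) \<and> p \<Delta> (Inl n) \<cdot> h = p' \<and> ArrMap E u \<cdot> h = q'"
      unfolding homD(2)[OF q] using h(1) by (intro ex1I[of _ h]) blast+
  qed (use homD[OF e(2)] homD[OF pt] homD[OF q] homD[OF Eu] in auto)
  then show ?thesis using R e(1) unfolding regular_category_def by blast
qed

text \<open>Induction on the number of variables of \<Delta> missed by \<open>fn e\<close>. If none
  is missed, \<open>e\<close> is an isomorphism. Otherwise \<open>e\<close> factors through \<Gamma>
  extended by one missed variable, and regular epimorphisms compose in \<open>R\<close>.\<close>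

lemma regular_epi:
  assumes e: "e \<in> hom (FRg (Obj R)) \<Delta> \<Gamma>" "inj_on (fn e) {1..len \<Gamma>}" "sorts \<Gamma> = sorts \<Delta>"
  shows "is_regular_epi R (ArrMap E e)"
  using e
proof (induction "card ({1..len \<Delta>} - fn e ` {1..len \<Gamma>})" arbitrary: e \<Gamma>)
  case 0
  have sub: "fn e ` {1..len \<Gamma>} \<subseteq> {1..len \<Delta>}" using FRg_homD(4)[OF "0.prems"(1)] by blast
  then have bij: "bij_betw (fn e) {1..len \<Gamma>} {1..len \<Delta>}"
    using "0.hyps" "0.prems"(2) unfolding bij_betw_def by auto
  define g where "g = inv_into {1..len \<Gamma>} (fn e)"
  have g: "g i \<in> {1..len \<Gamma>}" "fn e (g i) = i" if "i \<in> {1..len \<Delta>}" for i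
    using bij_betwE[OF bij_betw_inv_into[OF bij]] bij_betw_inv_into_right[OF bij] that unfolding g_def by auto
  have g': "g (fn e i) = i" if "i \<in> {1..len \<Gamma>}" for i
    using bij_betw_inv_into_left[OF bij that] unfolding g_def .
  note o = FRg_homD(1,2)[OF "0.prems"(1)]
  let ?e' = "(\<Gamma>, \<lambda>i\<in>{1..len \<Delta>}. g i, \<Delta>)"
  have e': "?e' \<in> hom (FRg (Obj R)) \<Gamma> \<Delta>"
    using g FRg_homD(5)[OF "0.prems"(1) g(1)] "0.prems"(3) by (intro FRg_homI o) auto
  have "e \<in> isos (FRg (Obj R)) \<Delta> \<Gamma>"
  proof (rule isosI[OF "0.prems"(1) e'])
    show "Comp (FRg (Obj R)) ?e' e = Ident (FRg (Obj R)) \<Delta>"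
    proof (rule FRg_hom_eqI[OF FRg_comp_hom[OF "0.prems"(1) e'] FRg_ident_hom[OF o(1)]])
      fix i assume i: "i \<in> {1..len \<Delta>}"
      show "fn (Comp (FRg (Obj R)) ?e' e) i = fn (Ident (FRg (Obj R)) \<Delta>) i"
        unfolding FRg_comp_fn[OF e' i] FRg_ident_fn[OF i] using g(2) i by simp
    qed
    show "Comp (FRg (Obj R)) e ?e' = Ident (FRg (Obj R)) \<Gamma>"
    proof (rule FRg_hom_eqI[OF FRg_comp_hom[OF e' "0.prems"(1)] FRg_ident_hom[OF o(2)]])
      fix i assume i: "i \<in> {1..len \<Gamma>}"
      show "fn (Comp (FRg (Obj R)) e ?e') i = fn (Ident (FRg (Obj R)) \<Gamma>) i"
        unfolding FRg_comp_fn[OF "0.prems"(1) i] FRg_ident_fn[OF i]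
        using g'[OF i] FRg_homD(4)[OF "0.prems"(1) i] by simp
    qed
  qed
  then show ?case using iso_regular_epi[OF C functor_isos[OF is_functor]] by blast
next
  case (Suc k)
  note o = FRg_homD(1,2)[OF Suc.prems(1)]
  have "{1..len \<Delta>} - fn e ` {1..len \<Gamma>} \<noteq> {}" using Suc.hyps(2) by (metis card.empty nat.distinct(1))
  then obtain y where y: "y \<in> {1..len \<Delta>}" "y \<notin> fn e ` {1..len \<Gamma>}" by blast
  let ?n = "Suc (len \<Gamma>)"
  \<comment> \<open>The missed variable \<open>y\<close> becomes the new last variable, the position
    at which \<open>regular_epi_step\<close> omits a factor.\<close>
  define f where "f = (\<lambda>i. if i = ?n then y else fn e i)"
  have f: "f i \<in> {1..len \<Delta>}" if "i \<in> {1..?n}" for i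
    using that y FRg_homD(4)[OF Suc.prems(1), of i] by (auto simp: f_def le_Suc_eq)
  define \<Theta> where "\<Theta> = (?n, sorts \<Gamma>, \<lambda>i\<in>{1..?n}. tau \<Delta> (f i))"
  have "tau \<Delta> (f i) \<in> sorts \<Gamma>" if "i \<in> {1..?n}" for i
    using tau_obj[OF o(1) f[OF that]] Suc.prems(3) by simp
  then have \<Theta>: "\<Theta> \<in> FRg_obj (Obj R)" using o(2) unfolding \<Theta>_def FRg_obj_iff by auto
  let ?v = "(\<Delta>, \<lambda>i\<in>{1..len \<Theta>}. f i, \<Theta>)" and ?u = "(\<Theta>, \<lambda>i\<in>{1..len \<Gamma>}. i, \<Gamma>)"
  have v: "?v \<in> hom (FRg (Obj R)) \<Delta> \<Theta>"
    by (rule FRg_homI[OF o(1) \<Theta>]) (use f Suc.prems(3) in \<open>auto simp: \<Theta>_def\<close>)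
  have u: "?u \<in> hom (FRg (Obj R)) \<Theta> \<Gamma>"
    by (rule FRg_homI[OF \<Theta> o(2)]) (use FRg_homD(5)[OF Suc.prems(1)] in \<open>auto simp: \<Theta>_def f_def\<close>)
  have e: "e = Comp (FRg (Obj R)) ?u ?v"
  proof (rule FRg_hom_eqI[OF Suc.prems(1) FRg_comp_hom[OF v u]])
    fix i assume i: "i \<in> {1..len \<Gamma>}"
    show "fn e i = fn (Comp (FRg (Obj R)) ?u ?v) i"
      unfolding FRg_comp_fn[OF u i] using i by (simp add: f_def \<Theta>_def)
  qed
  have im: "fn ?v ` {1..len \<Theta>} = insert y (fn e ` {1..len \<Gamma>})"
  proof -
    have "{1..len \<Theta>} = insert ?n {1..len \<Gamma>}" by (auto simp: \<Theta>_def)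
    then show ?thesis by (auto simp: f_def \<Theta>_def)
  qed
  have "{1..len \<Delta>} - fn ?v ` {1..len \<Theta>} = ({1..len \<Delta>} - fn e ` {1..len \<Gamma>}) - {y}"
    unfolding im by auto
  then have k: "k = card ({1..len \<Delta>} - fn ?v ` {1..len \<Theta>})"
    using Suc.hyps(2) y by simp
  have inj: "inj_on (fn ?v) {1..len \<Theta>}"
  proof -
    have "inj_on f {1..?n}"
    proof (rule inj_onI)
      fix i j assume ij: "i \<in> {1..?n}" "j \<in> {1..?n}" "f i = f j"
      have f': "k \<in> {1..len \<Gamma>}" "f k = fn e k" "f k \<noteq> y" if "k \<in> {1..?n}" "k \<noteq> ?n" for k
      proof -
        show k: "k \<in> {1..len \<Gamma>}" using that by simp
        show "f k = fn e k" using that(2) by (simp add: f_def)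
        then show "f k \<noteq> y" using y(2) k by blast
      qed
      have fn: "f ?n = y" by (simp add: f_def)
      show "i = j"
      proof (cases "i = ?n \<or> j = ?n")
        case True
        then show ?thesis using f'(3)[OF ij(1)] f'(3)[OF ij(2)] ij(3) fn by metis
      next
        case False
        then show ?thesis
          using inj_onD[OF Suc.prems(2), of i j] f'(1,2)[OF ij(1)] f'(1,2)[OF ij(2)] ij(3) by simp
      qed
    qed
    then show ?thesis by (simp add: inj_on_restrict_eq \<Theta>_def)
  qed
  have "is_regular_epi R (ArrMap E ?v)"
    using Suc.hyps(1)[OF k v inj] Suc.prems(3) by (simp add: \<Theta>_def)
  moreover have "is_regular_epi R (ArrMap E ?u)"
    by (rule regular_epi_step[OF o(2) u]) (auto simp: \<Theta>_def)
  ultimately have "is_regular_epi R (ArrMap E ?u \<cdot> ArrMap E ?v)"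
    using regular_epi_comp[OF R _ hom(1)[OF v] _ hom(1)[OF u]] by blast
  then show ?case using functor_comp[OF is_functor v u] e by simp
qed

lemma is_regular_functor: "regular_functor (FRg (Obj R)) R E"
  unfolding regular_functor_def
proof (intro conjI allI impI regular_category_FRg R is_functor preserves_limits)
  fix e assume e: "is_regular_epi (FRg (Obj R)) e"
  then have "e \<in> hom (FRg (Obj R)) (Dom (FRg (Obj R)) e) (Cod (FRg (Obj R)) e)"
    unfolding is_regular_epi_def is_coequalizer_def hom_def by auto
  with e show "is_regular_epi R (ArrMap E e)" using FRg_regular_epi_iff regular_epi by blast
qed

text \<open>The value at the unary context is a product of \<open>r\<close> and
  \<open>Supp r\<close>; the inverse of the projection pairs the identity of \<open>r\<close> with
  its cover.\<close>

lemma proj_unit_iso: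
  assumes r: "r \<in> Obj R"
  shows "p (FRg_unit (Obj R) r) (Inl 1) \<in> isos R (ObjMap E (FRg_unit (Obj R) r)) r"
proof -
  let ?U = "unit_ctx r"
  have U: "?U \<in> FRg_obj (Obj R)" using unit_ctx_obj[OF r] .
  have q: "p ?U (Inl 1) \<in> hom R (ObjMap E ?U) r"
    using proj(1)[OF U, of 1] by (simp add: unit_ctx_simps)
  obtain e where e: "e \<in> hom R r (Supp r)" using cover[OF r] .
  obtain h where h: "h \<in> hom R r (ObjMap E ?U)"
    "\<And>i. i \<in> {1..len ?U} \<Longrightarrow> p ?U (Inl i) \<cdot> h = Ident R r"
    by (rule induced[OF U r, of "\<lambda>_. Ident R r"])
      (use e ident_hom[OF C r] in \<open>auto simp: unit_ctx_simps\<close>)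
  have ph: "p ?U (Inl 1) \<cdot> h = Ident R r" using h(2)[of 1] by (simp add: unit_ctx_simps)
  have "h \<cdot> p ?U (Inl 1) = Ident R (ObjMap E ?U)"
  proof (rule ext[OF U comp_hom[OF C q h(1)] ident_hom[OF C obj[OF U]]])
    fix i assume "i \<in> {1..len ?U}"
    then have i: "i = 1" by (simp add: unit_ctx_simps)
    show "p ?U (Inl i) \<cdot> (h \<cdot> p ?U (Inl 1)) = p ?U (Inl i) \<cdot> Ident R (ObjMap E ?U)"
      using comp_assoc[OF C q h(1) q] ph comp_ident[OF C q] i by simp
  qed
  then show ?thesis using isosI[OF q h(1) _ ph] FRg_unit_eq[OF r] by simp
qed

end

text \<open>An object is itself a product of it with its support, so the counit may be chosen to be the identity
  on unary contexts.\<close>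

lemma unit_product:
  assumes C: "category R" and r: "r \<in> Obj R" and u: "subterminal R (Supp r)" "e \<in> hom R r (Supp r)"
  shows "is_product R ({1..len (unit_ctx r)} <+> sorts (unit_ctx r)) (case_sum (tau (unit_ctx r)) Supp) r
    (case_sum (\<lambda>_. Ident R r) (\<lambda>_. e))"
  unfolding is_product_def
proof (intro conjI ballI allI impI r)
  let ?I = "{1..len (unit_ctx r)} <+> sorts (unit_ctx r)"
  have I: "?I = {Inl 1, Inr r}" by (auto simp: unit_ctx_def Plus_def)
  show "case_sum (\<lambda>_. Ident R r) (\<lambda>_. e) i \<in> hom R r (case_sum (tau (unit_ctx r)) Supp i)"
    if "i \<in> ?I" for i
    using that ident_hom[OF C r] u(2) unfolding I by (auto simp: unit_ctx_simps)
  fix X q assume "\<forall>i\<in>?I. q i \<in> hom R X (case_sum (tau (unit_ctx r)) Supp i)"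
  then have q: "q (Inl 1) \<in> hom R X r" "q (Inr r) \<in> hom R X (Supp r)"
    unfolding I by (auto simp: unit_ctx_simps)
  show "\<exists>!h. h \<in> hom R X r \<and> (\<forall>i\<in>?I. Comp R (case_sum (\<lambda>_. Ident R r) (\<lambda>_. e) i) h = q i)"
    unfolding I
  proof (rule ex1I[of _ "q (Inl 1)"])
    show "q (Inl 1) \<in> hom R X r \<and>
      (\<forall>i\<in>{Inl 1, Inr r}. Comp R (case_sum (\<lambda>_. Ident R r) (\<lambda>_. e) i) (q (Inl 1)) = q i)"
      using q comp_ident(2)[OF C q(1)] subterminalD[OF u(1) comp_hom[OF C q(1) u(2)] q(2)] by simp
    fix h assume "h \<in> hom R X r \<and> (\<forall>i\<in>{Inl 1, Inr r}. Comp R (case_sum (\<lambda>_. Ident R r) (\<lambda>_. e) i) h = q i)"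
    then show "h = q (Inl 1)" using comp_ident(2)[OF C] by auto
  qed
qed

text \<open>Products are chosen freely except at unary contexts, where \<open>r\<close> itself is
  taken; extensions then have the prescribed values on the nose.\<close>

lemma counit_exists:
  fixes R :: "('o, 'a) precategory"
  assumes R: "regular_category R"
  obtains Supp p E where "is_counit R Supp p E" "\<And>r. r \<in> Obj R \<Longrightarrow> ObjMap E (unit_ctx r) = r"
proof -
  have C: "category R" "has_finite_limits R" using R unfolding regular_category_def by auto
  obtain Supp where Supp: "\<And>s. s \<in> Obj R \<Longrightarrow> is_support R s (Supp s)"
  proof -
    have "\<forall>s. \<exists>u. s \<in> Obj R \<longrightarrow> is_support R s u" using support_exists[OF R] by blast
    then show ?thesis using that by metis
  qed
  have So: "Supp s \<in> Obj R" if "s \<in> Obj R" for s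
    using supportD[OF C(1) Supp[OF that]] unfolding subterminal_def by metis
  let ?prod = "\<lambda>\<Gamma> P p. is_product R ({1..len \<Gamma>} <+> sorts \<Gamma>) (case_sum (tau \<Gamma>) Supp) P p"
  have "\<exists>P p. ?prod \<Gamma> P p \<and> (\<forall>r\<in>Obj R. \<Gamma> = unit_ctx r \<longrightarrow> P = r)" if \<Gamma>: "\<Gamma> \<in> FRg_obj (Obj R)" for \<Gamma>
  proof (cases "\<exists>r\<in>Obj R. \<Gamma> = unit_ctx r")
    case True
    then obtain r where r: "r \<in> Obj R" "\<Gamma> = unit_ctx r" by blast
    obtain e where "subterminal R (Supp r)" "e \<in> hom R r (Supp r)"
      using supportD[OF C(1) Supp[OF r(1)]] .
    then have "?prod \<Gamma> r (case_sum (\<lambda>_. Ident R r) (\<lambda>_. e))"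
      using unit_product[OF C(1) r(1)] r(2) by blast
    \<comment> \<open>The special choice is consistent because a unary context determines its
      sort.\<close>
    moreover have "r' = r" if "\<Gamma> = unit_ctx r'" for r' using that r(2) by (simp add: unit_ctx_def)
    ultimately show ?thesis by blast
  next
    case False
    have "case_sum (tau \<Gamma>) Supp i \<in> Obj R" if "i \<in> {1..len \<Gamma>} <+> sorts \<Gamma>" for i
      using that \<Gamma> So unfolding FRg_obj_iff by auto
    moreover have "finite ({1..len \<Gamma>} <+> sorts \<Gamma>)" using \<Gamma> unfolding FRg_obj_iff by simp
    ultimately show ?thesis using finite_product_exists[OF C] False by metis
  qed
  then obtain P p where P: "\<And>\<Gamma>. \<Gamma> \<in> FRg_obj (Obj R) \<Longrightarrow> ?prod \<Gamma> (P \<Gamma>) (p \<Gamma>)"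
    and Pr: "\<And>\<Gamma> r. \<Gamma> \<in> FRg_obj (Obj R) \<Longrightarrow> r \<in> Obj R \<Longrightarrow> \<Gamma> = unit_ctx r \<Longrightarrow> P \<Gamma> = r"
    by metis
  \<comment> \<open>Arrows are chosen one at a time; functoriality follows afterwards from the
    uniqueness of induced maps.\<close>
  define ok where "ok = (\<lambda>u h. let \<Gamma> = fst u; \<Gamma>' = snd (snd u) in h \<in> hom R (P \<Gamma>) (P \<Gamma>') \<and>
    (\<forall>i\<in>{1..len \<Gamma>'}. Comp R (p \<Gamma>' (Inl i)) h = p \<Gamma> (Inl (fn u i))) \<and>
    (\<forall>s\<in>sorts \<Gamma>'. Comp R (p \<Gamma>' (Inr s)) h = p \<Gamma> (Inr s)))"
  have ok: "\<exists>h. ok u h" if u: "u \<in> Arr (FRg (Obj R))" for u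
  proof -
    define \<Gamma> \<Gamma>' where "\<Gamma> = fst u" and "\<Gamma>' = snd (snd u)"
    have uh: "u \<in> hom (FRg (Obj R)) \<Gamma> \<Gamma>'" using arr_hom[OF u] by (simp add: FRg_simps \<Gamma>_def \<Gamma>'_def)
    note o = FRg_homD(1,2)[OF uh]
    let ?q = "case_sum (\<lambda>i. p \<Gamma> (Inl (fn u i))) (\<lambda>s. p \<Gamma> (Inr s))"
    have pr: "\<forall>i\<in>{1..len \<Gamma>} <+> sorts \<Gamma>. p \<Gamma> i \<in> hom R (P \<Gamma>) (case_sum (tau \<Gamma>) Supp i)"
      using P[OF o(1)] unfolding is_product_def by blast
    have q: "?q i \<in> hom R (P \<Gamma>) (case_sum (tau \<Gamma>') Supp i)" if i: "i \<in> {1..len \<Gamma>'} <+> sorts \<Gamma>'" for i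
    proof (cases i)
      case (Inl x)
      then have x: "x \<in> {1..len \<Gamma>'}" using i by auto
      show ?thesis using bspec[OF pr InlI[OF FRg_homD(4)[OF uh x]]] FRg_homD(5)[OF uh x] Inl by simp
    next
      case (Inr s)
      then have "s \<in> sorts \<Gamma>" using i FRg_homD(3)[OF uh] by auto
      then show ?thesis using bspec[OF pr InrI] Inr by simp
    qed
    have "P \<Gamma> \<in> Obj R" using P[OF o(1)] unfolding is_product_def by blast
    from product_induced[OF C(1) P[OF o(2)] this q]
    obtain h where h: "h \<in> hom R (P \<Gamma>) (P \<Gamma>')" "\<And>i. i \<in> {1..len \<Gamma>'} <+> sorts \<Gamma>' \<Longrightarrow> Comp R (p \<Gamma>' i) h = ?q i"
      by blast
    have "ok u h"
      unfolding ok_def Let_def \<Gamma>_def[symmetric] \<Gamma>'_def[symmetric]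
      using h(1) h(2)[OF InlI] h(2)[OF InrI] by simp
    then show ?thesis by blast
  qed
  define E where "E = \<lparr>ObjMap = P, ArrMap = (\<lambda>u. SOME h. ok u h)\<rparr>"
  have E: "ok u (ArrMap E u)" if "u \<in> Arr (FRg (Obj R))" for u
    using someI_ex[OF ok[OF that]] by (simp add: E_def)
  have "is_counit R Supp p E"
    unfolding is_counit_def
  proof (intro conjI ballI)
    fix \<Gamma> assume "\<Gamma> \<in> Obj (FRg (Obj R))"
    then show "case \<Gamma> of (n, S, t) \<Rightarrow>
      is_product R ({1..n} <+> S) (case_sum t Supp) (ObjMap E (n, S, t)) (p (n, S, t))"
      using P[of \<Gamma>] by (cases \<Gamma>) (simp add: E_def FRg_simps)
  next
    fix u assume u: "u \<in> Arr (FRg (Obj R))"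
    obtain n S t f n' S' t' where ueq: "u = ((n, S, t), f, (n', S', t'))" by (metis prod_cases3)
    show "case u of (x, xa) \<Rightarrow> (case x of (n, S, t) \<Rightarrow> \<lambda>(f, n', S', t').
        let \<Gamma> = (n, S, t); \<Gamma>' = (n', S', t'); h = ArrMap E (\<Gamma>, f, \<Gamma>') in
          h \<in> hom R (ObjMap E \<Gamma>) (ObjMap E \<Gamma>') \<and>
          (\<forall>i\<in>{1..n'}. Comp R (p \<Gamma>' (Inl i)) h = p \<Gamma> (Inl (f i))) \<and>
          (\<forall>s\<in>S'. Comp R (p \<Gamma>' (Inr s)) h = p \<Gamma> (Inr s))) xa"
      using E[OF u] unfolding ueq ok_def by (simp add: Let_def E_def)
  qed (rule Supp)
  moreover have "ObjMap E (unit_ctx r) = r" if "r \<in> Obj R" for r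
    using Pr[OF unit_ctx_obj[OF that] that] by (simp add: E_def)
  ultimately show thesis using that by blast
qed

section \<open>Uniqueness of the extension\<close>

text \<open>The support of \<open>unit_ctx s\<close> among contexts: the variable is forgotten, its
  sort is kept.\<close>

definition supp_ctx :: "'t \<Rightarrow> 't ctx" where
  "supp_ctx s = (0, {s}, \<lambda>_. undefined)"

definition proj_unit :: "'t ctx \<Rightarrow> nat \<Rightarrow> 't ctx_arr" where
  "proj_unit \<Gamma> i = (\<Gamma>, \<lambda>x\<in>{1..1}. i, unit_ctx (tau \<Gamma> i))"

definition proj_supp :: "'t ctx \<Rightarrow> 't \<Rightarrow> 't ctx_arr" where
  "proj_supp \<Gamma> s = (\<Gamma>, \<lambda>_. undefined, supp_ctx s)"

lemma supp_ctx_obj: "s \<in> T \<Longrightarrow> supp_ctx s \<in> FRg_obj T"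
  by (auto simp: FRg_obj_iff supp_ctx_def)

lemma FRg_tau:
  assumes "\<Gamma> \<in> FRg_obj T" "i \<in> {1..len \<Gamma>}"
  shows "tau \<Gamma> i \<in> sorts \<Gamma>" "tau \<Gamma> i \<in> T"
  using assms unfolding FRg_obj_iff by auto

lemma proj_unit_hom:
  assumes "\<Gamma> \<in> FRg_obj T" "i \<in> {1..len \<Gamma>}"
  shows "proj_unit \<Gamma> i \<in> hom (FRg T) \<Gamma> (unit_ctx (tau \<Gamma> i))"
  using FRg_tau[OF assms] assms
    FRg_homI[OF assms(1) unit_ctx_obj[OF FRg_tau(2)[OF assms]], of "\<lambda>_. i"]
  by (auto simp: proj_unit_def unit_ctx_def)

lemma proj_supp_hom:
  assumes "\<Gamma> \<in> FRg_obj T" "s \<in> sorts \<Gamma>"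
  shows "proj_supp \<Gamma> s \<in> hom (FRg T) \<Gamma> (supp_ctx s)"
proof -
  have "s \<in> T" using assms unfolding FRg_obj_iff by auto
  from FRg_homI[OF assms(1) supp_ctx_obj[OF this], of "\<lambda>_. undefined"] show ?thesis
    using assms(2) by (auto simp: proj_supp_def supp_ctx_def restrict_def)
qed

lemma proj_unit_comp:
  assumes f: "f \<in> hom (FRg T) \<Gamma> \<Delta>" and i: "i \<in> {1..len \<Delta>}"
  shows "Comp (FRg T) (proj_unit \<Delta> i) f = proj_unit \<Gamma> (fn f i)"
proof (rule FRg_hom_eqI)
  note p = proj_unit_hom[OF FRg_homD(2)[OF f] i]
  show "Comp (FRg T) (proj_unit \<Delta> i) f \<in> hom (FRg T) \<Gamma> (unit_ctx (tau \<Delta> i))"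
    using FRg_comp_hom[OF f p] .
  show "proj_unit \<Gamma> (fn f i) \<in> hom (FRg T) \<Gamma> (unit_ctx (tau \<Delta> i))"
    using proj_unit_hom[OF FRg_homD(1)[OF f] FRg_homD(4)[OF f i]] FRg_homD(5)[OF f i] by simp
  fix x assume x: "x \<in> {1..len (unit_ctx (tau \<Delta> i))}"
  show "fn (Comp (FRg T) (proj_unit \<Delta> i) f) x = fn (proj_unit \<Gamma> (fn f i)) x"
    unfolding FRg_comp_fn[OF p x] using x by (simp add: proj_unit_def unit_ctx_def)
qed

lemma proj_unit_ident: "proj_unit (unit_ctx t) 1 = Ident (FRg T) (unit_ctx t)"
  by (auto simp: proj_unit_def FRg_simps unit_ctx_def)

text \<open>The projections to unary contexts record where each variable is sent. The projections to
  supports carry no data, but they demand that the source has every sort of \<Gamma>.\<close>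

lemma FRg_product:
  assumes \<Gamma>: "\<Gamma> \<in> FRg_obj T"
  shows "is_product (FRg T) ({1..len \<Gamma>} <+> sorts \<Gamma>) (case_sum (\<lambda>i. unit_ctx (tau \<Gamma> i)) supp_ctx) \<Gamma>
    (case_sum (proj_unit \<Gamma>) (proj_supp \<Gamma>))"
  unfolding is_product_def
proof (intro conjI ballI allI impI)
  let ?I = "{1..len \<Gamma>} <+> sorts \<Gamma>" and ?A = "case_sum (\<lambda>i. unit_ctx (tau \<Gamma> i)) supp_ctx"
  let ?p = "case_sum (proj_unit \<Gamma>) (proj_supp \<Gamma>)"
  show "\<Gamma> \<in> Obj (FRg T)" using \<Gamma> by (simp add: FRg_simps)
  show p: "?p i \<in> hom (FRg T) \<Gamma> (?A i)" if "i \<in> ?I" for i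
    using that proj_unit_hom[OF \<Gamma>] proj_supp_hom[OF \<Gamma>] by auto
  fix X q assume X: "X \<in> Obj (FRg T)" and q: "\<forall>i\<in>?I. q i \<in> hom (FRg T) X (?A i)"
  have X: "X \<in> FRg_obj T" using X by (simp add: FRg_simps)
  have ql: "q (Inl i) \<in> hom (FRg T) X (unit_ctx (tau \<Gamma> i))" if "i \<in> {1..len \<Gamma>}" for i
    using bspec[OF q InlI[OF that]] by simp
  have qr: "q (Inr s) \<in> hom (FRg T) X (supp_ctx s)" if "s \<in> sorts \<Gamma>" for s
    using bspec[OF q InrI[OF that]] by simp
  have one: "1 \<in> {1..len (unit_ctx t)}" for t by (simp add: unit_ctx_def)
  define f where "f = (\<lambda>i. fn (q (Inl i)) 1)"
  let ?h = "(X, \<lambda>i\<in>{1..len \<Gamma>}. f i, \<Gamma>)"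
  have h: "?h \<in> hom (FRg T) X \<Gamma>"
  proof (rule FRg_homI[OF X \<Gamma>])
    show "sorts \<Gamma> \<subseteq> sorts X" using FRg_homD(3)[OF qr] by (auto simp: supp_ctx_def)
    fix i assume i: "i \<in> {1..len \<Gamma>}"
    show "f i \<in> {1..len X} \<and> tau X (f i) = tau \<Gamma> i"
      using FRg_homD(4,5)[OF ql[OF i] one] by (simp add: f_def unit_ctx_simps)
  qed
  have eq: "Comp (FRg T) (proj_unit \<Gamma> i) k = q (Inl i) \<longleftrightarrow> fn k i = f i"
    if k: "k \<in> hom (FRg T) X \<Gamma>" and i: "i \<in> {1..len \<Gamma>}" for k i
  proof -
    have c: "fn (proj_unit X (fn k i)) 1 = fn k i" by (simp add: proj_unit_def)
    have "proj_unit X (fn k i) = q (Inl i) \<longleftrightarrow> fn k i = f i"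
    proof
      assume "fn k i = f i"
      then show "proj_unit X (fn k i) = q (Inl i)"
        using FRg_comp_hom[OF k proj_unit_hom[OF \<Gamma> i]] c unfolding proj_unit_comp[OF k i]
        by (intro FRg_hom_eqI[OF _ ql[OF i]]) (auto simp: f_def unit_ctx_def)
    qed (use c in \<open>auto simp: f_def\<close>)
    then show ?thesis unfolding proj_unit_comp[OF k i] .
  qed
  have eq': "Comp (FRg T) (proj_supp \<Gamma> s) k = q (Inr s)"
    if k: "k \<in> hom (FRg T) X \<Gamma>" and s: "s \<in> sorts \<Gamma>" for k s
    by (rule FRg_hom_eqI[OF FRg_comp_hom[OF k proj_supp_hom[OF \<Gamma> s]] qr[OF s]]) (simp add: supp_ctx_def)
  show "\<exists>!h. h \<in> hom (FRg T) X \<Gamma> \<and> (\<forall>i\<in>?I. Comp (FRg T) (?p i) h = q i)"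
  proof (rule ex1I[of _ ?h])
    show "?h \<in> hom (FRg T) X \<Gamma> \<and> (\<forall>i\<in>?I. Comp (FRg T) (?p i) ?h = q i)"
    proof (intro conjI ballI h)
      fix i assume "i \<in> ?I"
      then show "Comp (FRg T) (?p i) ?h = q i"
      proof
        fix x assume x: "i = Inl x" "x \<in> {1..len \<Gamma>}"
        then have "fn ?h x = f x" by simp
        then show ?thesis using eq[OF h x(2)] x(1) by (simp only: sum.case)
      next
        fix s assume "i = Inr s" "s \<in> sorts \<Gamma>"
        then show ?thesis using eq'[OF h] by (simp only: sum.case)
      qed
    qed
    fix k assume k: "k \<in> hom (FRg T) X \<Gamma> \<and> (\<forall>i\<in>?I. Comp (FRg T) (?p i) k = q i)"
    show "k = ?h"
    proof (rule FRg_hom_eqI[OF _ h])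
      show kh: "k \<in> hom (FRg T) X \<Gamma>" using k by simp
      fix i assume i: "i \<in> {1..len \<Gamma>}"
      have "Comp (FRg T) (proj_unit \<Gamma> i) k = q (Inl i)" using conjunct2[OF k] InlI[OF i] by fastforce
      then show "fn k i = fn ?h i" using eq[OF kh i] i by simp
    qed
  qed
qed

text \<open>Subterminality expressed as a finite limit: the object is its own square, with
  identities as projections. In this form a functor preserving finite limits carries it
  over.\<close>

lemma supp_ctx_product:
  assumes s: "s \<in> T"
  shows "is_product (FRg T) (UNIV :: bool set) (\<lambda>_. supp_ctx s) (supp_ctx s) (\<lambda>_. Ident (FRg T) (supp_ctx s))"
  unfolding is_product_def
proof (intro conjI ballI allI impI)
  note i = FRg_ident_hom[OF supp_ctx_obj[OF s]]
  show "supp_ctx s \<in> Obj (FRg T)" using supp_ctx_obj[OF s] by (simp add: FRg_simps)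
  show "Ident (FRg T) (supp_ctx s) \<in> hom (FRg T) (supp_ctx s) (supp_ctx s)" by (rule i)
  fix X and q :: "bool \<Rightarrow> _" assume q: "\<forall>j\<in>UNIV. q j \<in> hom (FRg T) X (supp_ctx s)"
  have u: "a = b" if "a \<in> hom (FRg T) X (supp_ctx s)" "b \<in> hom (FRg T) X (supp_ctx s)" for a b
    by (rule FRg_hom_eqI[OF that]) (simp add: supp_ctx_def)
  show "\<exists>!h. h \<in> hom (FRg T) X (supp_ctx s) \<and> (\<forall>j\<in>UNIV. Comp (FRg T) (Ident (FRg T) (supp_ctx s)) h = q j)"
  proof (rule ex1I[of _ "q True"])
    show "q True \<in> hom (FRg T) X (supp_ctx s) \<and>
      (\<forall>j\<in>UNIV. Comp (FRg T) (Ident (FRg T) (supp_ctx s)) (q True) = q j)"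
      using q u FRg_comp_hom[OF _ i] by (intro conjI ballI) blast+
  qed (use q u in blast)
qed

text \<open>In the preserved square both projections are identities, so the map induced by
  \<open>a\<close> and \<open>b\<close> equals each of them. The cover is regular epi because a
  context without variables satisfies the injectivity criterion vacuously.\<close>

lemma regular_functor_supp:
  assumes F: "regular_functor (FRg T) R F" and s: "s \<in> T"
  shows "subterminal R (ObjMap F (supp_ctx s))"
    and "is_regular_epi R (ArrMap F (proj_supp (unit_ctx s) s))"
    and "ArrMap F (proj_supp (unit_ctx s) s) \<in> hom R (ObjMap F (unit_ctx s)) (ObjMap F (supp_ctx s))"
proof -
  have fctr: "is_functor (FRg T) R F" and lim: "preserves_finite_limits (FRg T) R F" and R: "category R"
    using F unfolding regular_functor_def regular_category_def by auto
  have o: "supp_ctx s \<in> Obj (FRg T)" using supp_ctx_obj[OF s] by (simp add: FRg_simps)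
  have "is_product R (UNIV :: bool set) (ObjMap F \<circ> (\<lambda>_. supp_ctx s)) (ObjMap F (supp_ctx s))
      (ArrMap F \<circ> (\<lambda>_. Ident (FRg T) (supp_ctx s)))"
    by (rule preserves_finite_products[OF fctr lim _ _ supp_ctx_product[OF s]]) (use o in auto)
  then have P: "is_product R (UNIV :: bool set) (\<lambda>_. ObjMap F (supp_ctx s)) (ObjMap F (supp_ctx s))
      (\<lambda>_. Ident R (ObjMap F (supp_ctx s)))"
    using functor_ident[OF fctr o] by (simp add: comp_def)
  have "a = b" if ab: "a \<in> hom R w (ObjMap F (supp_ctx s))" "b \<in> hom R w (ObjMap F (supp_ctx s))" for a b w
  proof -
    have q: "(if i then a else b) \<in> hom R w (ObjMap F (supp_ctx s))" for i using ab by simp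
    obtain h where h: "h \<in> hom R w (ObjMap F (supp_ctx s))"
      "\<And>i :: bool. Comp R (Ident R (ObjMap F (supp_ctx s))) h = (if i then a else b)"
      by (rule product_induced[OF R P hom_obj(1)[OF R ab(1)], of "\<lambda>i. if i then a else b", OF q])
        (rule that, simp_all only: UNIV_I)
    show ?thesis using h(2)[of True] h(2)[of False] by simp
  qed
  moreover have "ObjMap F (supp_ctx s) \<in> Obj R" using fctr o unfolding is_functor_def by auto
  ultimately show "subterminal R (ObjMap F (supp_ctx s))" unfolding subterminal_def by blast
  have c: "proj_supp (unit_ctx s) s \<in> hom (FRg T) (unit_ctx s) (supp_ctx s)"
    using proj_supp_hom[OF unit_ctx_obj[OF s]] by (simp add: unit_ctx_def)
  then show "ArrMap F (proj_supp (unit_ctx s) s) \<in> hom R (ObjMap F (unit_ctx s)) (ObjMap F (supp_ctx s))"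
    using functor_hom[OF fctr] by blast
  have "is_regular_epi (FRg T) (proj_supp (unit_ctx s) s)"
    unfolding FRg_regular_epi_iff[OF c] by (simp add: supp_ctx_def unit_ctx_def)
  then show "is_regular_epi R (ArrMap F (proj_supp (unit_ctx s) s))"
    using F unfolding regular_functor_def by blast
qed

lemma regular_functor_product:
  assumes F: "regular_functor (FRg T) R F" and \<Gamma>: "\<Gamma> \<in> FRg_obj T"
  shows "is_product R ({1..len \<Gamma>} <+> sorts \<Gamma>)
    (ObjMap F \<circ> case_sum (\<lambda>i. unit_ctx (tau \<Gamma> i)) supp_ctx) (ObjMap F \<Gamma>)
    (ArrMap F \<circ> case_sum (proj_unit \<Gamma>) (proj_supp \<Gamma>))"
proof (rule preserves_finite_products[OF _ _ _ _ FRg_product[OF \<Gamma>]])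
  show "finite ({1..len \<Gamma>} <+> sorts \<Gamma>)" using \<Gamma> unfolding FRg_obj_iff by auto
  fix i assume "i \<in> {1..len \<Gamma>} <+> sorts \<Gamma>"
  then show "case_sum (\<lambda>i. unit_ctx (tau \<Gamma> i)) supp_ctx i \<in> Obj (FRg T)"
  proof
    fix s assume s: "i = Inr s" "s \<in> sorts \<Gamma>"
    then have "s \<in> T" using \<Gamma> unfolding FRg_obj_iff by auto
    then show ?thesis using supp_ctx_obj s(1) by (simp add: FRg_simps)
  qed (use unit_ctx_obj[OF FRg_tau(2)[OF \<Gamma>]] in \<open>auto simp: FRg_simps\<close>)
qed (use F in \<open>auto simp: regular_functor_def\<close>)

lemma regular_functor_ext:
  assumes G: "regular_functor (FRg T) R G" and \<Gamma>: "\<Gamma> \<in> FRg_obj T"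
    and h: "h \<in> hom R X (ObjMap G \<Gamma>)" "h' \<in> hom R X (ObjMap G \<Gamma>)"
    and eq: "\<And>i. i \<in> {1..len \<Gamma>} \<Longrightarrow>
      Comp R (ArrMap G (proj_unit \<Gamma> i)) h = Comp R (ArrMap G (proj_unit \<Gamma> i)) h'"
  shows "h = h'"
proof -
  have fctr: "is_functor (FRg T) R G" and R: "category R"
    using G unfolding regular_functor_def regular_category_def by auto
  show ?thesis
  proof (rule product_joint_mono[OF R regular_functor_product[OF G \<Gamma>] h])
    fix i assume "i \<in> {1..len \<Gamma>} <+> sorts \<Gamma>"
    then show "Comp R ((ArrMap G \<circ> case_sum (proj_unit \<Gamma>) (proj_supp \<Gamma>)) i) h =
      Comp R ((ArrMap G \<circ> case_sum (proj_unit \<Gamma>) (proj_supp \<Gamma>)) i) h'"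
    proof
      fix s assume s: "i = Inr s" "s \<in> sorts \<Gamma>"
      have sT: "s \<in> T" using s(2) \<Gamma> unfolding FRg_obj_iff by auto
      note g = functor_hom[OF fctr proj_supp_hom[OF \<Gamma> s(2)]]
      show ?thesis
        using subterminalD[OF regular_functor_supp(1)[OF G sT] comp_hom[OF R h(1) g] comp_hom[OF R h(2) g]] s(1)
        by simp
    qed (use eq in auto)
  qed
qed

text \<open>The components at variables are prescribed by \<alpha>. Those at supports arise by
  descending \<alpha> along the cover of a support, whose target is subterminal. Stated for families
  of arrows so that it applies to \<alpha> and to its inverses.\<close>

lemma component_exists:
  assumes F: "regular_functor (FRg T) R F" and G: "regular_functor (FRg T) R G" and \<Gamma>: "\<Gamma> \<in> FRg_obj T"
    and \<alpha>: "\<And>t. t \<in> T \<Longrightarrow> \<alpha> t \<in> hom R (ObjMap F (unit_ctx t)) (ObjMap G (unit_ctx t))"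
  obtains b where "b \<in> hom R (ObjMap F \<Gamma>) (ObjMap G \<Gamma>)"
    "\<And>i. i \<in> {1..len \<Gamma>} \<Longrightarrow>
      Comp R (ArrMap G (proj_unit \<Gamma> i)) b = Comp R (\<alpha> (tau \<Gamma> i)) (ArrMap F (proj_unit \<Gamma> i))"
proof -
  have fF: "is_functor (FRg T) R F" and fG: "is_functor (FRg T) R G" and R: "category R"
    using F G unfolding regular_functor_def regular_category_def by auto
  have "\<exists>l. l \<in> hom R (ObjMap F (supp_ctx s)) (ObjMap G (supp_ctx s))" if s: "s \<in> T" for s
    using regular_epi_lift_subterminal[OF R regular_functor_supp(2,3)[OF F s] regular_functor_supp(1)[OF G s]
      comp_hom[OF R \<alpha>[OF s] regular_functor_supp(3)[OF G s]]] by blast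
  then obtain l where l: "\<And>s. s \<in> T \<Longrightarrow> l s \<in> hom R (ObjMap F (supp_ctx s)) (ObjMap G (supp_ctx s))"
    by metis
  let ?I = "{1..len \<Gamma>} <+> sorts \<Gamma>"
  define q where "q = case_sum (\<lambda>i. Comp R (\<alpha> (tau \<Gamma> i)) (ArrMap F (proj_unit \<Gamma> i)))
    (\<lambda>s. Comp R (l s) (ArrMap F (proj_supp \<Gamma> s)))"
  have q: "q i \<in> hom R (ObjMap F \<Gamma>) ((ObjMap G \<circ> case_sum (\<lambda>i. unit_ctx (tau \<Gamma> i)) supp_ctx) i)"
    if "i \<in> ?I" for i
    using that
  proof
    fix x assume x: "i = Inl x" "x \<in> {1..len \<Gamma>}"
    show ?thesis
      using comp_hom[OF R functor_hom[OF fF proj_unit_hom[OF \<Gamma> x(2)]] \<alpha>[OF FRg_tau(2)[OF \<Gamma> x(2)]]] x(1)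
      by (simp add: q_def)
  next
    fix s assume s: "i = Inr s" "s \<in> sorts \<Gamma>"
    have sT: "s \<in> T" using s(2) \<Gamma> unfolding FRg_obj_iff by auto
    show ?thesis
      using comp_hom[OF R functor_hom[OF fF proj_supp_hom[OF \<Gamma> s(2)]] l[OF sT]] s(1) by (simp add: q_def)
  qed
  have "ObjMap F \<Gamma> \<in> Obj R" using fF \<Gamma> unfolding is_functor_def by (auto simp: FRg_simps)
  from product_induced[OF R regular_functor_product[OF G \<Gamma>] this q]
  obtain b where b: "b \<in> hom R (ObjMap F \<Gamma>) (ObjMap G \<Gamma>)"
    "\<And>i. i \<in> ?I \<Longrightarrow> Comp R ((ArrMap G \<circ> case_sum (proj_unit \<Gamma>) (proj_supp \<Gamma>)) i) b = q i" by blast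
  show thesis using that[OF b(1)] b(2)[OF InlI] by (simp add: q_def)
qed

text \<open>One of the two inverse laws; the other is the same lemma with \<open>F\<close> and
  \<open>G\<close> exchanged.\<close>

lemma component_inverse:
  assumes F: "regular_functor (FRg T) R F" and \<Gamma>: "\<Gamma> \<in> FRg_obj T" and fG: "is_functor (FRg T) R G"
    and b: "b \<in> hom R (ObjMap F \<Gamma>) (ObjMap G \<Gamma>)" "b' \<in> hom R (ObjMap G \<Gamma>) (ObjMap F \<Gamma>)"
    and \<alpha>: "\<And>t. t \<in> T \<Longrightarrow> \<alpha> t \<in> hom R (ObjMap F (unit_ctx t)) (ObjMap G (unit_ctx t))"
    and \<alpha>': "\<And>t. t \<in> T \<Longrightarrow> \<alpha>' t \<in> hom R (ObjMap G (unit_ctx t)) (ObjMap F (unit_ctx t))"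
    and inv: "\<And>t. t \<in> T \<Longrightarrow> Comp R (\<alpha>' t) (\<alpha> t) = Ident R (ObjMap F (unit_ctx t))"
    and eq: "\<And>i. i \<in> {1..len \<Gamma>} \<Longrightarrow>
      Comp R (ArrMap G (proj_unit \<Gamma> i)) b = Comp R (\<alpha> (tau \<Gamma> i)) (ArrMap F (proj_unit \<Gamma> i))"
    and eq': "\<And>i. i \<in> {1..len \<Gamma>} \<Longrightarrow>
      Comp R (ArrMap F (proj_unit \<Gamma> i)) b' = Comp R (\<alpha>' (tau \<Gamma> i)) (ArrMap G (proj_unit \<Gamma> i))"
  shows "Comp R b' b = Ident R (ObjMap F \<Gamma>)"
proof -
  have fF: "is_functor (FRg T) R F" and R: "category R"
    using F unfolding regular_functor_def regular_category_def by auto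
  have "ObjMap F \<Gamma> \<in> Obj R" using hom_obj[OF R b(1)] by simp
  note i = ident_hom[OF R this]
  show ?thesis
  proof (rule regular_functor_ext[OF F \<Gamma> comp_hom[OF R b] i])
    fix x assume x: "x \<in> {1..len \<Gamma>}"
    have t: "tau \<Gamma> x \<in> T" using FRg_tau(2)[OF \<Gamma> x] .
    note p = functor_hom[OF fF proj_unit_hom[OF \<Gamma> x]]
    note q = functor_hom[OF fG proj_unit_hom[OF \<Gamma> x]]
    show "Comp R (ArrMap F (proj_unit \<Gamma> x)) (Comp R b' b) =
      Comp R (ArrMap F (proj_unit \<Gamma> x)) (Ident R (ObjMap F \<Gamma>))"
      using comp_assoc[OF R b p] eq'[OF x] comp_assoc[OF R b(1) q \<alpha>'[OF t]] eq[OF x]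
        comp_assoc[OF R p \<alpha>[OF t] \<alpha>'[OF t]] inv[OF t] comp_ident[OF R p] by simp
  qed
qed

text \<open>Naturality at the arrows \<open>proj_unit \<Gamma> i\<close> prescribes the component at
  \<Gamma> on all variables, hence determines it. Naturality at a general \<open>f\<close> is tested
  on variables too, where \<open>f\<close> turns the projection at \<open>i\<close> into the
  projection at \<open>fn f i\<close>.\<close>

lemma regular_functor_iso_extension:
  assumes F: "regular_functor (FRg T) R F" and G: "regular_functor (FRg T) R G"
    and \<alpha>: "\<And>t. t \<in> T \<Longrightarrow> \<alpha> t \<in> isos R (ObjMap F (unit_ctx t)) (ObjMap G (unit_ctx t))"
  shows "\<exists>!\<beta>. \<beta> \<in> nat_isos (FRg T) R F G \<and> (\<forall>t\<in>T. \<beta> (unit_ctx t) = \<alpha> t)"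
proof -
  have fF: "is_functor (FRg T) R F" and fG: "is_functor (FRg T) R G" and R: "category R"
    using F G unfolding regular_functor_def regular_category_def by auto
  have \<alpha>h: "\<alpha> t \<in> hom R (ObjMap F (unit_ctx t)) (ObjMap G (unit_ctx t))" if "t \<in> T" for t
    using \<alpha>[OF that] unfolding isos_def by simp
  have "\<forall>t. \<exists>a. t \<in> T \<longrightarrow> a \<in> hom R (ObjMap G (unit_ctx t)) (ObjMap F (unit_ctx t)) \<and>
      Comp R a (\<alpha> t) = Ident R (ObjMap F (unit_ctx t)) \<and> Comp R (\<alpha> t) a = Ident R (ObjMap G (unit_ctx t))"
    using \<alpha> unfolding isos_def by blast
  then obtain \<alpha>' where \<alpha>': "\<And>t. t \<in> T \<Longrightarrow> \<alpha>' t \<in> hom R (ObjMap G (unit_ctx t)) (ObjMap F (unit_ctx t))"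
    "\<And>t. t \<in> T \<Longrightarrow> Comp R (\<alpha>' t) (\<alpha> t) = Ident R (ObjMap F (unit_ctx t))"
    "\<And>t. t \<in> T \<Longrightarrow> Comp R (\<alpha> t) (\<alpha>' t) = Ident R (ObjMap G (unit_ctx t))"
    by metis
  let ?ok = "\<lambda>\<Gamma> b. b \<in> hom R (ObjMap F \<Gamma>) (ObjMap G \<Gamma>) \<and> (\<forall>i\<in>{1..len \<Gamma>}.
      Comp R (ArrMap G (proj_unit \<Gamma> i)) b = Comp R (\<alpha> (tau \<Gamma> i)) (ArrMap F (proj_unit \<Gamma> i)))"
  have "\<forall>\<Gamma>. \<exists>b. \<Gamma> \<in> FRg_obj T \<longrightarrow> ?ok \<Gamma> b"
    using component_exists[OF F G _ \<alpha>h] by (metis (no_types, lifting))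
  then obtain B where B: "\<And>\<Gamma>. \<Gamma> \<in> FRg_obj T \<Longrightarrow> ?ok \<Gamma> (B \<Gamma>)" by metis
  have uniq: "b = B \<Gamma>" if "\<Gamma> \<in> FRg_obj T" "?ok \<Gamma> b" for b \<Gamma>
    by (rule regular_functor_ext[OF G that(1)]) (use B[OF that(1)] that(2) in auto)
  define \<beta> where "\<beta> = restrict B (FRg_obj T)"
  have iso: "B \<Gamma> \<in> isos R (ObjMap F \<Gamma>) (ObjMap G \<Gamma>)" if \<Gamma>: "\<Gamma> \<in> FRg_obj T" for \<Gamma>
  proof -
    obtain b' where b': "b' \<in> hom R (ObjMap G \<Gamma>) (ObjMap F \<Gamma>)"
      "\<And>i. i \<in> {1..len \<Gamma>} \<Longrightarrow>
        Comp R (ArrMap F (proj_unit \<Gamma> i)) b' = Comp R (\<alpha>' (tau \<Gamma> i)) (ArrMap G (proj_unit \<Gamma> i))"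
      using component_exists[OF G F \<Gamma> \<alpha>'(1)] by blast
    have b: "B \<Gamma> \<in> hom R (ObjMap F \<Gamma>) (ObjMap G \<Gamma>)" "\<And>i. i \<in> {1..len \<Gamma>} \<Longrightarrow>
        Comp R (ArrMap G (proj_unit \<Gamma> i)) (B \<Gamma>) = Comp R (\<alpha> (tau \<Gamma> i)) (ArrMap F (proj_unit \<Gamma> i))"
      using B[OF \<Gamma>] by auto
    show ?thesis
      using isosI[OF b(1) b'(1)] component_inverse[OF F \<Gamma> fG b(1) b'(1) \<alpha>h \<alpha>'(1,2) b(2) b'(2)]
        component_inverse[OF G \<Gamma> fF b'(1) b(1) \<alpha>'(1) \<alpha>h \<alpha>'(3) b'(2) b(2)] by blast
  qed
  have nat: "Comp R (B (Cod (FRg T) f)) (ArrMap F f) = Comp R (ArrMap G f) (B (Dom (FRg T) f))"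
    if "f \<in> Arr (FRg T)" for f
  proof -
    define \<Gamma> \<Delta> where "\<Gamma> = Dom (FRg T) f" and "\<Delta> = Cod (FRg T) f"
    have f: "f \<in> hom (FRg T) \<Gamma> \<Delta>" using arr_hom[OF that] unfolding \<Gamma>_def \<Delta>_def .
    note o = FRg_homD(1,2)[OF f]
    have B': "B \<Gamma> \<in> hom R (ObjMap F \<Gamma>) (ObjMap G \<Gamma>)" "B \<Delta> \<in> hom R (ObjMap F \<Delta>) (ObjMap G \<Delta>)"
      using B o by auto
    note Ff = functor_hom[OF fF f] and Gf = functor_hom[OF fG f]
    have "Comp R (B \<Delta>) (ArrMap F f) = Comp R (ArrMap G f) (B \<Gamma>)"
    proof (rule regular_functor_ext[OF G o(2) comp_hom[OF R Ff B'(2)] comp_hom[OF R B'(1) Gf]])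
      fix i assume i: "i \<in> {1..len \<Delta>}"
      have i': "fn f i \<in> {1..len \<Gamma>}" "tau \<Gamma> (fn f i) = tau \<Delta> i" using FRg_homD(4,5)[OF f i] .
      have t: "tau \<Delta> i \<in> T" using FRg_tau(2)[OF o(2) i] .
      note p = proj_unit_hom[OF o(2) i]
      have "Comp R (ArrMap G (proj_unit \<Delta> i)) (Comp R (B \<Delta>) (ArrMap F f)) =
        Comp R (\<alpha> (tau \<Delta> i)) (Comp R (ArrMap F (proj_unit \<Delta> i)) (ArrMap F f))"
        using comp_assoc[OF R Ff B'(2) functor_hom[OF fG p]] B[OF o(2)] i
          comp_assoc[OF R Ff functor_hom[OF fF p] \<alpha>h[OF t]] by simp
      also have "\<dots> = Comp R (\<alpha> (tau \<Delta> i)) (ArrMap F (proj_unit \<Gamma> (fn f i)))"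
        using functor_comp[OF fF f p] proj_unit_comp[OF f i] by simp
      also have "\<dots> = Comp R (ArrMap G (proj_unit \<Gamma> (fn f i))) (B \<Gamma>)"
        using B[OF o(1)] i' by simp
      also have "\<dots> = Comp R (ArrMap G (proj_unit \<Delta> i)) (Comp R (ArrMap G f) (B \<Gamma>))"
        using functor_comp[OF fG f p] proj_unit_comp[OF f i] comp_assoc[OF R B'(1) Gf functor_hom[OF fG p]]
        by simp
      finally show "Comp R (ArrMap G (proj_unit \<Delta> i)) (Comp R (B \<Delta>) (ArrMap F f)) =
        Comp R (ArrMap G (proj_unit \<Delta> i)) (Comp R (ArrMap G f) (B \<Gamma>))" .
    qed
    then show ?thesis unfolding \<Gamma>_def \<Delta>_def .
  qed
  have DC: "Dom (FRg T) f \<in> FRg_obj T" "Cod (FRg T) f \<in> FRg_obj T" if "f \<in> Arr (FRg T)" for f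
    using FRg_homD(1,2)[OF arr_hom[OF that]] .
  have "\<beta> \<in> nat_isos (FRg T) R F G"
    unfolding nat_isos_def using iso nat DC by (auto simp: \<beta>_def FRg_simps(1))
  moreover have "\<beta> (unit_ctx t) = \<alpha> t" if t: "t \<in> T" for t
  proof -
    have U: "unit_ctx t \<in> FRg_obj T" using unit_ctx_obj[OF t] .
    have U': "unit_ctx t \<in> Obj (FRg T)" using U by (simp add: FRg_simps)
    \<comment> \<open>At a unary context the only projection is the identity, so
      \<open>\<alpha> t\<close> solves the equation that characterises the component.\<close>
    have "?ok (unit_ctx t) (\<alpha> t)"
    proof (intro conjI ballI)
      fix i assume "i \<in> {1..len (unit_ctx t)}"
      then have i: "i = 1" by (simp add: unit_ctx_simps)
      show "Comp R (ArrMap G (proj_unit (unit_ctx t) i)) (\<alpha> t) =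
        Comp R (\<alpha> (tau (unit_ctx t) i)) (ArrMap F (proj_unit (unit_ctx t) i))"
        unfolding i proj_unit_ident[of t T] functor_ident[OF fF U'] functor_ident[OF fG U']
        using comp_ident[OF R \<alpha>h[OF t]] by (simp add: unit_ctx_simps)
    qed (rule \<alpha>h[OF t])
    then show ?thesis using uniq[OF U] U by (simp add: \<beta>_def)
  qed
  moreover have "\<gamma> = \<beta>"
    if \<gamma>: "\<gamma> \<in> nat_isos (FRg T) R F G" "\<forall>t\<in>T. \<gamma> (unit_ctx t) = \<alpha> t" for \<gamma>
  proof (rule extensionalityI)
    show "\<gamma> \<in> extensional (FRg_obj T)" using \<gamma>(1) unfolding nat_isos_def by (auto simp: FRg_simps)
    show "\<beta> \<in> extensional (FRg_obj T)" by (simp add: \<beta>_def)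
    fix \<Gamma> assume \<Gamma>: "\<Gamma> \<in> FRg_obj T"
    have "\<gamma> \<Gamma> = B \<Gamma>"
    proof (rule uniq[OF \<Gamma>], intro conjI ballI)
      show "\<gamma> \<Gamma> \<in> hom R (ObjMap F \<Gamma>) (ObjMap G \<Gamma>)"
        using \<gamma>(1) \<Gamma> unfolding nat_isos_def isos_def by (auto simp: FRg_simps)
      fix i assume i: "i \<in> {1..len \<Gamma>}"
      note p = homD[OF proj_unit_hom[OF \<Gamma> i]]
      have "Comp R (\<gamma> (unit_ctx (tau \<Gamma> i))) (ArrMap F (proj_unit \<Gamma> i)) =
        Comp R (ArrMap G (proj_unit \<Gamma> i)) (\<gamma> \<Gamma>)"
        using \<gamma>(1) p unfolding nat_isos_def by auto
      then show "Comp R (ArrMap G (proj_unit \<Gamma> i)) (\<gamma> \<Gamma>) =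
        Comp R (\<alpha> (tau \<Gamma> i)) (ArrMap F (proj_unit \<Gamma> i))"
        using \<gamma>(2) FRg_tau(2)[OF \<Gamma> i] by simp
    qed
    then show "\<gamma> \<Gamma> = \<beta> \<Gamma>" using \<Gamma> by (simp add: \<beta>_def)
  qed
  ultimately show ?thesis by (intro ex1I[of _ \<beta>]) blast+
qed

section \<open>Naturality of the counit, triangle identities, extensions and functoriality\<close>

lemma FRg_map_unit: "FRg_map_obj f (unit_ctx t) = unit_ctx (f t)"
  by (auto simp: unit_ctx_def compose_def)

text \<open>Both composites are regular functors on contexts, so isomorphisms at unary contexts
  extend. There both values are isomorphic to \<open>ObjMap H r\<close>: one by applying
  \<open>H\<close> to a projection, the other by a projection in \<open>R'\<close>.\<close>

lemma counit_natural:
  assumes R: "regular_category R" and R': "regular_category R'"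
    and E: "is_counit R Supp p E" and E': "is_counit R' Supp' p' E'" and H: "regular_functor R R' H"
  shows "nat_isos (FRg (Obj R)) R' (comp_funct H E) (comp_funct E' (FRg_map (Ob_map R H))) \<noteq> {}"
proof -
  interpret E: counit R Supp p E using R E by unfold_locales
  interpret E': counit R' Supp' p' E' using R' E' by unfold_locales
  have fH: "is_functor R R' H" using H unfolding regular_functor_def by simp
  have Ho: "Ob_map R H \<in> Obj R \<rightarrow> Obj R'" using fH unfolding is_functor_def Ob_map_def by auto
  let ?F = "comp_funct H E" and ?G = "comp_funct E' (FRg_map (Ob_map R H))"
  have F: "regular_functor (FRg (Obj R)) R' ?F" using regular_functor_comp[OF E.is_regular_functor H] .
  have G: "regular_functor (FRg (Obj R)) R' ?G"
    using regular_functor_comp[OF regular_functor_FRg_map[OF Ho] E'.is_regular_functor] .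
  have "\<exists>a. a \<in> isos R' (ObjMap ?F (unit_ctx r)) (ObjMap ?G (unit_ctx r))" if r: "r \<in> Obj R" for r
  proof -
    have Hr: "ObjMap H r \<in> Obj R'" using fH r unfolding is_functor_def by auto
    have 1: "ArrMap H (p (unit_ctx r) (Inl 1)) \<in> isos R' (ObjMap ?F (unit_ctx r)) (ObjMap H r)"
      using functor_isos[OF fH E.proj_unit_iso[OF r]] unfolding FRg_unit_eq[OF r] by (simp add: comp_funct_def)
    have "p' (unit_ctx (ObjMap H r)) (Inl 1) \<in> isos R' (ObjMap ?G (unit_ctx r)) (ObjMap H r)"
      using E'.proj_unit_iso[OF Hr] r unfolding FRg_unit_eq[OF Hr]
      by (simp add: comp_funct_def FRg_map_def FRg_map_unit Ob_map_def)
    then obtain g where "g \<in> isos R' (ObjMap H r) (ObjMap ?G (unit_ctx r))" by (rule isos_inverse)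
    then show ?thesis using isos_comp[OF E'.C 1] by blast
  qed
  then obtain \<alpha> where "\<And>r. r \<in> Obj R \<Longrightarrow> \<alpha> r \<in> isos R' (ObjMap ?F (unit_ctx r)) (ObjMap ?G (unit_ctx r))"
    by metis
  from regular_functor_iso_extension[OF F G this] show ?thesis by blast
qed

lemma FRg_unit_in: "FRg_unit T \<in> T \<rightarrow>\<^sub>E Obj (FRg T)"
proof (rule PiE_I)
  show "FRg_unit T t \<in> Obj (FRg T)" if "t \<in> T" for t
    using unit_ctx_obj[OF that] by (simp add: FRg_unit_eq[OF that] FRg_simps)
qed (simp add: FRg_unit_def)

text \<open>Again by extension from unary contexts, where the projection identifies the value at
  \<open>unit_ctx (unit_ctx t)\<close> with \<open>unit_ctx t\<close>.\<close>

lemma counit_unit: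
  assumes E: "is_counit (FRg T) Supp p E"
  shows "nat_isos (FRg T) (FRg T) (comp_funct E (FRg_map (FRg_unit T))) id_funct \<noteq> {}"
proof -
  interpret E: counit "FRg T" Supp p E using regular_category_FRg E by unfold_locales
  have u: "FRg_unit T \<in> T \<rightarrow> Obj (FRg T)" by (intro funcsetI PiE_mem[OF FRg_unit_in])
  let ?F = "comp_funct E (FRg_map (FRg_unit T))"
  have F: "regular_functor (FRg T) (FRg T) ?F"
    using regular_functor_comp[OF regular_functor_FRg_map[OF u] E.is_regular_functor] .
  have "p (unit_ctx (unit_ctx t)) (Inl 1) \<in> isos (FRg T) (ObjMap ?F (unit_ctx t)) (ObjMap id_funct (unit_ctx t))"
    if t: "t \<in> T" for t
  proof -
    have ut: "unit_ctx t \<in> Obj (FRg T)" using unit_ctx_obj[OF t] by (simp add: FRg_simps)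
    show ?thesis
      using E.proj_unit_iso[OF ut] unfolding FRg_unit_eq[OF ut]
      by (simp add: comp_funct_def FRg_map_def FRg_map_unit FRg_unit_eq[OF t] id_funct_def)
  qed
  from regular_functor_iso_extension[OF F regular_functor_id[OF regular_category_FRg] this]
  show ?thesis by blast
qed

lemma FRg_unit_natural:
  assumes f: "f \<in> T \<rightarrow> T'"
  shows "compose T (Ob_map (FRg T) (FRg_map f)) (FRg_unit T) = compose T (FRg_unit T') f"
proof
  fix t
  show "compose T (Ob_map (FRg T) (FRg_map f)) (FRg_unit T) t = compose T (FRg_unit T') f t"
  proof (cases "t \<in> T")
    case True
    then have "f t \<in> T'" using f by blast
    then show ?thesis
      using True unit_ctx_obj[OF True] FRg_unit_eq[OF True] FRg_unit_eq[of "f t" T']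
      by (simp add: compose_def Ob_map_def FRg_simps FRg_map_def FRg_map_unit)
  qed (simp add: compose_def)
qed

text \<open>Relabel along \<open>g\<close>, then apply a counit that is strict on unary
  contexts.\<close>

lemma extension_exists:
  fixes T :: "'t set"
  assumes R: "regular_category R" and g: "g \<in> T \<rightarrow>\<^sub>E Obj R"
  shows "\<exists>F. regular_functor (FRg T) R F \<and> compose T (Ob_map (FRg T) F) (FRg_unit T) = g"
proof -
  obtain Supp p E where E: "is_counit R Supp p E" and Er: "\<And>r. r \<in> Obj R \<Longrightarrow> ObjMap E (unit_ctx r) = r"
    using counit_exists[OF R] by blast
  interpret E: counit R Supp p E using R E by unfold_locales
  have g': "g \<in> T \<rightarrow> Obj R" using g by auto
  let ?F = "comp_funct E (FRg_map g)"
  have "compose T (Ob_map (FRg T) ?F) (FRg_unit T) t = g t" for t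
  proof (cases "t \<in> T")
    case True
    then show ?thesis
      using unit_ctx_obj[OF True] FRg_unit_eq[OF True] Er[of "g t"] g'
      by (auto simp: compose_def Ob_map_def FRg_simps FRg_map_def FRg_map_unit comp_funct_def)
  next
    case False
    then show ?thesis using g by (auto simp: compose_def PiE_def extensional_def)
  qed
  then show ?thesis
    using regular_functor_comp[OF regular_functor_FRg_map[OF g'] E.is_regular_functor] by blast
qed

lemma FRg_map_id: "funct_eq (FRg T) (FRg_map (\<lambda>t\<in>T. t)) id_funct"
proof -
  have o: "FRg_map_obj (\<lambda>t\<in>T. t) \<Gamma> = \<Gamma>" if "\<Gamma> \<in> FRg_obj T" for \<Gamma>
  proof -
    have "compose {1..len \<Gamma>} (\<lambda>t\<in>T. t) (tau \<Gamma>) = tau \<Gamma>"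
      using that by (intro extensionalityI[of _ "{1..len \<Gamma>}"]) (auto simp: FRg_obj_iff compose_def PiE_def)
    moreover have "(\<lambda>t\<in>T. t) ` sorts \<Gamma> = sorts \<Gamma>" using that by (auto simp: FRg_obj_iff image_iff)
    ultimately show ?thesis by (cases \<Gamma>) simp
  qed
  have "ArrMap (FRg_map (\<lambda>t\<in>T. t)) u = u" if "u \<in> Arr (FRg T)" for u
    using o[OF FRg_homD(1)[OF arr_hom[OF that]]] o[OF FRg_homD(2)[OF arr_hom[OF that]]]
    by (cases u) (simp add: FRg_map_def FRg_simps)
  then show ?thesis using o by (auto simp: funct_eq_def id_funct_def FRg_map_def FRg_simps)
qed

lemma FRg_map_compose:
  "funct_eq (FRg T) (FRg_map (compose T g f)) (comp_funct (FRg_map g) (FRg_map f))"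
proof -
  have o: "FRg_map_obj (compose T g f) \<Gamma> = FRg_map_obj g (FRg_map_obj f \<Gamma>)" if "\<Gamma> \<in> FRg_obj T" for \<Gamma>
  proof -
    have "compose {1..len \<Gamma>} (compose T g f) (tau \<Gamma>) = compose {1..len \<Gamma>} g (compose {1..len \<Gamma>} f (tau \<Gamma>))"
      using FRg_tau(2)[OF that]
      by (intro extensionalityI[of _ "{1..len \<Gamma>}"]) (auto simp: compose_def)
    moreover have "compose T g f ` sorts \<Gamma> = g ` f ` sorts \<Gamma>"
      using that unfolding image_image FRg_obj_iff by (intro image_cong) (auto simp: compose_def)
    ultimately show ?thesis by (cases \<Gamma>) simp
  qed
  have "ArrMap (FRg_map (compose T g f)) u = ArrMap (comp_funct (FRg_map g) (FRg_map f)) u"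
    if "u \<in> Arr (FRg T)" for u
    using o[OF FRg_homD(1)[OF arr_hom[OF that]]] o[OF FRg_homD(2)[OF arr_hom[OF that]]]
    by (cases u) (simp add: FRg_map_def FRg_simps comp_funct_def)
  then show ?thesis using o by (auto simp: funct_eq_def comp_funct_def FRg_map_def FRg_simps)
qed

theorem theorem4p11:
  fixes T :: "'t set" and T' :: "'s set" and T'' :: "'r set"
    and R :: "('o, 'a) precategory" and R' :: "('p, 'b) precategory"
  assumes "regular_category R" and "regular_category R'"
  shows
    \<comment> \<open>\<open>FRg\<close> is a functor from sets to regular categories\<close>
    "regular_category (FRg T) \<and>
     (\<forall>f \<in> T \<rightarrow>\<^sub>E T'. regular_functor (FRg T) (FRg T') (FRg_map f)) \<and>
     funct_eq (FRg T) (FRg_map (\<lambda>t\<in>T. t)) id_funct \<and>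
     (\<forall>f \<in> T \<rightarrow>\<^sub>E T'. \<forall>g \<in> T' \<rightarrow>\<^sub>E T''.
        funct_eq (FRg T) (FRg_map (compose T g f)) (comp_funct (FRg_map g) (FRg_map f))) \<and>
     \<comment> \<open>the unit is a natural transformation from the identity to \<open>Ob \<circ> FRg\<close>\<close>
     FRg_unit T \<in> T \<rightarrow>\<^sub>E Obj (FRg T) \<and>
     (\<forall>f \<in> T \<rightarrow>\<^sub>E T'.
        compose T (Ob_map (FRg T) (FRg_map f)) (FRg_unit T) = compose T (FRg_unit T') f) \<and>
     \<comment> \<open>\<open>F \<mapsto> Ob F \<circ> unit\<close> is onto, and injective up to unique natural isomorphism\<close>
     (\<forall>g \<in> T \<rightarrow>\<^sub>E Obj R. \<exists>F. regular_functor (FRg T) R F \<and>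
        compose T (Ob_map (FRg T) F) (FRg_unit T) = g) \<and>
     (\<forall>F G. regular_functor (FRg T) R F \<and> regular_functor (FRg T) R G \<longrightarrow>
        (\<forall>\<alpha>. (\<forall>t\<in>T. \<alpha> t \<in> isos R (ObjMap F (FRg_unit T t)) (ObjMap G (FRg_unit T t))) \<longrightarrow>
          (\<exists>!\<beta>. \<beta> \<in> nat_isos (FRg T) R F G \<and> (\<forall>t\<in>T. \<beta> (FRg_unit T t) = \<alpha> t)))) \<and>
     \<comment> \<open>the counit exists, is a regular functor, and is natural up to natural isomorphism\<close>
     (\<exists>Supp p E. is_counit R Supp p E) \<and>
     (\<forall>Supp p E. is_counit R Supp p E \<longrightarrow> regular_functor (FRg (Obj R)) R E) \<and>
     (\<forall>Supp p E Supp' p' E' H.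
        is_counit R Supp p E \<and> is_counit R' Supp' p' E' \<and> regular_functor R R' H \<longrightarrow>
        nat_isos (FRg (Obj R)) R' (comp_funct H E) (comp_funct E' (FRg_map (Ob_map R H))) \<noteq> {}) \<and>
     \<comment> \<open>the two triangle identities, up to isomorphism\<close>
     (\<forall>Supp p E. is_counit R Supp p E \<longrightarrow>
        (\<forall>r\<in>Obj R. p (FRg_unit (Obj R) r) (Inl 1) \<in> isos R (ObjMap E (FRg_unit (Obj R) r)) r)) \<and>
     (\<forall>Supp p E. is_counit (FRg T) Supp p E \<longrightarrow>
        nat_isos (FRg T) (FRg T) (comp_funct E (FRg_map (FRg_unit T))) id_funct \<noteq> {})"
proof (intro conjI)
  show "\<forall>f \<in> T \<rightarrow>\<^sub>E T'. regular_functor (FRg T) (FRg T') (FRg_map f)"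
    by (intro ballI regular_functor_FRg_map) auto
  show "\<forall>f \<in> T \<rightarrow>\<^sub>E T'.
      compose T (Ob_map (FRg T) (FRg_map f)) (FRg_unit T) = compose T (FRg_unit T') f"
    by (intro ballI FRg_unit_natural) auto
  show "\<forall>F G. regular_functor (FRg T) R F \<and> regular_functor (FRg T) R G \<longrightarrow>
      (\<forall>\<alpha>. (\<forall>t\<in>T. \<alpha> t \<in> isos R (ObjMap F (FRg_unit T t)) (ObjMap G (FRg_unit T t))) \<longrightarrow>
        (\<exists>!\<beta>. \<beta> \<in> nat_isos (FRg T) R F G \<and> (\<forall>t\<in>T. \<beta> (FRg_unit T t) = \<alpha> t)))"
  proof (intro allI impI)
    fix F G \<alpha>
    assume FG: "regular_functor (FRg T) R F \<and> regular_functor (FRg T) R G"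
      and "\<forall>t\<in>T. \<alpha> t \<in> isos R (ObjMap F (FRg_unit T t)) (ObjMap G (FRg_unit T t))"
    then have "\<alpha> t \<in> isos R (ObjMap F (unit_ctx t)) (ObjMap G (unit_ctx t))" if "t \<in> T" for t
      using that FRg_unit_eq[OF that] by metis
    from regular_functor_iso_extension[OF conjunct1[OF FG] conjunct2[OF FG] this]
    show "\<exists>!\<beta>. \<beta> \<in> nat_isos (FRg T) R F G \<and> (\<forall>t\<in>T. \<beta> (FRg_unit T t) = \<alpha> t)"
      using FRg_unit_eq[of _ T] by (simp cong: ball_cong)
  qed
  show "\<exists>Supp p E. is_counit R Supp p E"
    by (rule counit_exists[OF assms(1)]) blast
  show "\<forall>Supp p E. is_counit R Supp p E \<longrightarrow> regular_functor (FRg (Obj R)) R E"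
    using counit.is_regular_functor[OF counit.intro[OF assms(1)]] by blast
  show "\<forall>Supp p E. is_counit R Supp p E \<longrightarrow>
      (\<forall>r\<in>Obj R. p (FRg_unit (Obj R) r) (Inl 1) \<in> isos R (ObjMap E (FRg_unit (Obj R) r)) r)"
    using counit.proj_unit_iso[OF counit.intro[OF assms(1)]] by blast
  show "\<forall>Supp p E. is_counit (FRg T) Supp p E \<longrightarrow>
      nat_isos (FRg T) (FRg T) (comp_funct E (FRg_map (FRg_unit T))) id_funct \<noteq> {}"
    using counit_unit by blast
  show "\<forall>Supp p E Supp' p' E' H.
      is_counit R Supp p E \<and> is_counit R' Supp' p' E' \<and> regular_functor R R' H \<longrightarrow>
      nat_isos (FRg (Obj R)) R' (comp_funct H E) (comp_funct E' (FRg_map (Ob_map R H))) \<noteq> {}"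
    using counit_natural[OF assms] by blast
  show "\<forall>g \<in> T \<rightarrow>\<^sub>E Obj R. \<exists>F. regular_functor (FRg T) R F \<and>
      compose T (Ob_map (FRg T) F) (FRg_unit T) = g"
    using extension_exists[OF assms(1)] by blast
  show "\<forall>f \<in> T \<rightarrow>\<^sub>E T'. \<forall>g \<in> T' \<rightarrow>\<^sub>E T''.
      funct_eq (FRg T) (FRg_map (compose T g f)) (comp_funct (FRg_map g) (FRg_map f))"
    by (intro ballI FRg_map_compose)
qed (rule regular_category_FRg FRg_map_id FRg_unit_in)+

end
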